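(* Let $e_1,e_2,e_3$ be nonzero integers with $e_1+e_2+e_3=0$, $\gcd(e_1,e_2,e_3)\in\{1,2\}$, $e_1,e_2$ odd and $2\,\|\,e_3$. Let $n=p_1\cdots p_k$ be an odd positive square-free integer coprime with $e_1e_2e_3$, whose prime factors are quadratic residues modulo each odd prime factor of $e_1e_2e_3$. If $\mathrm{Sel}_2(E/\mathbb{Q})\cong(\mathbb{Z}/2\mathbb{Z})^2$, then every class of $\mathrm{Sel}_2'(E^{(n)})$ has a unique representative $(d_1,d_2,d_3)$ with each $d_i$ a positive divisor of $n$, and the map $(d_1,d_2,d_3)\mapsto\begin{pmatrix}\mathbf{x}\\ \mathbf{y}\end{pmatrix}$, where $\mathbf{x}=(v_{p_i}(d_1))_{i}^{\mathrm T}$, $\mathbf{y}=(v_{p_i}(d_2))_i^{\mathrm T}\in\mathbb{F}_2^k$, induces an isomorphism $$\mathrm{Sel}_2'(E^{(n)})\xrightarrow{\sim}\ker\begin{pmatrix}\mathbf{A}+\mathbf{D}_{-e_3}&\mathbf{D}_{-e_2e_3}\\ \mathbf{D}_{-e_1e_3}&\mathbf{A}+\mathbf{D}_{e_3}\end{pmatrix}.$$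
   Context: For a nonzero integer $m$, $E^{(m)}$ is $y^2=x(x-e_1m)(x+e_2m)$, $E=E^{(1)}$. For $\Lambda=(d_1,d_2,d_3)$ of nonzero square-free integers with $d_1d_2d_3$ a square, $D^{(m)}_\Lambda\subset\mathbb{P}^3$ is defined by $e_1mt^2+d_2u_2^2-d_3u_3^2=0$, $e_2mt^2+d_3u_3^2-d_1u_1^2=0$, $e_3mt^2+d_1u_1^2-d_2u_2^2=0$. $\mathrm{Sel}_2(E^{(m)}/\mathbb{Q})$ is identified with the group (componentwise multiplication) of $\Lambda\in(\mathbb{Q}^\times/\mathbb{Q}^{\times2})^3$ with $d_1d_2d_3\in\mathbb{Q}^{\times2}$ and $D^{(m)}_\Lambda(\mathbb{A}_{\mathbb{Q}})\ne\emptyset$; rational 2-torsion points correspond to $(1,1,1)$, $(-e_3m,-e_1e_3,e_1m)$, $(-e_2e_3,e_3m,-e_2m)$, $(e_2m,-e_1m,-e_1e_2)$. $\mathrm{Sel}_2'(E^{(m)})=\mathrm{Sel}_2(E^{(m)}/\mathbb{Q})/(E^{(m)}(\mathbb{Q})_{\rm tors}/2E^{(m)}(\mathbb{Q})_{\rm tors})$. $[\alpha,\beta]_v\in\mathbb{F}_2$ is the additive Hilbert symbol, $(\alpha,\beta)_v=(-1)^{[\alpha,\beta]_v}$. $\mathbf{A}=([p_j,-n]_{p_i})_{i,j}\in M_k(\mathbb{F}_2)$. For an integer $u$ coprime to $n$, $\mathbf{D}_u=\mathrm{diag}([u/p_1],\dots,[u/p_k])$, where $[u/p]\in\mathbb{F}_2$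 is $0$ if $u$ is a quadratic residue mod $p$ and $1$ otherwise. $2\,\|\,m$ means $2\mid m$, $4\nmid m$. *)

theory Defs
  imports "HOL-Number_Theory.Number_Theory" "HOL-Computational_Algebra.Squarefree"
begin

definition D_eqs :: "int \<Rightarrow> int \<Rightarrow> int \<Rightarrow> int \<Rightarrow> int \<times> int \<times> int
    \<Rightarrow> 'a::comm_ring_1 \<Rightarrow> 'a \<Rightarrow> 'a \<Rightarrow> 'a \<Rightarrow> 'a list" where
  "D_eqs e1 e2 e3 m L t u1 u2 u3 = (case L of (d1, d2, d3) \<Rightarrow>
     [of_int (e1*m) * t^2 + of_int d2 * u2^2 - of_int d3 * u3^2,
      of_int (e2*m) * t^2 + of_int d3 * u3^2 - of_int d1 * u1^2,
      of_int (e3*m) * t^2 + of_int d1 * u1^2 - of_int d2 * u2^2])"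

text \<open>Q_p-point of the projective variety: for homogeneous integral forms this is equivalent
  (Hensel/compactness of Z_p^4) to primitive integral solutions modulo every p^N.\<close>
definition D_padic_point :: "nat \<Rightarrow> int \<Rightarrow> int \<Rightarrow> int \<Rightarrow> int \<Rightarrow> int \<times> int \<times> int \<Rightarrow> bool" where
  "D_padic_point p e1 e2 e3 m L \<longleftrightarrow>
     (\<forall>N::nat. \<exists>t u1 u2 u3 :: int.
        \<not> (int p dvd t \<and> int p dvd u1 \<and> int p dvd u2 \<and> int p dvd u3) \<and>
        (\<forall>f \<in> set (D_eqs e1 e2 e3 m L t u1 u2 u3). int p ^ N dvd f))"

definition D_real_point :: "int \<Rightarrow> int \<Rightarrow> int \<Rightarrow> int \<Rightarrow> int \<times> int \<times> int \<Rightarrow> bool" where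
  "D_real_point e1 e2 e3 m L \<longleftrightarrow>
     (\<exists>t u1 u2 u3 :: real. (t, u1, u2, u3) \<noteq> (0, 0, 0, 0) \<and>
        (\<forall>f \<in> set (D_eqs e1 e2 e3 m L t u1 u2 u3). f = 0))"

definition D_adelic_point :: "int \<Rightarrow> int \<Rightarrow> int \<Rightarrow> int \<Rightarrow> int \<times> int \<times> int \<Rightarrow> bool" where
  "D_adelic_point e1 e2 e3 m L \<longleftrightarrow>
     D_real_point e1 e2 e3 m L \<and> (\<forall>p. prime p \<longrightarrow> D_padic_point p e1 e2 e3 m L)"

definition is_square :: "int \<Rightarrow> bool" where
  "is_square x \<longleftrightarrow> (\<exists>k. x = k^2)"

text \<open>Sel_2(E^(m)/Q), elements of (Q^x/Q^x2)^3 represented by squarefree integers.\<close>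
definition Sel2 :: "int \<Rightarrow> int \<Rightarrow> int \<Rightarrow> int \<Rightarrow> (int \<times> int \<times> int) set" where
  "Sel2 e1 e2 e3 m = {(d1, d2, d3). d1 \<noteq> 0 \<and> d2 \<noteq> 0 \<and> d3 \<noteq> 0 \<and>
      squarefree d1 \<and> squarefree d2 \<and> squarefree d3 \<and> is_square (d1*d2*d3) \<and>
      D_adelic_point e1 e2 e3 m (d1, d2, d3)}"

text \<open>Images of the rational 2-torsion points.\<close>
definition tors :: "int \<Rightarrow> int \<Rightarrow> int \<Rightarrow> int \<Rightarrow> (int \<times> int \<times> int) list" where
  "tors e1 e2 e3 m = [(1, 1, 1), (-e3*m, -e1*e3, e1*m), (-e2*e3, e3*m, -e2*m), (e2*m, -e1*m, -e1*e2)]"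

text \<open>Same class in Sel_2' = Sel_2 / torsion image (equality in (Q^x/Q^x2)^3 up to torsion).\<close>
definition sel_equiv :: "int \<Rightarrow> int \<Rightarrow> int \<Rightarrow> int \<Rightarrow> int \<times> int \<times> int \<Rightarrow> int \<times> int \<times> int \<Rightarrow> bool" where
  "sel_equiv e1 e2 e3 m L L' \<longleftrightarrow> (case L of (a1, a2, a3) \<Rightarrow> case L' of (b1, b2, b3) \<Rightarrow>
     (\<exists>(c1, c2, c3) \<in> set (tors e1 e2 e3 m).
        is_square (a1*b1*c1) \<and> is_square (a2*b2*c2) \<and> is_square (a3*b3*c3)))"

text \<open>Group law on squarefree representatives.\<close>
definition sqmul :: "int \<Rightarrow> int \<Rightarrow> int" where
  "sqmul a b = (a * b) div (gcd a b)^2"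

definition mul3 :: "int \<times> int \<times> int \<Rightarrow> int \<times> int \<times> int \<Rightarrow> int \<times> int \<times> int" where
  "mul3 L L' = (case L of (a1, a2, a3) \<Rightarrow> case L' of (b1, b2, b3) \<Rightarrow>
     (sqmul a1 b1, sqmul a2 b2, sqmul a3 b3))"

definition posdiv_triple :: "nat \<Rightarrow> int \<times> int \<times> int \<Rightarrow> bool" where
  "posdiv_triple n L \<longleftrightarrow> (case L of (d1, d2, d3) \<Rightarrow>
     0 < d1 \<and> d1 dvd int n \<and> 0 < d2 \<and> d2 dvd int n \<and> 0 < d3 \<and> d3 dvd int n)"

text \<open>Additive Hilbert symbol [a,b]_p in F_2 = {0,1}: 0 iff z^2 = a x^2 + b y^2 has a
  nontrivial solution over Q_p (expressed via primitive solutions mod p^N).\<close>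
definition hilb :: "nat \<Rightarrow> int \<Rightarrow> int \<Rightarrow> nat" where
  "hilb p a b = (if (\<forall>N::nat. \<exists>x y z :: int.
       \<not> (int p dvd x \<and> int p dvd y \<and> int p dvd z) \<and> int p ^ N dvd (a*x^2 + b*y^2 - z^2))
     then 0 else 1)"

definition qr_bit :: "int \<Rightarrow> nat \<Rightarrow> nat" where
  "qr_bit u p = (if QuadRes (int p) u then 0 else 1)"

definition matA :: "nat list \<Rightarrow> nat \<Rightarrow> nat \<Rightarrow> nat" where
  "matA ps i j = hilb (ps ! i) (int (ps ! j)) (- int (prod_list ps))"

definition matD :: "int \<Rightarrow> nat list \<Rightarrow> nat \<Rightarrow> nat \<Rightarrow> nat" where
  "matD u ps i j = (if i = j then qr_bit u (ps ! i) else 0)"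

definition selmat :: "int \<Rightarrow> int \<Rightarrow> int \<Rightarrow> nat list \<Rightarrow> nat \<Rightarrow> nat \<Rightarrow> nat" where
  "selmat e1 e2 e3 ps i j = (let k = length ps in
     if i < k \<and> j < k then (matA ps i j + matD (-e3) ps i j) mod 2
     else if i < k then matD (-e2*e3) ps i (j - k)
     else if j < k then matD (-e1*e3) ps (i - k) j
     else (matA ps (i - k) (j - k) + matD e3 ps (i - k) (j - k)) mod 2)"

definition kerF2 :: "(nat \<Rightarrow> nat \<Rightarrow> nat) \<Rightarrow> nat \<Rightarrow> nat list set" where
  "kerF2 M K = {v. length v = K \<and> set v \<subseteq> {0, 1} \<and>
      (\<forall>i<K. even (\<Sum>j<K. M i j * v ! j))}"

definition vadd2 :: "nat list \<Rightarrow> nat list \<Rightarrow> nat list" where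
  "vadd2 v w = map2 (\<lambda>a b. (a + b) mod 2) v w"

definition phi :: "nat list \<Rightarrow> int \<times> int \<times> int \<Rightarrow> nat list" where
  "phi ps L = (case L of (d1, d2, d3) \<Rightarrow>
     map (\<lambda>p. multiplicity (int p) d1 mod 2) ps @ map (\<lambda>p. multiplicity (int p) d2 mod 2) ps)"

end

theory Submission
  imports Defs
begin

text \<open>
  Let \<open>\<Lambda> = (d1, d2, d3)\<close> have odd entries. Each of the three quadrics cutting out the 2-covering is a conic, and
  by Legendre's theorem a conic solvable at the real place and at all odd primes has a rational point. Reading
  the three rational points modulo 8 shows that the covering is automatically solvable at 2. (This plays
  the role of Hilbert reciprocity.)

  Translating by torsion, every Selmer element of the twist can be made odd. Removing the common factors with
  \<open>n\<close> from its entries gives an odd element of the Selmer group of \<open>E\<close>: the primes dividing \<open>n\<close> are squares at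
  the odd primes of bad reduction, good primes impose no condition, and the prime 2 is automatic. That group is
  the torsion image, so after one more translation by \<open>(e2 n, -e1 n, -e1 e2)\<close> the entries are positive divisors of
  \<open>n\<close>. Uniqueness holds because \<open>-e1 e2 \<equiv> 3\<close> modulo 4 is not a square.

  For positive divisors of \<open>n\<close> only the primes \<open>p\<close> dividing \<open>n\<close> impose conditions. There the covering is soluble iff
  \<open>\<Lambda>\<close> agrees locally with a torsion image, which amounts to the two rows of the matrix belonging to \<open>p\<close>.
\<close>

section \<open>Local solvability of the 2-coverings\<close>

text \<open>All p-adic conditions are congruences modulo every p^N with primitive coordinates. A
  change of variables may spoil primitivity, but only by a power of p that is fixed by its nonzero
  coefficients and independent of N; the introduction rules ending in \<open>_bounded\<close> absorb
  this loss, and every \<open>M\<close> below is such a bound.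

  At good primes a point on a genus one curve has to be found. Its count involves a cubic character
  sum of unknown size, and this sum cancels when the count is compared with that of the trivial
  class.

  The hypothesis on the Selmer group of E enters once, by counting: the four torsion images are
  pairwise distinct, so an odd element outside them would be a fifth one.

  Closure of the representatives under multiplication is not checked place by place. It is inherited
  from the kernel of the matrix, once membership has been translated into the kernel
  condition.\<close>

lemma common_power_bound:
  fixes q :: "'a::comm_semiring_1"
  assumes "\<not> (\<forall>x\<in>S. q ^ M dvd x)"
  shows "\<exists>k<M. (\<forall>x\<in>S. q ^ k dvd x) \<and> \<not> (\<forall>x\<in>S. q ^ Suc k dvd x)"
  using assms
proof (induction M)
  case 0
  then show ?case by simp
next
  case (Suc M)
  show ?case
  proof (cases "\<forall>x\<in>S. q ^ M dvd x")
    case True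
    then show ?thesis using Suc.prems by blast
  next
    case False
    from Suc.IH[OF False] show ?thesis using less_SucI by blast
  qed
qed

text \<open>The test inside \<open>hilb\<close>, kept as a proposition so that the descent can work
  without the 0/1 coding.\<close>

definition conic_solvable :: "nat \<Rightarrow> int \<Rightarrow> int \<Rightarrow> bool" where
  "conic_solvable p a b \<longleftrightarrow> (\<forall>N::nat. \<exists>x y z :: int.
     \<not> (int p dvd x \<and> int p dvd y \<and> int p dvd z) \<and> int p ^ N dvd (a*x^2 + b*y^2 - z^2))"

lemma hilb_eq_0_iff: "hilb p a b = 0 \<longleftrightarrow> conic_solvable p a b"
  by (simp add: hilb_def conic_solvable_def)

text \<open>Stands in for compactness: the exact common power p^k of the coordinates is divided out.
  The form is quadratic, so this costs p^(2k), and k < M for every N; precision N + 2M is therefore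
  enough.\<close>

lemma conic_solvableI_bounded:
  assumes p: "prime p"
    and ex: "\<And>N. \<exists>x y z. \<not> (int p ^ M dvd x \<and> int p ^ M dvd y \<and> int p ^ M dvd z)
               \<and> int p ^ N dvd (a*x^2 + b*y^2 - z^2)"
  shows "conic_solvable p a b"
  unfolding conic_solvable_def
proof
  fix N
  obtain x y z where nd: "\<not> (int p ^ M dvd x \<and> int p ^ M dvd y \<and> int p ^ M dvd z)"
    and eq: "int p ^ (N + 2*M) dvd (a*x^2 + b*y^2 - z^2)" using ex by blast
  have "\<not> (\<forall>w\<in>{x,y,z}. int p ^ M dvd w)" using nd by simp
  from common_power_bound[OF this] obtain k where k: "k < M"
    and dv: "\<forall>w\<in>{x,y,z}. int p ^ k dvd w" and ndv: "\<not> (\<forall>w\<in>{x,y,z}. int p ^ Suc k dvd w)"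
    by blast
  from dv obtain x' y' z' where s: "x = int p ^ k * x'" "y = int p ^ k * y'" "z = int p ^ k * z'"
    by (auto elim!: dvdE)
  have 1: "\<not> (int p dvd x' \<and> int p dvd y' \<and> int p dvd z')"
    using ndv unfolding s by (auto simp: mult_dvd_mono mult.commute)
  have A: "a*x^2 + b*y^2 - z^2 = int p ^ (2*k) * (a*x'^2 + b*y'^2 - z'^2)"
    unfolding s by (simp add: power_mult_distrib power_mult[symmetric] algebra_simps)
  have B: "int p ^ (2*k) * int p ^ N dvd int p ^ (N + 2*M)"
    unfolding power_add[symmetric] using k by (intro le_imp_power_dvd) simp
  have "int p ^ (2*k) * int p ^ N dvd int p ^ (2*k) * (a*x'^2 + b*y'^2 - z'^2)"
    using dvd_trans[OF B eq] unfolding A .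
  then have "int p ^ N dvd (a*x'^2 + b*y'^2 - z'^2)" using prime_gt_0_nat[OF p] by simp
  then show "\<exists>x y z. \<not> (int p dvd x \<and> int p dvd y \<and> int p dvd z)
               \<and> int p ^ N dvd (a*x^2 + b*y^2 - z^2)" using 1 by blast
qed

lemma D_padic_pointD:
  assumes "D_padic_point p e1 e2 e3 m (d1, d2, d3)"
  obtains t u1 u2 u3 where "\<not> (int p dvd t \<and> int p dvd u1 \<and> int p dvd u2 \<and> int p dvd u3)"
    "int p ^ N dvd e1*m*t^2 + d2*u2^2 - d3*u3^2"
    "int p ^ N dvd e2*m*t^2 + d3*u3^2 - d1*u1^2"
    "int p ^ N dvd e3*m*t^2 + d1*u1^2 - d2*u2^2"
proof -
  from assms[unfolded D_padic_point_def, rule_format, of N] obtain t u1 u2 u3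
    where s: "\<not> (int p dvd t \<and> int p dvd u1 \<and> int p dvd u2 \<and> int p dvd u3)"
      "\<forall>f\<in>set (D_eqs e1 e2 e3 m (d1, d2, d3) t u1 u2 u3). int p ^ N dvd f"
    by (elim exE conjE)
  show thesis by (rule that[OF s(1)]) (use s(2) in \<open>simp_all add: D_eqs_def\<close>)
qed

text \<open>The third equation is redundant because the three quadrics sum to zero.\<close>
lemma D_padic_pointI_bounded:
  assumes p: "prime p" and e: "e1 + e2 + e3 = (0::int)"
    and ex: "\<And>N. \<exists>t u1 u2 u3. \<not> (int p ^ M dvd t \<and> int p ^ M dvd u1 \<and> int p ^ M dvd u2 \<and> int p ^ M dvd u3)
               \<and> int p ^ N dvd e1*m*t^2 + d2*u2^2 - d3*u3^2
               \<and> int p ^ N dvd e2*m*t^2 + d3*u3^2 - d1*u1^2"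
  shows "D_padic_point p e1 e2 e3 m (d1, d2, d3)"
  unfolding D_padic_point_def
proof
  fix N
  obtain t u1 u2 u3 where nd: "\<not> (int p ^ M dvd t \<and> int p ^ M dvd u1 \<and> int p ^ M dvd u2 \<and> int p ^ M dvd u3)"
    and eq1: "int p ^ (N + 2*M) dvd e1*m*t^2 + d2*u2^2 - d3*u3^2"
    and eq2: "int p ^ (N + 2*M) dvd e2*m*t^2 + d3*u3^2 - d1*u1^2" using ex by blast
  have "\<not> (\<forall>w\<in>{t,u1,u2,u3}. int p ^ M dvd w)" using nd by simp
  from common_power_bound[OF this] obtain k where k: "k < M"
    and dv: "\<forall>w\<in>{t,u1,u2,u3}. int p ^ k dvd w" and ndv: "\<not> (\<forall>w\<in>{t,u1,u2,u3}. int p ^ Suc k dvd w)"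
    by blast
  from dv obtain t' x' y' z' where s: "t = int p ^ k * t'" "u1 = int p ^ k * x'" "u2 = int p ^ k * y'" "u3 = int p ^ k * z'"
    by (auto elim!: dvdE)
  have 1: "\<not> (int p dvd t' \<and> int p dvd x' \<and> int p dvd y' \<and> int p dvd z')"
    using ndv unfolding s by (auto simp: mult_dvd_mono mult.commute)
  have *: "int p ^ (2*k) * int p ^ N dvd int p ^ (N + 2*M)"
    unfolding power_add[symmetric] using k by (intro le_imp_power_dvd) simp
  have A: "e1*m*t^2 + d2*u2^2 - d3*u3^2 = int p ^ (2*k) * (e1*m*t'^2 + d2*y'^2 - d3*z'^2)"
    unfolding s by (simp add: power_mult_distrib power_mult[symmetric] algebra_simps)
  have "int p ^ (2*k) * int p ^ N dvd int p ^ (2*k) * (e1*m*t'^2 + d2*y'^2 - d3*z'^2)"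
    using dvd_trans[OF * eq1] unfolding A .
  then have a: "int p ^ N dvd (e1*m*t'^2 + d2*y'^2 - d3*z'^2)" using prime_gt_0_nat[OF p] by simp
  have B: "e2*m*t^2 + d3*u3^2 - d1*u1^2 = int p ^ (2*k) * (e2*m*t'^2 + d3*z'^2 - d1*x'^2)"
    unfolding s by (simp add: power_mult_distrib power_mult[symmetric] algebra_simps)
  have "int p ^ (2*k) * int p ^ N dvd int p ^ (2*k) * (e2*m*t'^2 + d3*z'^2 - d1*x'^2)"
    using dvd_trans[OF * eq2] unfolding B .
  then have b: "int p ^ N dvd (e2*m*t'^2 + d3*z'^2 - d1*x'^2)" using prime_gt_0_nat[OF p] by simp
  have e3: "e3 = - e1 - e2" using e by simp
  have C: "e3*m*t'^2 + d1*x'^2 - d2*y'^2 = - (e1*m*t'^2 + d2*y'^2 - d3*z'^2) - (e2*m*t'^2 + d3*z'^2 - d1*x'^2)"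
    unfolding e3 by (simp add: algebra_simps)
  have c: "int p ^ N dvd e3*m*t'^2 + d1*x'^2 - d2*y'^2"
    unfolding C by (rule dvd_diff[OF iffD2[OF dvd_minus_iff a] b])
  show "\<exists>t u1 u2 u3. \<not> (int p dvd t \<and> int p dvd u1 \<and> int p dvd u2 \<and> int p dvd u3) \<and>
        (\<forall>f\<in>set (D_eqs e1 e2 e3 m (d1, d2, d3) t u1 u2 u3). int p ^ N dvd f)"
    by (rule exI[of _ t'], rule exI[of _ x'], rule exI[of _ y'], rule exI[of _ z'])
      (use 1 a b c in \<open>simp add: D_eqs_def\<close>)
qed

text \<open>A cyclic shift of the indices permutes the three quadrics. Local statements below single
  out one index and are moved to the others by this lemma.\<close>

lemma D_padic_point_rotate:
  assumes "D_padic_point p e1 e2 e3 m (d1, d2, d3)"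
  shows "D_padic_point p e2 e3 e1 m (d2, d3, d1)"
  unfolding D_padic_point_def
proof
  fix N
  obtain t u1 u2 u3 where "\<not> (int p dvd t \<and> int p dvd u1 \<and> int p dvd u2 \<and> int p dvd u3)"
    "int p ^ N dvd e1*m*t^2 + d2*u2^2 - d3*u3^2"
    "int p ^ N dvd e2*m*t^2 + d3*u3^2 - d1*u1^2"
    "int p ^ N dvd e3*m*t^2 + d1*u1^2 - d2*u2^2"
    using D_padic_pointD[OF assms] by metis
  then show "\<exists>t u1 u2 u3. \<not> (int p dvd t \<and> int p dvd u1 \<and> int p dvd u2 \<and> int p dvd u3) \<and>
        (\<forall>f\<in>set (D_eqs e2 e3 e1 m (d2, d3, d1) t u1 u2 u3). int p ^ N dvd f)"
    by - (rule exI[of _ t], rule exI[of _ u2], rule exI[of _ u3], rule exI[of _ u1], auto simp add: D_eqs_def)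
qed

lemma D_real_pointE:
  assumes "D_real_point e1 e2 e3 m (d1, d2, d3)"
  obtains t u1 u2 u3 :: real where "t \<noteq> 0 \<or> u1 \<noteq> 0 \<or> u2 \<noteq> 0 \<or> u3 \<noteq> 0"
     "of_int e1 * of_int m * t^2 + of_int d2 * u2^2 - of_int d3 * u3^2 = 0"
     "of_int e2 * of_int m * t^2 + of_int d3 * u3^2 - of_int d1 * u1^2 = 0"
     "of_int e3 * of_int m * t^2 + of_int d1 * u1^2 - of_int d2 * u2^2 = 0"
proof -
  from assms[unfolded D_real_point_def] obtain t u1 u2 u3 :: real
    where s: "(t, u1, u2, u3) \<noteq> (0, 0, 0, 0)"
      "\<forall>f\<in>set (D_eqs e1 e2 e3 m (d1, d2, d3) t u1 u2 u3). f = 0"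
    by (elim exE conjE)
  show thesis by (rule that[of t u1 u2 u3]) (use s in \<open>simp_all add: D_eqs_def\<close>)
qed

lemma D_real_pointI:
  fixes t u1 u2 u3 :: real
  assumes e: "e1 + e2 + e3 = 0"
    and "t \<noteq> 0 \<or> u1 \<noteq> 0 \<or> u2 \<noteq> 0 \<or> u3 \<noteq> 0"
    and "of_int e1 * of_int m * t^2 + of_int d2 * u2^2 - of_int d3 * u3^2 = 0"
    and "of_int e2 * of_int m * t^2 + of_int d3 * u3^2 - of_int d1 * u1^2 = 0"
  shows "D_real_point e1 e2 e3 m (d1, d2, d3)"
proof -
  have e3: "real_of_int e3 = - of_int e1 - of_int e2" using e by linarith
  have "of_int e3 * of_int m * t^2 + of_int d1 * u1^2 - of_int d2 * u2^2 = 0"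
    using assms(3,4) unfolding e3 by (simp add: algebra_simps)
  then show ?thesis unfolding D_real_point_def D_eqs_def
    by - (rule exI[of _ t], rule exI[of _ u1], rule exI[of _ u2], rule exI[of _ u3],
      use assms in \<open>simp\<close>)
qed

lemma D_real_point_rotate:
  assumes e: "e1 + e2 + e3 = 0" and D: "D_real_point e1 e2 e3 m (d1, d2, d3)"
  shows "D_real_point e2 e3 e1 m (d2, d3, d1)"
proof (rule D_real_pointE[OF D])
  fix t u1 u2 u3 :: real
  assume s: "t \<noteq> 0 \<or> u1 \<noteq> 0 \<or> u2 \<noteq> 0 \<or> u3 \<noteq> 0"
    "of_int e2 * of_int m * t^2 + of_int d3 * u3^2 - of_int d1 * u1^2 = 0"
    "of_int e3 * of_int m * t^2 + of_int d1 * u1^2 - of_int d2 * u2^2 = 0"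
  show ?thesis by (rule D_real_pointI[of _ _ _ t u2 u3 u1]) (use s e in auto)
qed

section \<open>Divisibility by prime powers\<close>

lemma prime_not_dvd_one: "prime p \<Longrightarrow> \<not> int p dvd 1"
  by (metis not_prime_unit prime_nat_int_transfer)

lemma squarefree_not_square_dvd: "squarefree (x::int) \<Longrightarrow> prime p \<Longrightarrow> \<not> int p ^ 2 dvd x"
  using squarefreeD prime_not_dvd_one by blast

lemma square_dvd_imp_dvd: "int p ^ 2 dvd x \<Longrightarrow> int p dvd x"
  by (auto simp: power2_eq_square dest: dvd_mult_left)

lemma prime_square_dvd_cancel:
  fixes c u :: int
  assumes p: "prime p" and c: "int p dvd c" "\<not> int p ^ 2 dvd c" and d: "int p ^ 2 dvd c * u^2"
  shows "int p dvd u"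
proof -
  have pi: "prime (int p)" using p by simp
  obtain c' where c': "c = int p * c'" using c(1) by (auto elim: dvdE)
  have "int p dvd c' * u^2" using d pi unfolding c' by (simp add: power2_eq_square mult.assoc)
  moreover have "\<not> int p dvd c'" using c(2) unfolding c' by (simp add: power2_eq_square)
  ultimately show ?thesis using pi by (simp add: prime_dvd_mult_iff prime_dvd_power_iff)
qed

lemma prime_int_cases:
  assumes "prime (r::int)"
  obtains p where "prime p" "r = int p"
  using that[of "nat r"] assms by (simp add: prime_ge_0_int)

lemma inverse_mod_prime:
  fixes d :: int
  assumes "prime p" "\<not> int p dvd d"
  obtains w where "int p dvd d * w - 1"
proof -
  have "coprime d (int p)" using assms prime_imp_coprime[of "int p" d] by (simp add: coprime_commute)
  then show thesis using cong_solve_coprime_int that by (auto simp: cong_iff_dvd_diff)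
qed

lemma prime_power_not_dvd_ex:
  fixes c :: int
  assumes "prime p" "c \<noteq> 0"
  shows "\<exists>M. \<not> int p ^ M dvd c"
proof -
  have "\<not> is_unit (int p)" using assms(1) not_prime_unit by auto
  then have "finite {M. int p ^ M dvd c}"
    using finite_divisor_powers[of c "int p"] assms by auto
  then have "{M. int p ^ M dvd c} \<noteq> UNIV" using infinite_UNIV_nat by metis
  then show ?thesis by blast
qed

text \<open>The hypothesis on c means v_p(c) <= M - 1, so one power more than k survives; already k
  = 0 gives that p divides x.\<close>

lemma prime_power_dvd_cancel:
  fixes c x :: int
  assumes p: "prime p" and M: "\<not> int p ^ M dvd c" and d: "int p ^ (M + k) dvd c * x"
  shows "int p ^ Suc k dvd x"
proof -
  have c0: "c \<noteq> 0" using M by auto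
  have pe: "prime_elem (int p)" using p by simp
  have "multiplicity (int p) c < M" using M multiplicity_dvd' not_less by blast
  show ?thesis
  proof (cases "x = 0")
    case False
    have "M + k \<le> multiplicity (int p) (c * x)"
      using d False c0 p by (intro multiplicity_geI) auto
    also have "\<dots> = multiplicity (int p) c + multiplicity (int p) x"
      using False c0 pe by (simp add: prime_elem_multiplicity_mult_distrib)
    finally have "Suc k \<le> multiplicity (int p) x" using \<open>multiplicity (int p) c < M\<close> by simp
    then show ?thesis by (rule multiplicity_dvd')
  qed simp
qed

text \<open>Here d_i = d_i' (c_i/k_i)^2, so u_i is rescaled by c_i/k_i. Multiplying all coordinates
  by \<open>K\<close> clears denominators, and the \<open>M\<close> chosen for
  \<open>K*r1*r2*r3\<close> bounds the loss of primitivity.\<close>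

lemma D_padic_point_square_class:
  assumes p: "prime p" and e: "e1 + e2 + e3 = (0::int)"
    and D: "D_padic_point p e1 e2 e3 m (d1, d2, d3)"
    and c: "c1 \<noteq> 0" "c2 \<noteq> 0" "c3 \<noteq> 0"
    and eq: "d1 * k1^2 = d1' * c1^2" "d2 * k2^2 = d2' * c2^2" "d3 * k3^2 = d3' * c3^2"
    and k: "k1 \<noteq> 0" "k2 \<noteq> 0" "k3 \<noteq> 0"
  shows "D_padic_point p e1 e2 e3 m (d1', d2', d3')"
proof -
  define K where "K = k1*k2*k3"
  define r1 r2 r3 where "r1 = c1*k2*k3" and "r2 = c2*k1*k3" and "r3 = c3*k1*k2"
  have nz: "K * r1 * r2 * r3 \<noteq> 0" using c k by (simp add: K_def r1_def r2_def r3_def)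
  from prime_power_not_dvd_ex[OF p nz] obtain M where M: "\<not> int p ^ M dvd K*r1*r2*r3" by blast
  have eqs: "d1 * K^2 = d1' * r1^2" "d2 * K^2 = d2' * r2^2" "d3 * K^2 = d3' * r3^2"
    using arg_cong[OF eq(1), of "\<lambda>z. z * (k2*k3)^2"] arg_cong[OF eq(2), of "\<lambda>z. z * (k1*k3)^2"]
      arg_cong[OF eq(3), of "\<lambda>z. z * (k1*k2)^2"]
    unfolding K_def r1_def r2_def r3_def by (simp_all only: power_mult_distrib mult_ac)
  show ?thesis
  proof (rule D_padic_pointI_bounded[OF p e, where M = M], goal_cases)
    case (1 N)
    obtain t u1 u2 u3 where nd: "\<not> (int p dvd t \<and> int p dvd u1 \<and> int p dvd u2 \<and> int p dvd u3)"
      and 1: "int p ^ N dvd e1*m*t^2 + d2*u2^2 - d3*u3^2"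
        "int p ^ N dvd e2*m*t^2 + d3*u3^2 - d1*u1^2"
      using D_padic_pointD[OF D] by metis
    have x: "int p dvd x" if "int p ^ M dvd w * x" "w dvd K*r1*r2*r3" for w x
    proof -
      have "\<not> int p ^ M dvd w" using M that(2) dvd_trans by blast
      from prime_power_dvd_cancel[OF p this, of 0 x] that(1) show ?thesis by simp
    qed
    have nd': "\<not> (int p ^ M dvd K*t \<and> int p ^ M dvd r1*u1 \<and> int p ^ M dvd r2*u2 \<and> int p ^ M dvd r3*u3)"
      using nd x[of K t] x[of r1 u1] x[of r2 u2] x[of r3 u3] by (auto simp: dvd_mult2 mult.assoc)
    have q: "d1' * (r1*u1)^2 = K^2 * (d1*u1^2)" "d2' * (r2*u2)^2 = K^2 * (d2*u2^2)" "d3' * (r3*u3)^2 = K^2 * (d3*u3^2)"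
      using arg_cong[OF eqs(1), of "\<lambda>z. z * u1^2"] arg_cong[OF eqs(2), of "\<lambda>z. z * u2^2"]
        arg_cong[OF eqs(3), of "\<lambda>z. z * u3^2"] by (simp_all only: power_mult_distrib mult_ac)
    have A: "e1*m*(K*t)^2 + d2'*(r2*u2)^2 - d3'*(r3*u3)^2 = K^2 * (e1*m*t^2 + d2*u2^2 - d3*u3^2)"
      unfolding q by (simp add: power_mult_distrib algebra_simps)
    have B: "e2*m*(K*t)^2 + d3'*(r3*u3)^2 - d1'*(r1*u1)^2 = K^2 * (e2*m*t^2 + d3*u3^2 - d1*u1^2)"
      unfolding q by (simp add: power_mult_distrib algebra_simps)
    show ?case
      by (rule exI[of _ "K*t"], rule exI[of _ "r1*u1"], rule exI[of _ "r2*u2"], rule exI[of _ "r3*u3"],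
          unfold A B, intro conjI nd' dvd_mult 1)
  qed
qed

lemma D_real_point_square_class:
  assumes e: "e1 + e2 + e3 = 0" and D: "D_real_point e1 e2 e3 m (d1, d2, d3)"
    and c: "c1 \<noteq> 0" "c2 \<noteq> 0" "c3 \<noteq> 0"
    and eq: "d1 * k1^2 = d1' * c1^2" "d2 * k2^2 = d2' * c2^2" "d3 * k3^2 = d3' * c3^2"
    and k: "k1 \<noteq> 0" "k2 \<noteq> 0" "k3 \<noteq> 0"
  shows "D_real_point e1 e2 e3 m (d1', d2', d3')"
proof (rule D_real_pointE[OF D])
  fix t u1 u2 u3 :: real
  assume s: "t \<noteq> 0 \<or> u1 \<noteq> 0 \<or> u2 \<noteq> 0 \<or> u3 \<noteq> 0"
    "of_int e1 * of_int m * t^2 + of_int d2 * u2^2 - of_int d3 * u3^2 = 0"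
    "of_int e2 * of_int m * t^2 + of_int d3 * u3^2 - of_int d1 * u1^2 = 0"
  have E: "of_int d' * (of_int c / of_int k * u)^2 = of_int d * u^2"
    if "d * k^2 = d' * c^2" "k \<noteq> 0" for d d' c k :: int and u :: real
  proof -
    have "real_of_int d * of_int k^2 = of_int d' * of_int c^2"
      using that(1) by (metis of_int_mult of_int_power)
    then show ?thesis using that(2) by (simp add: field_simps power_mult_distrib)
  qed
  show ?thesis
    by (rule D_real_pointI[OF e, of t "of_int c1 / of_int k1 * u1" "of_int c2 / of_int k2 * u2" "of_int c3 / of_int k3 * u3"])
       (unfold E[OF eq(1) k(1)] E[OF eq(2) k(2)] E[OF eq(3) k(3)], use s c k in auto)
qed

text \<open>Translation by the 2-torsion point with image \<open>(e2 m, -e1 m, -e1 e2)\<close>; modulo squares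
  \<open>d2 d3\<close> is \<open>d1\<close> and \<open>d1 d3\<close> is \<open>d2\<close>.\<close>
lemma D_padic_point_translate:
  assumes p: "prime p" and e: "e1 + e2 + e3 = (0::int)" and nz: "m \<noteq> 0" "d3 \<noteq> 0"
    and D: "D_padic_point p e1 e2 e3 m (d1, d2, d3)"
  shows "D_padic_point p e1 e2 e3 m (e2*m*d2*d3, -e1*m*d1*d3, -e1*e2*d3)"
proof -
  from prime_power_not_dvd_ex[OF p] nz obtain M where M: "\<not> int p ^ M dvd m*d3" by (metis mult_eq_0_iff)
  have M1: "\<not> int p ^ M dvd m" "\<not> int p ^ M dvd d3" using M by auto
  have M0: "int p dvd int p ^ M" using M1 by (cases M) auto
  have e3: "e3 = - e1 - e2" using e by simp
  show ?thesis
  proof (rule D_padic_pointI_bounded[OF p e, where M = M], goal_cases)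
    case (1 N)
    obtain t u1 u2 u3 where nd: "\<not> (int p dvd t \<and> int p dvd u1 \<and> int p dvd u2 \<and> int p dvd u3)"
      and 1: "int p ^ N dvd e1*m*t^2 + d2*u2^2 - d3*u3^2"
        "int p ^ N dvd e2*m*t^2 + d3*u3^2 - d1*u1^2"
        "int p ^ N dvd e3*m*t^2 + d1*u1^2 - d2*u2^2"
      using D_padic_pointD[OF D] by metis
    have nd': "\<not> (int p ^ M dvd d3*u3 \<and> int p ^ M dvd u2 \<and> int p ^ M dvd u1 \<and> int p ^ M dvd m*t)"
      using nd prime_power_dvd_cancel[OF p M1(1), of 0 t] prime_power_dvd_cancel[OF p M1(2), of 0 u3]
        M0 dvd_trans by auto
    \<comment> \<open>Up to scaling, the translation acts on coordinates by exchanging t with u3 and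
      u1 with u2; the factors d3 and m make the quadrics match.\<close>
    have A: "e1*m*(d3*u3)^2 + (-e1*m*d1*d3)*u1^2 - (-e1*e2*d3)*(m*t)^2 = e1*m*d3 * (e2*m*t^2 + d3*u3^2 - d1*u1^2)"
      by (simp add: power2_eq_square algebra_simps)
    have B: "e2*m*(d3*u3)^2 + (-e1*e2*d3)*(m*t)^2 - (e2*m*d2*d3)*u2^2
        = - (e2*m*d3) * (e1*m*t^2 + d2*u2^2 - d3*u3^2)"
      by (simp add: power2_eq_square algebra_simps)
    show ?case
      by (rule exI[of _ "d3*u3"], rule exI[of _ u2], rule exI[of _ u1], rule exI[of _ "m*t"],
          unfold A B, intro conjI nd' dvd_mult 1)
  qed
qed

lemma D_real_point_translate:
  assumes e: "e1 + e2 + e3 = (0::int)" and nz: "m \<noteq> 0" "d3 \<noteq> 0"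
    and D: "D_real_point e1 e2 e3 m (d1, d2, d3)"
  shows "D_real_point e1 e2 e3 m (e2*m*d2*d3, -e1*m*d1*d3, -e1*e2*d3)"
proof (rule D_real_pointE[OF D])
  fix t u1 u2 u3 :: real
  assume s: "t \<noteq> 0 \<or> u1 \<noteq> 0 \<or> u2 \<noteq> 0 \<or> u3 \<noteq> 0"
    "of_int e1 * of_int m * t^2 + of_int d2 * u2^2 - of_int d3 * u3^2 = 0"
    "of_int e2 * of_int m * t^2 + of_int d3 * u3^2 - of_int d1 * u1^2 = 0"
  have a: "of_int e1 * of_int m * (of_int d3*u3)^2 + of_int (-e1*m*d1*d3)*u1^2 - of_int (-e1*e2*d3)*(of_int m*t)^2
      = of_int (e1*m*d3) * (of_int e2*of_int m*t^2 + of_int d3*u3^2 - of_int d1*u1^2)"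
    by (simp add: power2_eq_square algebra_simps)
  have b: "of_int e2 * of_int m * (of_int d3*u3)^2 + of_int (-e1*e2*d3)*(of_int m*t)^2 - of_int (e2*m*d2*d3)*u2^2
      = - of_int (e2*m*d3) * (of_int e1*of_int m*t^2 + of_int d2*u2^2 - of_int d3*u3^2)"
    by (simp add: power2_eq_square algebra_simps)
  show ?thesis
    by (rule D_real_pointI[OF e, of "of_int d3*u3" u2 u1 "of_int m*t"]) (unfold a b s, use s nz in auto)
qed

section \<open>Hensel lifting and Legendre's theorem on conics\<close>

text \<open>Newton iteration for c s^2 = a. The derivative 2 c s stays a unit, since p dividing s
  would give p dividing a.\<close>

lemma hensel_square_odd:
  fixes a c u :: int
  assumes p: "prime p" "odd p" and nd: "\<not> int p dvd c" "\<not> int p dvd a"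
    and u: "int p dvd c * u^2 - a"
  shows "\<exists>s. int p ^ N dvd c * s^2 - a"
proof -
  have "\<exists>s. int p ^ Suc N dvd c * s^2 - a"
  proof (induction N)
    case 0
    show ?case using u by auto
  next
    case (Suc N)
    then obtain s w where w: "c * s^2 - a = int p ^ Suc N * w" by (auto elim!: dvdE)
    have ps: "\<not> int p dvd s"
    proof
      assume "int p dvd s"
      then have "int p dvd c * s^2" by (simp add: power2_eq_square)
      moreover have "int p dvd c * s^2 - a" unfolding w by simp
      ultimately have "int p dvd c * s^2 - (c * s^2 - a)" by (rule dvd_diff)
      then show False using nd(2) by simp
    qed
    have pi: "prime (int p)" using p by simp
    have "\<not> int p dvd 2"
    proof
      assume "int p dvd 2"
      then have "p dvd 2" by (metis int_dvd_int_iff of_nat_numeral)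
      then have "p = 2" using p(1) primes_dvd_imp_eq two_is_prime_nat by blast
      then show False using p(2) by simp
    qed
    then have "\<not> int p dvd 2 * c * s" using ps nd(1) pi by (simp add: prime_dvd_mult_iff)
    then obtain x where "int p dvd 2 * c * s * x - 1" by (rule inverse_mod_prime[OF p(1)])
    then obtain y where y: "1 - 2 * c * s * x = int p * y" using dvd_diff_commute by (metis dvdE)
    \<comment> \<open>\<open>x\<close> inverts 2 c s modulo p, so this correction cancels the error
      \<open>p^(N+1) * w\<close> modulo p^(N+2).\<close>
    define s' where "s' = s - w * x * int p ^ Suc N"
    have "c * s'^2 - a = (c * s^2 - a) - 2 * c * s * w * x * int p ^ Suc N + c * (w * x)^2 * int p ^ Suc N * int p ^ Suc N"
      unfolding s'_def by (simp add: power2_eq_square algebra_simps)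
    also have "\<dots> = int p ^ Suc N * (w * (1 - 2 * c * s * x) + c * (w * x)^2 * int p ^ Suc N)"
      unfolding w by (simp add: algebra_simps)
    also have "\<dots> = int p ^ Suc N * int p * (w * y + c * (w * x)^2 * int p ^ N)"
      unfolding y by (simp add: algebra_simps)
    finally have "int p ^ Suc (Suc N) dvd c * s'^2 - a" by (simp add: mult.assoc mult.left_commute)
    then show ?case by blast
  qed
  then obtain s where "int p ^ Suc N dvd c * s^2 - a" by blast
  moreover have "int p ^ N dvd int p ^ Suc N" by simp
  ultimately show ?thesis using dvd_trans by blast
qed

text \<open>At 2 the derivative 2 c s has valuation one, so a correction by a multiple of 2^(N+2)
  removes an error of size 2^(N+3). The iteration therefore starts modulo 8, from s = 1.\<close>

lemma hensel_square_two:
  fixes a c :: int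
  assumes c: "odd c" and ca: "8 dvd c - a"
  shows "\<exists>s. odd s \<and> 2 ^ N dvd c * s^2 - a"
proof -
  have "\<exists>s. odd s \<and> 2 ^ (N + 3) dvd c * s^2 - a"
  proof (induction N)
    case 0
    show ?case by (rule exI[of _ 1]) (use ca in simp)
  next
    case (Suc N)
    then obtain s w where s: "odd s" and w: "c * s^2 - a = 2 ^ (N + 3) * w" by (auto elim!: dvdE)
    define s' where "s' = s + w * 2 ^ (N + 2)"
    from c s obtain v where v: "1 + c * s = 2 * v" by (metis dvdE even_plus_one_iff even_mult_iff add.commute)
    have "c * s'^2 - a = (c * s^2 - a) + c * s * w * (2 * 2 ^ (N + 2)) + c * w^2 * 2 ^ (N + 2) * 2 ^ (N + 2)"
      unfolding s'_def by (simp add: power2_eq_square algebra_simps)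
    also have "\<dots> = 2 ^ (N + 3) * (w * (1 + c * s) + 2 * (c * w^2 * 2 ^ N))"
      unfolding w by (simp add: power_add algebra_simps)
    also have "\<dots> = 2 ^ (N + 3) * 2 * (w * v + c * w^2 * 2 ^ N)"
      unfolding v by (simp add: algebra_simps)
    also have "2 ^ (N + 3) * (2::int) = 2 ^ (Suc N + 3)" by (simp only: add_Suc power_Suc2)
    finally have "2 ^ (Suc N + 3) dvd c * s'^2 - a" by (rule dvdI)
    moreover have "odd s'" unfolding s'_def using s by simp
    ultimately show ?case by blast
  qed
  then obtain s where "odd s" "2 ^ (N + 3) dvd c * s^2 - a" by blast
  moreover have "(2::int) ^ N dvd 2 ^ (N + 3)" by (simp add: le_imp_power_dvd)
  ultimately show ?thesis using dvd_trans by blast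
qed

text \<open>Chinese remainders, one prime at a time; squarefreeness makes the prime split off
  coprime to its cofactor.\<close>

lemma squarefree_square_mod:
  fixes a b :: int
  assumes "squarefree b" and "\<And>p::nat. prime p \<Longrightarrow> int p dvd b \<Longrightarrow> \<exists>s. int p dvd s^2 - a"
  shows "\<exists>s. b dvd s^2 - a"
  using assms
proof (induction "nat \<bar>b\<bar>" arbitrary: b rule: less_induct)
  case less
  have b0: "b \<noteq> 0" using less.prems(1) by auto
  show ?case
  proof (cases "is_unit b")
    case True
    then show ?thesis by (meson dvd_trans one_dvd)
  next
    case False
    then obtain q where q: "prime q" "q dvd b" using prime_divisor_exists[OF b0] by blast
    then obtain c where c: "b = q * c" by (auto elim: dvdE)
    have q1: "q > 1" using q(1) by (simp add: prime_gt_1_int)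
    have c0: "c \<noteq> 0" using b0 c by auto
    have cop: "coprime q c"
    proof (rule prime_imp_coprime[OF q(1)], rule notI)
      assume "q dvd c"
      then have "q^2 dvd b" unfolding c by (simp add: power2_eq_square)
      then have "q dvd 1" using less.prems(1) squarefreeD by blast
      then show False using q(1) by auto
    qed
    have "nat \<bar>c\<bar> < nat \<bar>b\<bar>" unfolding c using q1 c0 by (simp add: abs_mult)
    moreover have "squarefree c" using less.prems(1) squarefree_multD(2) unfolding c by blast
    ultimately obtain s1 where s1: "c dvd s1^2 - a"
      using less.hyps[of c] less.prems(2) c by (meson dvd_mult)
    have "prime (nat q)" "int (nat q) = q" using q1 q(1) by simp_all
    then obtain s2 where s2: "q dvd s2^2 - a" using less.prems(2)[of "nat q"] q(2) by auto
    obtain x where x: "[x = s1] (mod c)" "[x = s2] (mod q)"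
      using binary_chinese_remainder_int[of c q s1 s2] cop by (auto simp: coprime_commute)
    have "[x^2 - a = s1^2 - a] (mod c)" "[x^2 - a = s2^2 - a] (mod q)"
      using x by (auto intro: cong_diff cong_pow)
    then have "c dvd x^2 - a" "q dvd x^2 - a" using s1 s2 by (auto simp: cong_dvd_iff)
    then have "q * c dvd x^2 - a" using cop by (simp add: divides_mult)
    then show ?thesis unfolding c by blast
  qed
qed

lemma conic_solvableE:
  assumes "conic_solvable p a b"
  obtains x y z where "\<not> (int p dvd x \<and> int p dvd y \<and> int p dvd z)"
    "int p ^ N dvd (a*x^2 + b*y^2 - z^2)"
  using assms[unfolded conic_solvable_def, rule_format, of N] by (elim exE conjE)

lemma conic_solvable_commute:
  assumes "conic_solvable p a b"
  shows "conic_solvable p b a"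
  unfolding conic_solvable_def
proof
  fix N
  obtain x y z where s: "\<not> (int p dvd x \<and> int p dvd y \<and> int p dvd z)"
    "int p ^ N dvd (a*x^2 + b*y^2 - z^2)" by (rule conic_solvableE[OF assms])
  show "\<exists>x y z. \<not> (int p dvd x \<and> int p dvd y \<and> int p dvd z) \<and> int p ^ N dvd (b*x^2 + a*y^2 - z^2)"
    by (rule exI[of _ y], rule exI[of _ x], rule exI[of _ z]) (use s in \<open>auto simp: add.commute\<close>)
qed

lemma conic_solvable_drop_square:
  assumes p: "prime p" and c: "c \<noteq> 0" and s: "conic_solvable p a (c^2 * b)"
  shows "conic_solvable p a b"
proof -
  from prime_power_not_dvd_ex[OF p c] obtain M where M: "\<not> int p ^ M dvd c" by blast
  have M0: "int p dvd int p ^ M" using M by (cases M) auto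
  show ?thesis
  proof (rule conic_solvableI_bounded[OF p, where M = M], goal_cases)
    case (1 N)
    obtain x y z where s: "\<not> (int p dvd x \<and> int p dvd y \<and> int p dvd z)"
      "int p ^ N dvd (a*x^2 + c^2*b*y^2 - z^2)" by (rule conic_solvableE[OF s])
    have "\<not> (int p ^ M dvd x \<and> int p ^ M dvd c*y \<and> int p ^ M dvd z)"
      using s(1) prime_power_dvd_cancel[OF p M, of 0 y] M0 dvd_trans by auto
    moreover have "int p ^ N dvd a*x^2 + b*(c*y)^2 - z^2" using s(2) by (simp add: power_mult_distrib mult_ac)
    ultimately show ?case by blast
  qed
qed

text \<open>\<open>b b'\<close> is the norm of \<open>t + \<surd>a\<close>, so \<open>b\<close> and \<open>b'\<close> are simultaneously norms from \<open>\<surd>a\<close>.\<close>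
lemma conic_solvable_norm:
  assumes p: "prime p" and bb: "b * b' = t^2 - a" and nz: "b * b' \<noteq> 0" and s: "conic_solvable p a b"
  shows "conic_solvable p a b'"
proof -
  from prime_power_not_dvd_ex[OF p nz] obtain M where M: "\<not> int p ^ M dvd b * b'" by blast
  have M1: "\<not> int p ^ M dvd b" using M by auto
  show ?thesis
  proof (rule conic_solvableI_bounded[OF p, where M = M], goal_cases)
    case (1 N)
    obtain x y z where s: "\<not> (int p dvd x \<and> int p dvd y \<and> int p dvd z)"
      "int p ^ N dvd (a*x^2 + b*y^2 - z^2)" by (rule conic_solvableE[OF s])
    \<comment> \<open>The new coordinates come from (z + x sqrt a)(t + sqrt a) = (z t + a x) + (z +
      t x) sqrt a, an element of norm (z^2 - a x^2)(t^2 - a).\<close>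
    have "\<not> (int p ^ M dvd z + t*x \<and> int p ^ M dvd b*y \<and> int p ^ M dvd z*t + a*x)"
    proof
      assume h: "int p ^ M dvd z + t*x \<and> int p ^ M dvd b*y \<and> int p ^ M dvd z*t + a*x"
      \<comment> \<open>Multiplying back by t - sqrt a recovers \<open>b*b'\<close> times x and z,
        so p would divide x and z as well.\<close>
      then have "int p ^ M dvd t*(z + t*x) - (z*t + a*x)" by (simp del: mult_eq_0_iff)
      also have "t*(z + t*x) - (z*t + a*x) = b*b'*x" unfolding bb by (simp add: power2_eq_square algebra_simps)
      finally have 1: "int p dvd x" using prime_power_dvd_cancel[OF p M, of 0 x] by simp
      have "int p ^ M dvd t*(z*t + a*x) - a*(z + t*x)" using h by (simp del: mult_eq_0_iff)
      also have "t*(z*t + a*x) - a*(z + t*x) = b*b'*z" unfolding bb by (simp add: power2_eq_square algebra_simps)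
      finally have 2: "int p dvd z" using prime_power_dvd_cancel[OF p M, of 0 z] by simp
      have "int p dvd y" using prime_power_dvd_cancel[OF p M1, of 0 y] h by simp
      then show False using 1 2 s(1) by blast
    qed
    moreover have "a*(z + t*x)^2 + b'*(b*y)^2 - (z*t + a*x)^2 = b*b'*(b*y^2) - (t^2 - a)*(z^2 - a*x^2)"
      by (simp add: power2_eq_square algebra_simps)
    then have "a*(z + t*x)^2 + b'*(b*y)^2 - (z*t + a*x)^2 = (t^2 - a)*(a*x^2 + b*y^2 - z^2)"
      unfolding bb by (simp add: algebra_simps)
    then have "int p ^ N dvd a*(z + t*x)^2 + b'*(b*y)^2 - (z*t + a*x)^2" using s(2) by simp
    ultimately show ?case by blast
  qed
qed

text \<open>Modulo p the conic reads a x^2 = z^2. If p divided x it would divide z, and the equation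
  modulo p^2, with p dividing b exactly once, would then force p to divide y.\<close>

lemma conic_solvable_imp_residue:
  assumes p: "prime p" and b: "int p dvd b" "\<not> int p ^ 2 dvd b" and s: "conic_solvable p a b"
  shows "\<exists>s. int p dvd s^2 - a"
proof -
  have pi: "prime (int p)" using p by simp
  obtain x y z where s: "\<not> (int p dvd x \<and> int p dvd y \<and> int p dvd z)"
      "int p ^ 2 dvd (a*x^2 + b*y^2 - z^2)" by (rule conic_solvableE[OF s])
  have d: "int p dvd (a*x^2 + b*y^2 - z^2)" using s(2) by (auto simp: power2_eq_square dest: dvd_mult_left)
  have "int p dvd (a*x^2 + b*y^2 - z^2) - b*y^2" using b(1) by (intro dvd_diff[OF d]) simp
  then have d': "int p dvd a*x^2 - z^2" by (simp add: algebra_simps)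
  have px: "\<not> int p dvd x"
  proof
    assume px: "int p dvd x"
    then have "int p dvd a*x^2" by (simp add: power2_eq_square)
    then have "int p dvd a*x^2 - (a*x^2 - z^2)" using d' by (rule dvd_diff)
    then have pz: "int p dvd z" using pi by (simp add: prime_dvd_power_iff)
    have "int p ^ 2 dvd x^2" "int p ^ 2 dvd z^2" using px pz by (simp_all add: dvd_power_same)
    then have "int p ^ 2 dvd (a*x^2 + b*y^2 - z^2) - a*x^2 + z^2"
      by (intro dvd_diff[OF s(2)] dvd_add) simp_all
    then have "int p ^ 2 dvd b*y^2" by (simp add: algebra_simps)
    from prime_square_dvd_cancel[OF p b this] show False using px pz s(1) by blast
  qed
  obtain w where w: "int p dvd x * w - 1" by (rule inverse_mod_prime[OF p px])
  have "(z*w)^2 - a = a * (x*w + 1) * (x*w - 1) - w^2 * (a*x^2 - z^2)"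
    by (simp add: power2_eq_square algebra_simps)
  then have "int p dvd (z*w)^2 - a" using w d' by (simp del: mult_eq_0_iff)
  then show ?thesis by blast
qed

text \<open>A root of absolute value at most |b|/2 is what makes the cofactor of b in t^2 - a
  smaller than b in the descent.\<close>

lemma balanced_square_root_mod:
  fixes a b :: int
  assumes "b \<noteq> 0" and "b dvd s^2 - a"
  obtains t where "b dvd t^2 - a" "2 * \<bar>t\<bar> \<le> \<bar>b\<bar>"
proof -
  define r where "r = s mod \<bar>b\<bar>"
  have r: "0 \<le> r" "r < \<bar>b\<bar>" using assms(1) by (simp_all add: r_def)
  have "[r = s] (mod b)" unfolding r_def cong_def by (metis mod_mod_cancel abs_dvd_iff dvd_refl)
  then have "[r^2 - a = s^2 - a] (mod b)" by (intro cong_diff cong_pow) auto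
  then have 1: "b dvd r^2 - a" using assms(2) by (simp add: cong_dvd_iff)
  show thesis
  proof (cases "2 * r \<le> \<bar>b\<bar>")
    case True
    then show thesis using that[of r] 1 r by simp
  next
    case False
    have "(r - \<bar>b\<bar>)^2 - a = (r^2 - a) + \<bar>b\<bar> * (\<bar>b\<bar> - 2 * r)" by (simp add: power2_eq_square algebra_simps)
    moreover have "b dvd (r^2 - a) + \<bar>b\<bar> * (\<bar>b\<bar> - 2 * r)" using 1 by (intro dvd_add dvd_mult2) simp_all
    ultimately have "b dvd (r - \<bar>b\<bar>)^2 - a" by (simp only:)
    then show thesis using that[of "r - \<bar>b\<bar>"] False r by auto
  qed
qed

text \<open>Legendre's theorem by descent; the prime 2 never enters because every integer is a square modulo 2.\<close>
lemma legendre_conic: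
  fixes a b :: int
  assumes "a \<noteq> 0" "b \<noteq> 0" "a > 0 \<or> b > 0"
    and "\<And>p. prime p \<Longrightarrow> odd p \<Longrightarrow> conic_solvable p a b"
  shows "\<exists>x y z::int. (x \<noteq> 0 \<or> y \<noteq> 0 \<or> z \<noteq> 0) \<and> a*x^2 + b*y^2 = z^2"
  using assms
proof (induction "nat \<bar>a\<bar> + nat \<bar>b\<bar>" arbitrary: a b rule: less_induct)
  case less
  \<comment> \<open>The descent step for |A| <= |B|. Its size is tied to that of a and b, so that
    \<open>less.hyps\<close> serves both for (a, b) and for (b, a).\<close>
  have main: "\<exists>x y z::int. (x \<noteq> 0 \<or> y \<noteq> 0 \<or> z \<noteq> 0) \<and> A*x^2 + B*y^2 = z^2"
    if sz: "nat \<bar>A\<bar> + nat \<bar>B\<bar> = nat \<bar>a\<bar> + nat \<bar>b\<bar>" and le: "\<bar>A\<bar> \<le> \<bar>B\<bar>"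
      and nz: "A \<noteq> 0" "B \<noteq> 0" and re: "A > 0 \<or> B > 0"
      and loc: "\<And>p. prime p \<Longrightarrow> odd p \<Longrightarrow> conic_solvable p A B" for A B
  proof (cases "squarefree B")
    case False
    then obtain c where c: "c^2 dvd B" "\<not> c dvd 1" by (auto simp: squarefree_def)
    then obtain B' where B': "B = c^2 * B'" by (auto elim: dvdE)
    have c0: "c \<noteq> 0" "B' \<noteq> 0" using nz B' by auto
    have "\<bar>c\<bar> \<noteq> 1" using c(2) by (auto simp: zdvd1_eq)
    then have "\<bar>c\<bar> > 1" using c0 by linarith
    then have "c^2 > 1" using one_less_power[of "\<bar>c\<bar>" 2] by simp
    then have "\<bar>B'\<bar> < \<bar>B\<bar>" unfolding B' using c0 by (simp add: abs_mult)
    then have "nat \<bar>A\<bar> + nat \<bar>B'\<bar> < nat \<bar>A\<bar> + nat \<bar>B\<bar>" by simp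
    then have 1: "nat \<bar>A\<bar> + nat \<bar>B'\<bar> < nat \<bar>a\<bar> + nat \<bar>b\<bar>" unfolding sz .
    have 2: "A > 0 \<or> B' > 0" using re c0 unfolding B' by (auto simp: zero_less_mult_iff)
    have 3: "conic_solvable p A B'" if "prime p" "odd p" for p
      using conic_solvable_drop_square[OF that(1) c0(1)] loc[OF that] unfolding B' by blast
    from less.hyps[OF 1 nz(1) c0(2) 2 3] obtain x y z
      where s: "x \<noteq> 0 \<or> y \<noteq> 0 \<or> z \<noteq> 0" "A*x^2 + B'*y^2 = z^2" by blast
    have "A*(c*x)^2 + B*y^2 = c^2 * (A*x^2 + B'*y^2)" unfolding B' by (simp add: power2_eq_square algebra_simps)
    then have "A*(c*x)^2 + B*y^2 = (c*z)^2" unfolding s(2) by (simp add: power_mult_distrib)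
    moreover have "c*x \<noteq> 0 \<or> y \<noteq> 0 \<or> c*z \<noteq> 0" using s(1) c0 by auto
    ultimately show ?thesis by blast
  next
    case True
    show ?thesis
    proof (cases "\<bar>B\<bar> = 1")
      case True
      then have "\<bar>A\<bar> = 1" using le nz by linarith
      then have "A = 1 \<or> B = 1" using True re by linarith
      then show ?thesis
      proof
        assume "A = 1"
        then show ?thesis by (intro exI[of _ 1] exI[of _ 0]) auto
      next
        assume "B = 1"
        then show ?thesis by - (rule exI[of _ 0], rule exI[of _ 1], rule exI[of _ 1], simp)
      qed
    next
      case False
      then have B2: "\<bar>B\<bar> \<ge> 2" using nz by linarith
      have "\<exists>s. int p dvd s^2 - A" if p: "prime p" "int p dvd B" for p
      proof (cases "odd p")
        case True
        have "\<not> int p ^ 2 dvd B" by (rule squarefree_not_square_dvd[OF \<open>squarefree B\<close> p(1)])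
        from conic_solvable_imp_residue[OF p(1) p(2) this loc[OF p(1) True]] show ?thesis .
      next
        case False
        then have "p = 2" using p(1) prime_prime_factor primes_dvd_imp_eq two_is_prime_nat by blast
        then show ?thesis by (intro exI[of _ A]) (simp add: power2_eq_square)
      qed
      from squarefree_square_mod[OF True this] obtain s where "B dvd s^2 - A" by blast
      from balanced_square_root_mod[OF nz(2) this] obtain t where t: "B dvd t^2 - A" "2 * \<bar>t\<bar> \<le> \<bar>B\<bar>" .
      then obtain B' where B': "B * B' = t^2 - A" by (metis dvdE)
      show ?thesis
      proof (cases "B' = 0")
        case True
        then have "A*1^2 + B*0^2 = t^2" using B' by simp
        then show ?thesis by (metis zero_neq_one)
      next
        case False
        \<comment> \<open>The cofactor shrinks: 4|B||B'| <= B^2 + 4|B| < 4 B^2, the last step by |B|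
          >= 2.\<close>
        have "\<bar>B\<bar> * \<bar>B'\<bar> \<le> t^2 + \<bar>A\<bar>" unfolding abs_mult[symmetric] B' using abs_triangle_ineq4[of "t^2" A] by simp
        moreover have "(2 * \<bar>t\<bar>)^2 \<le> \<bar>B\<bar>^2" using t(2) by (intro power_mono) auto
        then have "4 * t^2 \<le> \<bar>B\<bar> * \<bar>B\<bar>" by (simp add: power_mult_distrib power2_eq_square)
        moreover have "4 * \<bar>B\<bar> < 3 * (\<bar>B\<bar> * \<bar>B\<bar>)" using B2 mult_mono[of 2 "\<bar>B\<bar>" "\<bar>B\<bar>" "\<bar>B\<bar>"] by linarith
        ultimately have "\<bar>B\<bar> * \<bar>B'\<bar> < \<bar>B\<bar> * \<bar>B\<bar>" using le by linarith
        then have "\<bar>B'\<bar> < \<bar>B\<bar>" by (rule mult_left_less_imp_less) simp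
        then have "nat \<bar>A\<bar> + nat \<bar>B'\<bar> < nat \<bar>A\<bar> + nat \<bar>B\<bar>" by simp
    then have 1: "nat \<bar>A\<bar> + nat \<bar>B'\<bar> < nat \<bar>a\<bar> + nat \<bar>b\<bar>" unfolding sz .
        \<comment> \<open>The real condition is inherited: if A and B' were both negative, B would
          be positive, so B B' < 0 while t^2 - A > 0.\<close>
        have 2: "A > 0 \<or> B' > 0"
        proof (rule disjCI)
          assume "\<not> B' > 0"
          then have b': "B' < 0" using False by simp
          show "A > 0"
          proof (rule ccontr)
            assume "\<not> A > 0"
            then have "B > 0" "A < 0" using re nz by auto
            then have "t^2 - A > 0" using zero_le_power2[of t] by linarith
            moreover have "B * B' < 0" using \<open>B > 0\<close> b' by (simp add: mult_pos_neg)
            ultimately show False using B' by simp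
          qed
        qed
        have nz': "B * B' \<noteq> 0" using nz False by simp
        have 3: "conic_solvable p A B'" if "prime p" "odd p" for p
          using conic_solvable_norm[OF that(1) B' nz' loc[OF that]] .
        from less.hyps[OF 1 nz(1) False 2 3] obtain x y z
          where s: "x \<noteq> 0 \<or> y \<noteq> 0 \<or> z \<noteq> 0" "A*x^2 + B'*y^2 = z^2" by blast
        \<comment> \<open>Multiplication by t + sqrt A carries the solution for B' back to one for
          B.\<close>
        have "A*(z + t*x)^2 + B*(B'*y)^2 - (z*t + A*x)^2 = (B*B')*(B'*y^2) - (t^2 - A)*(z^2 - A*x^2)"
          by (simp add: power2_eq_square algebra_simps)
        also have "\<dots> = 0" unfolding B' s(2)[symmetric] by simp
        finally have eq: "A*(z + t*x)^2 + B*(B'*y)^2 = (z*t + A*x)^2" by simp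
        have "z + t*x \<noteq> 0 \<or> B'*y \<noteq> 0 \<or> z*t + A*x \<noteq> 0"
        proof (rule ccontr)
          assume "\<not> ?thesis"
          then have h: "z + t*x = 0" "B'*y = 0" "z*t + A*x = 0" by auto
          have "(B*B')*x = t*(z + t*x) - (z*t + A*x)" unfolding B' by (simp add: power2_eq_square algebra_simps)
          then have "x = 0" using h nz' by simp
          moreover have "y = 0" using h(2) False by simp
          ultimately show False using h(1) s(1) by simp
        qed
        then show ?thesis using eq by blast
      qed
    qed
  qed
  show ?case
  proof (cases "\<bar>a\<bar> \<le> \<bar>b\<bar>")
    case True
    then show ?thesis using main[of a b] less.prems by blast
  next
    case False
    then have "\<exists>x y z::int. (x \<noteq> 0 \<or> y \<noteq> 0 \<or> z \<noteq> 0) \<and> b*x^2 + a*y^2 = z^2"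
      using main[of b a] less.prems conic_solvable_commute by auto
    then show ?thesis by (metis add.commute)
  qed
qed

section \<open>Good reduction\<close>

lemma Legendre_cong:
  assumes "[a = b] (mod p)" shows "Legendre a p = Legendre b p"
proof -
  have "[a = 0] (mod p) \<longleftrightarrow> [b = 0] (mod p)" using assms cong_sym cong_trans by blast
  moreover have "QuadRes p a \<longleftrightarrow> QuadRes p b" unfolding QuadRes_def using assms cong_sym cong_trans by blast
  ultimately show ?thesis by (simp add: Legendre_def)
qed

lemma Legendre_range: "Legendre a p \<in> {-1, 0, 1}"
  by (simp add: Legendre_def)

text \<open>Euler's criterion gives the identity modulo p; both sides lie in {-1, 0, 1}, so they
  differ by at most 2 < p.\<close>

lemma Legendre_mult:
  assumes p: "prime p" "odd p"
  shows "Legendre (a * b) (int p) = Legendre a (int p) * Legendre b (int p)"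
proof -
  have p2: "2 < p" using p prime_gt_1_nat[OF p(1)] by (cases "p = 2") auto
  let ?e = "(p - 1) div 2"
  have "[Legendre (a*b) (int p) = (a*b)^?e] (mod int p)" using euler_criterion[OF p(1) p2] .
  also have "(a*b)^?e = a^?e * b^?e" by (rule power_mult_distrib)
  also have "[a^?e * b^?e = Legendre a (int p) * Legendre b (int p)] (mod int p)"
    by (intro cong_mult cong_sym[OF euler_criterion[OF p(1) p2]])
  finally have d: "int p dvd Legendre (a*b) (int p) - Legendre a (int p) * Legendre b (int p)"
    by (simp add: cong_iff_dvd_diff)
  have "\<bar>Legendre (a*b) (int p) - Legendre a (int p) * Legendre b (int p)\<bar> \<le> 2"
    using Legendre_range[of "a*b" "int p"] Legendre_range[of a "int p"] Legendre_range[of b "int p"] by auto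
  then have "\<bar>Legendre (a*b) (int p) - Legendre a (int p) * Legendre b (int p)\<bar> < int p" using p2 by simp
  then have "Legendre (a*b) (int p) - Legendre a (int p) * Legendre b (int p) = 0"
    using d zdvd_imp_le[of "int p" "\<bar>Legendre (a*b) (int p) - Legendre a (int p) * Legendre b (int p)\<bar>"]
    by (meson abs_of_nonneg dvd_abs_iff leD zero_less_abs_iff)
  then show ?thesis by simp
qed

lemma sum_affine_reindex:
  fixes f :: "int \<Rightarrow> int"
  assumes p: "prime p" and g: "\<not> int p dvd g" and f: "\<And>x y. [x = y] (mod int p) \<Longrightarrow> f x = f y"
  shows "(\<Sum>x\<in>{0..<int p}. f (g*x + b)) = (\<Sum>x\<in>{0..<int p}. f x)"
proof -
  let ?h = "\<lambda>x. (g*x + b) mod int p"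
  have p0: "int p > 0" using p prime_gt_0_nat by simp
  have cop: "coprime g (int p)" using g p prime_imp_coprime[of "int p" g] by (simp add: coprime_commute)
  have "inj_on ?h {0..<int p}"
  proof (rule inj_onI)
    fix x y assume xy: "x \<in> {0..<int p}" "y \<in> {0..<int p}" "?h x = ?h y"
    then have "[g*x + b = g*y + b] (mod int p)" by (simp add: cong_def)
    then have "[g*x = g*y] (mod int p)" by (simp add: cong_add_rcancel)
    then have "[x = y] (mod int p)" using cop by (simp add: cong_mult_lcancel)
    then show "x = y" using xy by (simp add: cong_def)
  qed
  moreover have "?h ` {0..<int p} \<subseteq> {0..<int p}" using p0 by auto
  ultimately have "bij_betw ?h {0..<int p} {0..<int p}"
    by (simp add: bij_betw_def endo_inj_surj)
  then have "(\<Sum>x\<in>{0..<int p}. f (?h x)) = (\<Sum>x\<in>{0..<int p}. f x)" by (rule sum.reindex_bij_betw)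
  moreover have "f (?h x) = f (g*x + b)" for x by (rule f) (simp add: cong_def)
  ultimately show ?thesis by simp
qed

text \<open>If every residue were a square, squaring would be injective modulo p, yet 1 and -1 are
  distinct with the same square.\<close>

lemma exists_nonresidue:
  assumes p: "prime p" "odd p"
  obtains g where "\<not> int p dvd g" "Legendre g (int p) = -1"
proof -
  have p2: "2 < int p" using p prime_gt_1_nat[OF p(1)] by (cases "p = 2") auto
  have "\<exists>g. \<not> QuadRes (int p) g"
  proof (rule ccontr)
    assume "\<nexists>g. \<not> QuadRes (int p) g"
    then have all: "QuadRes (int p) g" for g by blast
    let ?s = "\<lambda>y. y^2 mod int p"
    have "{0..<int p} \<subseteq> ?s ` {0..<int p}"
    proof
      fix x assume x: "x \<in> {0..<int p}"
      obtain y where "[y^2 = x] (mod int p)" using all[of x] unfolding QuadRes_def by blast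
      then have "?s (y mod int p) = x" using x by (simp add: cong_def power_mod)
      then show "x \<in> ?s ` {0..<int p}" using p2 by (intro image_eqI[of _ _ "y mod int p"]) auto
    qed
    moreover have "?s ` {0..<int p} \<subseteq> {0..<int p}" using p2 by auto
    ultimately have "?s ` {0..<int p} = {0..<int p}" by blast
    then have inj: "inj_on ?s {0..<int p}" by (intro eq_card_imp_inj_on) auto
    have "(int p - 1)^2 = 1 + int p * (int p - 2)" by (simp add: power2_eq_square algebra_simps)
    then have "?s (int p - 1) = ?s 1" by simp
    from inj_onD[OF inj this] have "int p - 1 = 1" using p2 by simp
    then show False using p2 by simp
  qed
  then obtain g where g: "\<not> QuadRes (int p) g" by blast
  have "\<not> [g = 0] (mod int p)"
  proof
    assume "[g = 0] (mod int p)"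
    then have "[0^2 = g] (mod int p)" by (simp add: cong_sym)
    then show False using g unfolding QuadRes_def by blast
  qed
  then show thesis using that[of g] g by (simp add: Legendre_def cong_0_iff)
qed

text \<open>Scaling x by a nonresidue permutes the residues and changes the sign of the sum.\<close>

lemma sum_Legendre:
  assumes p: "prime p" "odd p"
  shows "(\<Sum>x\<in>{0..<int p}. Legendre (x + b) (int p)) = 0"
proof -
  let ?S = "\<Sum>x\<in>{0..<int p}. Legendre x (int p)"
  obtain g where g: "\<not> int p dvd g" "Legendre g (int p) = -1" by (rule exists_nonresidue[OF p])
  have "(\<Sum>x\<in>{0..<int p}. Legendre (g*x + 0) (int p)) = ?S"
    by (rule sum_affine_reindex[OF p(1) g(1)]) (rule Legendre_cong)
  then have "?S = - ?S" by (simp add: Legendre_mult[OF p] g(2) sum_negf)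
  moreover have "\<not> int p dvd 1" by (rule prime_not_dvd_one[OF p(1)])
  then have "(\<Sum>x\<in>{0..<int p}. Legendre (1*x + b) (int p)) = ?S"
    by (rule sum_affine_reindex[OF p(1)]) (rule Legendre_cong)
  ultimately show ?thesis by simp
qed

text \<open>The sum does not depend on the nonzero difference \<open>c\<close>, and summing it over all \<open>c\<close> gives 0.\<close>
lemma sum_Legendre_pair_0:
  assumes p: "prime p" "odd p" and c: "\<not> int p dvd c"
  shows "(\<Sum>x\<in>{0..<int p}. Legendre x (int p) * Legendre (x + c) (int p)) = -1"
proof -
  let ?L = "\<lambda>x. Legendre x (int p)"
  let ?T = "\<lambda>c. \<Sum>x\<in>{0..<int p}. ?L x * ?L (x + c)"
  have p1: "1 < int p" using prime_gt_1_nat[OF p(1)] by simp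
  have sq: "?L c * ?L c = 1" if "\<not> int p dvd c" for c
    using that Legendre_range[of c "int p"] by (auto simp: Legendre_def cong_0_iff)
  have T: "?T c = ?T 1" if c: "\<not> int p dvd c" for c
  proof -
    have "(\<Sum>x\<in>{0..<int p}. ?L (c*x + 0) * ?L (c*x + 0 + c)) = ?T c"
      by (rule sum_affine_reindex[OF p(1) c, of "\<lambda>x. ?L x * ?L (x + c)"])
         (metis Legendre_cong cong_add_rcancel)
    moreover have "?L (c*x + 0) * ?L (c*x + 0 + c) = ?L x * ?L (x + 1)" for x
    proof -
      have "c*x + 0 + c = c*(x + 1)" by (simp add: algebra_simps)
      then have "?L (c*x + 0) * ?L (c*x + 0 + c) = (?L c * ?L c) * (?L x * ?L (x + 1))"
        by (simp add: Legendre_mult[OF p])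
      then show ?thesis by (simp add: sq[OF c])
    qed
    ultimately show ?thesis by simp
  qed
  have "(\<Sum>c\<in>{0..<int p}. ?T c) = (\<Sum>x\<in>{0..<int p}. \<Sum>c\<in>{0..<int p}. ?L x * ?L (x + c))"
    by (rule sum.swap)
  also have "\<dots> = (\<Sum>x\<in>{0..<int p}. ?L x * (\<Sum>c\<in>{0..<int p}. ?L (c + x)))"
    by (simp add: sum_distrib_left add.commute)
  also have "\<dots> = 0" by (simp add: sum_Legendre[OF p])
  finally have 0: "(\<Sum>c\<in>{0..<int p}. ?T c) = 0" .
  have nd: "\<not> int p dvd x" if "x \<in> {1..<int p}" for x using that zdvd_not_zless by auto
  have ins: "{0..<int p} = insert 0 {1..<int p}" using p1 by auto
  have A: "(\<Sum>c\<in>{0..<int p}. ?T c) = ?T 0 + (\<Sum>c\<in>{1..<int p}. ?T c)" unfolding ins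
    by (subst sum.insert) auto
  have "(\<Sum>c\<in>{1..<int p}. ?T c) = (\<Sum>c\<in>{1..<int p}. ?T 1)" by (rule sum.cong[OF refl]) (rule T[OF nd])
  then have B: "(\<Sum>c\<in>{1..<int p}. ?T c) = (int p - 1) * ?T 1" using p1 by simp
  have "?T 0 = ?L 0 * ?L 0 + (\<Sum>x\<in>{1..<int p}. ?L x * ?L x)" unfolding ins
    by (subst sum.insert) auto
  moreover have "(\<Sum>x\<in>{1..<int p}. ?L x * ?L x) = (\<Sum>x\<in>{1..<int p}. 1)" by (rule sum.cong[OF refl]) (rule sq[OF nd])
  moreover have "?L 0 = 0" by (simp add: Legendre_def)
  ultimately have C: "?T 0 = int p - 1" using p1 by simp
  have "(int p - 1) * (1 + ?T 1) = ?T 0 + (int p - 1) * ?T 1" unfolding C by (simp only: ring_distribs mult_1_right)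
  also have "\<dots> = 0" using 0 unfolding A B .
  finally have "(int p - 1) * (1 + ?T 1) = 0" .
  then have "?T 1 = -1" using p1 by simp
  then show ?thesis using T[OF c] by simp
qed

lemma sum_Legendre_pair:
  assumes p: "prime p" "odd p" and ab: "\<not> int p dvd b - a"
  shows "(\<Sum>x\<in>{0..<int p}. Legendre (x + a) (int p) * Legendre (x + b) (int p)) = -1"
proof -
  have n1: "\<not> int p dvd 1" by (rule prime_not_dvd_one[OF p(1)])
  have "(\<Sum>x\<in>{0..<int p}. Legendre (1*x + a) (int p) * Legendre ((1*x + a) + (b - a)) (int p))
     = (\<Sum>x\<in>{0..<int p}. Legendre x (int p) * Legendre (x + (b - a)) (int p))"
    by (rule sum_affine_reindex[OF p(1) n1, of "\<lambda>x. Legendre x (int p) * Legendre (x + (b - a)) (int p)"])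
       (metis Legendre_cong cong_add_rcancel)
  then show ?thesis using sum_Legendre_pair_0[OF p ab] by simp
qed

text \<open>The number of affine points of the twisted curve exceeds that of the untwisted one by exactly 4.\<close>
lemma exists_prescribed_residues:
  assumes p: "prime p" "odd p"
    and a: "\<not> int p dvd a2 - a1" "\<not> int p dvd a3 - a1" "\<not> int p dvd a3 - a2"
    and eps: "Legendre d1 (int p) * Legendre d2 (int p) * Legendre d3 (int p) = 1"
    and n1: "\<not> (Legendre d1 (int p) = 1 \<and> Legendre d2 (int p) = 1 \<and> Legendre d3 (int p) = 1)"
  obtains x where "QuadRes (int p) (d1 * (x + a1))" "QuadRes (int p) (d2 * (x + a2))"
    "QuadRes (int p) (d3 * (x + a3))"
proof -
  let ?L = "\<lambda>x. Legendre x (int p)"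
  let ?I = "{0..<int p}"
  define E1 E2 E3 where "E1 = ?L d1" and "E2 = ?L d2" and "E3 = ?L d3"
  have rng: "E1 \<in> {-1,0,1}" "E2 \<in> {-1,0,1}" "E3 \<in> {-1,0,1}"
    unfolding E1_def E2_def E3_def by (rule Legendre_range)+
  \<comment> \<open>Product 1 but not all equal to 1: exactly two of the signs are -1, so the second
    symmetric function is -1 instead of 3.\<close>
  have Es: "E1*E2*E3 = 1" "E1*E2 + E1*E3 + E2*E3 = -1"
    using eps n1 rng unfolding E1_def[symmetric] E2_def[symmetric] E3_def[symmetric] by auto
  define S where "S = (\<Sum>x\<in>?I. ?L (x+a1) * ?L (x+a2) * ?L (x+a3))"
  have expand: "(\<Sum>x\<in>?I. (1 + F1 * ?L (x+a1)) * (1 + F2 * ?L (x+a2)) * (1 + F3 * ?L (x+a3)))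
     = int p - (F1*F2 + F1*F3 + F2*F3) + F1*F2*F3 * S" for F1 F2 F3
  proof -
    have "(\<Sum>x\<in>?I. (1 + F1 * ?L (x+a1)) * (1 + F2 * ?L (x+a2)) * (1 + F3 * ?L (x+a3)))
      = (\<Sum>x\<in>?I. 1 + F1 * ?L (x+a1) + F2 * ?L (x+a2) + F3 * ?L (x+a3)
          + F1*F2 * (?L (x+a1) * ?L (x+a2)) + F1*F3 * (?L (x+a1) * ?L (x+a3)) + F2*F3 * (?L (x+a2) * ?L (x+a3))
          + F1*F2*F3 * (?L (x+a1) * ?L (x+a2) * ?L (x+a3)))"
      by (rule sum.cong[OF refl]) (simp add: algebra_simps)
    also have "\<dots> = int p - (F1*F2 + F1*F3 + F2*F3) + F1*F2*F3 * S"
      by (simp add: sum.distrib sum_distrib_left[symmetric] sum_Legendre[OF p]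
          sum_Legendre_pair[OF p a(1)] sum_Legendre_pair[OF p a(2)] sum_Legendre_pair[OF p a(3)] S_def)
    finally show ?thesis .
  qed
  \<comment> \<open>Trivial signs give \<open>int p - 3 + S\<close>, a sum of nonnegative terms; the
    given signs give \<open>int p + 1 + S\<close>, which is larger by 4 and hence positive whatever
    \<open>S\<close> is.\<close>
  have "(\<Sum>x\<in>?I. (1 + 1 * ?L (x+a1)) * (1 + 1 * ?L (x+a2)) * (1 + 1 * ?L (x+a3))) \<ge> 0"
    using Legendre_range[of _ "int p"] by (intro sum_nonneg mult_nonneg_nonneg) (smt (verit) insertE singletonD)+
  then have "int p - 3 + S \<ge> 0" unfolding expand by simp
  then have "(\<Sum>x\<in>?I. (1 + E1 * ?L (x+a1)) * (1 + E2 * ?L (x+a2)) * (1 + E3 * ?L (x+a3))) > 0"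
    unfolding expand Es by simp
  then obtain x where "(1 + E1 * ?L (x+a1)) * (1 + E2 * ?L (x+a2)) * (1 + E3 * ?L (x+a3)) \<noteq> 0"
    by (metis (mono_tags, lifting) less_irrefl sum.neutral)
  then have ne: "?L (d1 * (x+a1)) \<noteq> -1" "?L (d2 * (x+a2)) \<noteq> -1" "?L (d3 * (x+a3)) \<noteq> -1"
    by (auto simp: Legendre_mult[OF p] E1_def E2_def E3_def)
  have Q: "QuadRes (int p) y" if "?L y \<noteq> -1" for y
  proof (cases "[y = 0] (mod int p)")
    case True
    then have "[0^2 = y] (mod int p)" by (simp add: cong_sym)
    then show ?thesis unfolding QuadRes_def by blast
  next
    case False
    then show ?thesis using that by (auto simp: Legendre_def split: if_splits)
  qed
  show thesis by (rule that[of x]) (rule Q, rule ne)+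
qed

section \<open>Lifting points modulo p\<close>

lemma QuadRes_scaled_root:
  assumes p: "prime p" and d: "\<not> int p dvd d" and q: "QuadRes (int p) (d * X)"
  obtains u where "int p dvd d * u^2 - X"
proof -
  obtain v where v: "int p dvd v^2 - d*X" using q unfolding QuadRes_def cong_iff_dvd_diff by blast
  obtain w where w: "int p dvd d * w - 1" by (rule inverse_mod_prime[OF p d])
  have "d * (v*w)^2 - X = d * w^2 * (v^2 - d*X) + X * (d*w + 1) * (d*w - 1)"
    by (simp add: power2_eq_square algebra_simps)
  then have "int p dvd d * (v*w)^2 - X" using v w by (simp del: mult_eq_0_iff)
  then show thesis by (rule that)
qed

text \<open>With t and u1 kept fixed the system splits into separate square root problems for u2 and
  u3, each solved by Hensel lifting.\<close>

lemma D_padic_point_lift: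
  assumes p: "prime p" "odd p" and e: "e1 + e2 + e3 = (0::int)"
    and nd: "\<not> int p dvd d2" "\<not> int p dvd d3" "\<not> int p dvd u2" "\<not> int p dvd u3"
    and eq: "int p dvd e1*m*t^2 + d2*u2^2 - d3*u3^2" "int p dvd e3*m*t^2 + d1*u1^2 - d2*u2^2"
  shows "D_padic_point p e1 e2 e3 m (d1, d2, d3)"
proof (rule D_padic_pointI_bounded[OF p(1) e, where M = 1], goal_cases)
  case (1 N)
  have pi: "prime (int p)" using p by simp
  have e2: "e2 = - e1 - e3" using e by simp
  define X2 X3 where "X2 = e3*m*t^2 + d1*u1^2" and "X3 = d1*u1^2 - e2*m*t^2"
  have q2: "int p dvd d2*u2^2 - X2" using eq(2) unfolding X2_def by (simp add: dvd_diff_commute)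
  have "d3*u3^2 - X3 = - (e1*m*t^2 + d2*u2^2 - d3*u3^2) - (e3*m*t^2 + d1*u1^2 - d2*u2^2)"
    unfolding X3_def e2 by (simp add: algebra_simps)
  then have q3: "int p dvd d3*u3^2 - X3" using dvd_diff[OF iffD2[OF dvd_minus_iff eq(1)] eq(2)] by (simp only:)
  have c2: "\<not> int p dvd d2*u2^2" "\<not> int p dvd d3*u3^2"
    using nd pi by (simp_all add: prime_dvd_mult_iff prime_dvd_power_iff)
  have nX: "\<not> int p dvd X2" "\<not> int p dvd X3"
    using c2 q2 q3 dvd_add[of "int p" "d2*u2^2 - X2" X2] dvd_add[of "int p" "d3*u3^2 - X3" X3] by auto
  \<comment> \<open>Precision \<open>Suc N\<close> also covers N = 0: it keeps s2 prime to p, so the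
    lifted point is primitive.\<close>
  obtain s2 where s2: "int p ^ Suc N dvd d2*s2^2 - X2" using hensel_square_odd[OF p nd(1) nX(1) q2] by blast
  obtain s3 where s3: "int p ^ Suc N dvd d3*s3^2 - X3" using hensel_square_odd[OF p nd(2) nX(2) q3] by blast
  have "\<not> int p dvd s2"
  proof
    assume "int p dvd s2"
    then have "int p dvd d2*s2^2" by (simp add: power2_eq_square)
    moreover have "int p dvd d2*s2^2 - X2" using s2 by (auto dest: dvd_mult_left)
    ultimately have "int p dvd d2*s2^2 - (d2*s2^2 - X2)" by (rule dvd_diff)
    then show False using nX(1) by simp
  qed
  then have 1: "\<not> (int p ^ 1 dvd t \<and> int p ^ 1 dvd u1 \<and> int p ^ 1 dvd s2 \<and> int p ^ 1 dvd s3)" by simp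
  have r2: "int p ^ N dvd d2*s2^2 - X2" and r3: "int p ^ N dvd d3*s3^2 - X3"
    using s2 s3 by (auto dest: dvd_mult_right)
  have A: "e1*m*t^2 + d2*s2^2 - d3*s3^2 = (d2*s2^2 - X2) - (d3*s3^2 - X3)"
    unfolding X2_def X3_def e2 by (simp add: algebra_simps)
  have B: "e2*m*t^2 + d3*s3^2 - d1*u1^2 = d3*s3^2 - X3" unfolding X3_def by simp
  show ?case
    by (rule exI[of _ t], rule exI[of _ u1], rule exI[of _ s2], rule exI[of _ s3], unfold A B,
        intro conjI 1 dvd_diff[OF r2 r3] r3)
qed

text \<open>The point lies over the point at infinity of the curve: t = 0 and d_i u_i^2 = 1 for all
  i.\<close>

lemma D_padic_point_residues:
  assumes p: "prime p" "odd p" and e: "e1 + e2 + e3 = (0::int)"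
    and nd: "\<not> int p dvd d1" "\<not> int p dvd d2" "\<not> int p dvd d3"
    and q: "QuadRes (int p) d1" "QuadRes (int p) d2" "QuadRes (int p) d3"
  shows "D_padic_point p e1 e2 e3 m (d1, d2, d3)"
proof -
  have n1: "\<not> int p dvd 1" by (rule prime_not_dvd_one[OF p(1)])
  have R: "\<exists>u. int p dvd d * u^2 - 1 \<and> \<not> int p dvd u" if h: "\<not> int p dvd d" "QuadRes (int p) d" for d
  proof -
    obtain u where u: "int p dvd d * u^2 - 1" by (rule QuadRes_scaled_root[OF p(1) h(1), of 1]) (use h in auto)
    have "\<not> int p dvd u"
    proof
      assume "int p dvd u"
      then have "int p dvd d * u^2" by (simp add: power2_eq_square)
      then have "int p dvd d * u^2 - (d * u^2 - 1)" using u by (rule dvd_diff)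
      then show False using n1 by simp
    qed
    then show ?thesis using u by blast
  qed
  obtain u1 where u1: "int p dvd d1 * u1^2 - 1" using R[OF nd(1) q(1)] by blast
  obtain u2 where u2: "int p dvd d2 * u2^2 - 1" "\<not> int p dvd u2" using R[OF nd(2) q(2)] by blast
  obtain u3 where u3: "int p dvd d3 * u3^2 - 1" "\<not> int p dvd u3" using R[OF nd(3) q(3)] by blast
  show ?thesis
    by (rule D_padic_point_lift[OF p e nd(2,3) u2(2) u3(2), of m 0 d1 u1])
       (use dvd_diff[OF u2(1) u3(1)] dvd_diff[OF u1 u2(1)] in simp_all)
qed

text \<open>Good reduction: the count above replaces the Hasse--Weil bound.\<close>
lemma D_padic_point_good:
  assumes p: "prime p" "odd p" and e: "e1 + e2 + e3 = (0::int)"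
    and nd: "\<not> int p dvd e1" "\<not> int p dvd e2" "\<not> int p dvd e3" "\<not> int p dvd m"
      "\<not> int p dvd d1" "\<not> int p dvd d2" "\<not> int p dvd d3"
    and sq: "is_square (d1 * d2 * d3)"
  shows "D_padic_point p e1 e2 e3 m (d1, d2, d3)"
proof -
  have pi: "prime (int p)" using p by simp
  let ?L = "\<lambda>x. Legendre x (int p)"
  obtain k where k: "d1*d2*d3 = k^2" using sq unfolding is_square_def by blast
  have "\<not> int p dvd d1*d2*d3" using nd pi by (simp add: prime_dvd_mult_iff)
  moreover have "QuadRes (int p) (k^2)" unfolding QuadRes_def by (intro exI[of _ k] cong_refl)
  ultimately have "?L (d1*d2*d3) = 1" using k by (simp add: Legendre_def cong_0_iff)
  then have eps: "?L d1 * ?L d2 * ?L d3 = 1" by (simp add: Legendre_mult[OF p])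
  show ?thesis
  proof (cases "?L d1 = 1 \<and> ?L d2 = 1 \<and> ?L d3 = 1")
    case True
    then show ?thesis using nd by (intro D_padic_point_residues[OF p e]) (auto simp: Legendre_def split: if_splits)
  next
    case False
    have em: "\<not> int p dvd e1*m" "\<not> int p dvd e2*m" "\<not> int p dvd e3*m" using nd pi by (simp_all add: prime_dvd_mult_iff)
    have e1: "e1 = - e2 - e3" using e by simp
    \<comment> \<open>With t = 1 and x = d1 u1^2 the quadrics ask for d2 u2^2 = x + e3 m and d3 u3^2
      = x - e2 m; the three shifts 0, e3 m, -e2 m differ by units.\<close>
    have a: "\<not> int p dvd e3*m - 0" "\<not> int p dvd (-e2*m) - 0" "\<not> int p dvd (-e2*m) - e3*m"
      using em unfolding e1 by (simp_all add: algebra_simps)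
    obtain x where x: "QuadRes (int p) (d1 * (x + 0))" "QuadRes (int p) (d2 * (x + e3*m))" "QuadRes (int p) (d3 * (x + (-e2*m)))"
      by (rule exists_prescribed_residues[OF p a eps False])
    obtain u1 where u1: "int p dvd d1 * u1^2 - (x + 0)" by (rule QuadRes_scaled_root[OF p(1) nd(5) x(1)])
    obtain u2 where u2: "int p dvd d2 * u2^2 - (x + e3*m)" by (rule QuadRes_scaled_root[OF p(1) nd(6) x(2)])
    obtain u3 where u3: "int p dvd d3 * u3^2 - (x + (-e2*m))" by (rule QuadRes_scaled_root[OF p(1) nd(7) x(3)])
    have f1: "int p dvd e1*m*1^2 + d2*u2^2 - d3*u3^2" using dvd_diff[OF u2 u3] unfolding e1 by (simp add: algebra_simps)
    have f2: "int p dvd e2*m*1^2 + d3*u3^2 - d1*u1^2" using dvd_diff[OF u3 u1] by (simp add: algebra_simps)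
    have f3: "int p dvd e3*m*1^2 + d1*u1^2 - d2*u2^2" using dvd_diff[OF u1 u2] by (simp add: algebra_simps)
    have nn: "\<not> (int p dvd u \<and> int p dvd v)" if h: "int p dvd X*1^2 + a*u^2 - b*v^2" "\<not> int p dvd X" for X a b u v
    proof
      assume "int p dvd u \<and> int p dvd v"
      then have "int p dvd (X*1^2 + a*u^2 - b*v^2) - a*u^2 + b*v^2"
        by (intro dvd_add dvd_diff[OF h(1)]) (simp_all add: power2_eq_square)
      then show False using h(2) by simp
    qed
    \<comment> \<open>At most one of the u_i vanishes modulo p, so some pair consists of units and
      can be lifted after a rotation.\<close>
    consider "\<not> int p dvd u2" "\<not> int p dvd u3" | "\<not> int p dvd u1" "\<not> int p dvd u3" | "\<not> int p dvd u1" "\<not> int p dvd u2"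
      using nn[OF f1 em(1)] nn[OF f2 em(2)] nn[OF f3 em(3)] by blast
    then show ?thesis
    proof cases
      case 1
      show ?thesis by (rule D_padic_point_lift[OF p e nd(6,7) 1 f1 f3])
    next
      case 2
      have e': "e2 + e3 + e1 = 0" using e by simp
      show ?thesis by (rule D_padic_point_rotate, rule D_padic_point_rotate, rule D_padic_point_lift[OF p e' nd(7,5) 2(2,1) f2 f1])
    next
      case 3
      have e': "e3 + e1 + e2 = 0" using e by simp
      show ?thesis by (rule D_padic_point_rotate, rule D_padic_point_lift[OF p e' nd(5,6) 3 f3 f2])
    qed
  qed
qed

section \<open>The place 2 and ramification\<close>

text \<open>Projection to (u3, u2, e1 m t). If these were all divisible by p^(2M), p would divide
  every coordinate: one \<open>M\<close> pays for cancelling e1 m in front of t, the other for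
  cancelling d1 in the second quadric, which then forces p to divide u1.\<close>

lemma D_padic_point_imp_conic:
  assumes p: "prime p" and nz: "e1 \<noteq> 0" "m \<noteq> 0" "d1 \<noteq> 0"
    and D: "D_padic_point p e1 e2 e3 m (d1, d2, d3)"
  shows "conic_solvable p (e1*m*d3) (-e1*m*d2)"
proof -
  have pi: "prime (int p)" using p by simp
  have "e1*m*d1 \<noteq> 0" using nz by simp
  from prime_power_not_dvd_ex[OF p this] obtain M where M: "\<not> int p ^ M dvd e1*m*d1" by blast
  have M1: "\<not> int p ^ M dvd e1*m" "\<not> int p ^ M dvd d1" using M by auto
  have M0: "int p dvd int p ^ M" using M by (cases M) auto
  have le: "int p ^ M dvd int p ^ (M + M)" by (simp add: power_add)
  show ?thesis
  proof (rule conic_solvableI_bounded[OF p, where M = "M + M"], goal_cases)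
    case (1 N)
    obtain t u1 u2 u3 where nd: "\<not> (int p dvd t \<and> int p dvd u1 \<and> int p dvd u2 \<and> int p dvd u3)"
      and 1: "int p ^ (N + M) dvd e1*m*t^2 + d2*u2^2 - d3*u3^2"
        "int p ^ (N + M) dvd e2*m*t^2 + d3*u3^2 - d1*u1^2"
      by (rule D_padic_pointD[OF D])
    have "\<not> (int p ^ (M + M) dvd u3 \<and> int p ^ (M + M) dvd u2 \<and> int p ^ (M + M) dvd e1*m*t)"
    proof
      assume h: "int p ^ (M + M) dvd u3 \<and> int p ^ (M + M) dvd u2 \<and> int p ^ (M + M) dvd e1*m*t"
      then have "int p ^ Suc M dvd t" using prime_power_dvd_cancel[OF p M1(1), of M t] by simp
      then have t: "int p ^ M dvd t" by (auto dest: dvd_mult_right)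
      have u: "int p ^ M dvd u2" "int p ^ M dvd u3" using h le dvd_trans by blast+
      have "int p ^ M dvd e2*m*t^2 + d3*u3^2 - d1*u1^2" using 1(2) by (simp add: power_add) (auto dest: dvd_mult_right)
      moreover have "int p ^ M dvd e2*m*t^2 + d3*u3^2" using t u by (simp add: power2_eq_square)
      ultimately have "int p ^ M dvd (e2*m*t^2 + d3*u3^2) - (e2*m*t^2 + d3*u3^2 - d1*u1^2)" by (rule dvd_diff[rotated])
      then have "int p ^ (M + 0) dvd d1 * u1^2" by simp
      from prime_power_dvd_cancel[OF p M1(2) this] have "int p dvd u1" using pi by (simp add: prime_dvd_power_iff)
      then show False using t u M0 nd dvd_trans by blast
    qed
    moreover have "(e1*m*d3)*u3^2 + (-e1*m*d2)*u2^2 - (e1*m*t)^2 = -(e1*m) * (e1*m*t^2 + d2*u2^2 - d3*u3^2)"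
      by (simp add: power2_eq_square algebra_simps)
    moreover have "int p ^ N dvd e1*m*t^2 + d2*u2^2 - d3*u3^2" using 1(1) by (simp add: power_add) (auto dest: dvd_mult_left)
    then have "int p ^ N dvd -(e1*m) * (e1*m*t^2 + d2*u2^2 - d3*u3^2)" by (rule dvd_mult)
    ultimately show ?case
      by - (rule exI[of _ u3], rule exI[of _ u2], rule exI[of _ "e1*m*t"], simp only: simp_thms)
  qed
qed

lemma D_real_point_imp_conic:
  assumes nz: "e1 \<noteq> 0" "m \<noteq> 0" "d1 \<noteq> 0" "d2 \<noteq> 0" "d3 \<noteq> 0"
    and D: "D_real_point e1 e2 e3 m (d1, d2, d3)"
  shows "e1*m*d3 > 0 \<or> -e1*m*d2 > 0"
proof (rule ccontr)
  assume h: "\<not> ?thesis"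
  define A B where "A = e1*m*d3" and "B = -e1*m*d2"
  have "A \<noteq> 0" "B \<noteq> 0" unfolding A_def B_def using nz by simp_all
  then have AB: "A < 0" "B < 0" using h unfolding A_def B_def by linarith+
  show False
  proof (rule D_real_pointE[OF D])
    fix t u1 u2 u3 :: real
    assume s: "t \<noteq> 0 \<or> u1 \<noteq> 0 \<or> u2 \<noteq> 0 \<or> u3 \<noteq> 0"
      "of_int e1 * of_int m * t^2 + of_int d2 * u2^2 - of_int d3 * u3^2 = 0"
      "of_int e2 * of_int m * t^2 + of_int d3 * u3^2 - of_int d1 * u1^2 = 0"
    have "(of_int (e1*m) * t)^2 - of_int A * u3^2 - of_int B * u2^2
      = of_int (e1*m) * (of_int e1 * of_int m * t^2 + of_int d2 * u2^2 - of_int d3 * u3^2)"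
      unfolding A_def B_def by (simp add: power2_eq_square algebra_simps)
    then have eq: "(of_int (e1*m) * t)^2 + of_int (-A) * u3^2 + of_int (-B) * u2^2 = 0" unfolding s(2) by simp
    have nn: "(of_int (e1*m) * t)^2 \<ge> 0" "of_int (-A) * u3^2 \<ge> 0" "of_int (-B) * u2^2 \<ge> 0"
      using AB by (auto simp: mult_nonpos_nonneg)
    from eq nn have z: "(of_int (e1*m) * t)^2 = 0" "of_int (-A) * u3^2 = 0" "of_int (-B) * u2^2 = 0" by linarith+
    have "t = 0" "u3 = 0" "u2 = 0" using z AB nz by simp_all
    then show False using s(1,3) nz by simp
  qed
qed

section \<open>Rational conics modulo 4 and 8\<close>

lemma conic_primitive_two:
  fixes a b x y z :: int
  assumes nt: "x \<noteq> 0 \<or> y \<noteq> 0 \<or> z \<noteq> 0" and eq: "a*x^2 + b*y^2 = z^2"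
  obtains x' y' z' where "\<not> (even x' \<and> even y' \<and> even z')" "a*x'^2 + b*y'^2 = z'^2"
proof -
  from nt have "\<exists>M. \<not> (\<forall>w\<in>{x,y,z}. 2 ^ M dvd w)"
    using prime_power_not_dvd_ex[OF two_is_prime_nat, of x] prime_power_not_dvd_ex[OF two_is_prime_nat, of y]
      prime_power_not_dvd_ex[OF two_is_prime_nat, of z] by auto
  then obtain M where "\<not> (\<forall>w\<in>{x,y,z}. 2 ^ M dvd w)" by blast
  from common_power_bound[OF this] obtain k where dv: "\<forall>w\<in>{x,y,z}. 2 ^ k dvd w"
    and ndv: "\<not> (\<forall>w\<in>{x,y,z}. 2 ^ Suc k dvd w)" by blast
  from dv obtain x' y' z' where s: "x = 2 ^ k * x'" "y = 2 ^ k * y'" "z = 2 ^ k * z'" by (auto elim!: dvdE)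
  have 1: "\<not> (even x' \<and> even y' \<and> even z')"
    using ndv unfolding s by (auto simp: mult_dvd_mono mult.commute)
  have "(2 ^ k)^2 * (a*x'^2 + b*y'^2) = (2 ^ k)^2 * z'^2" using eq unfolding s
    by (simp only: power_mult_distrib ring_distribs mult.left_commute)
  then have "a*x'^2 + b*y'^2 = z'^2" by simp
  with 1 show thesis by (rule that)
qed

lemma odd_square_mod_8: "odd (x::int) \<Longrightarrow> x^2 mod 8 = 1"
proof -
  assume "odd x"
  then obtain k where k: "x = 2*k + 1" by (rule oddE)
  have "even (k*(k+1))" by simp
  then obtain j where j: "k*(k+1) = 2*j" by (rule evenE)
  have "x^2 = 4 * (k*(k+1)) + 1" unfolding k by (simp add: power2_eq_square algebra_simps)
  then have "x^2 = 1 + 8*j" unfolding j by simp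
  then show ?thesis by simp
qed

lemma square_mod_4: "(x::int)^2 mod 4 = (if even x then 0 else 1)"
proof (cases "even x")
  case True
  then obtain k where "x = 2*k" by (rule evenE)
  then have "x^2 = 4 * k^2" by (simp add: power2_eq_square)
  then show ?thesis using True by simp
next
  case False
  from odd_square_mod_8[OF False] have "x^2 mod 4 = 1" by presburger
  then show ?thesis using False by simp
qed

lemma odd_mod_4: "odd (a::int) \<Longrightarrow> a mod 4 = 1 \<or> a mod 4 = 3"
  by presburger

lemma odd_mult_mod_4:
  assumes "odd a" "odd (b::int)"
  shows "(a * b) mod 4 = (if a mod 4 = b mod 4 then 1 else 3)"
proof -
  have "(a * b) mod 4 = ((a mod 4) * (b mod 4)) mod 4" by (simp only: mod_mult_eq)
  then show ?thesis using odd_mod_4[OF assms(1)] odd_mod_4[OF assms(2)] by auto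
qed

lemma odd_minus_mod_4: "odd (a::int) \<Longrightarrow> (- a) mod 4 = (if a mod 4 = 1 then 3 else 1)"
  by presburger

text \<open>With both coefficients 3 modulo 4 the equation reads x^2 + y^2 + z^2 = 0 modulo 4, which
  makes all three even, against primitivity.\<close>

lemma conic_mod_4:
  fixes a b :: int
  assumes ab: "odd a" "odd b" and s: "\<exists>x y z. (x \<noteq> 0 \<or> y \<noteq> 0 \<or> z \<noteq> 0) \<and> a*x^2 + b*y^2 = z^2"
  shows "a mod 4 = 1 \<or> b mod 4 = 1"
proof (rule ccontr)
  assume "\<not> ?thesis"
  then have m: "a mod 4 = 3" "b mod 4 = 3" using ab by presburger+
  from s obtain x y z where "x \<noteq> 0 \<or> y \<noteq> 0 \<or> z \<noteq> 0" "a*x^2 + b*y^2 = z^2" by blast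
  from conic_primitive_two[OF this] obtain x y z
    where n: "\<not> (even x \<and> even y \<and> even z)" and e: "a*x^2 + b*y^2 = z^2" .
  have "(a*x^2 + b*y^2) mod 4 = ((a mod 4)*(x^2 mod 4) + (b mod 4)*(y^2 mod 4)) mod 4"
    using mod_add_eq[of "a*x^2" 4 "b*y^2"] mod_add_eq[of "(a mod 4)*(x^2 mod 4)" 4 "(b mod 4)*(y^2 mod 4)"]
    by (simp only: mod_mult_eq)
  then have "z^2 mod 4 = (3*(x^2 mod 4) + 3*(y^2 mod 4)) mod 4" unfolding e m .
  then show False using n unfolding square_mod_4 by (auto split: if_splits)
qed

text \<open>Write z = 2 w; then 2 w^2 = c (d2 x^2 - d1 y^2) with x and y odd. As 4 divides d2 - d1,
  the right side is divisible by 4, so w is even and the left side is divisible by 8. Modulo 8 the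
  squares of x and y are 1.\<close>

lemma conic_mod_8:
  fixes d1 d2 c :: int
  assumes c: "odd c" and d: "d1 mod 4 = 1" "d2 mod 4 = 1"
    and s: "\<exists>x y z. (x \<noteq> 0 \<or> y \<noteq> 0 \<or> z \<noteq> 0) \<and> (2*c*d2)*x^2 + (-2*c*d1)*y^2 = z^2"
  shows "8 dvd d2 - d1"
proof -
  from s obtain x y z where "x \<noteq> 0 \<or> y \<noteq> 0 \<or> z \<noteq> 0" "(2*c*d2)*x^2 + (-2*c*d1)*y^2 = z^2" by blast
  from conic_primitive_two[OF this] obtain x y z
    where n: "\<not> (even x \<and> even y \<and> even z)" and e: "(2*c*d2)*x^2 + (-2*c*d1)*y^2 = z^2" .
  have e': "z^2 = 2 * (c * (d2*x^2 - d1*y^2))" using e by (simp add: algebra_simps)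
  then have "even (z^2)" by simp
  then have "even z" by simp
  then obtain w where w: "z = 2*w" by (rule evenE)
  have eq: "2 * w^2 = c * (d2*x^2 - d1*y^2)" using e' unfolding w by (simp add: power2_eq_square)
  have od: "odd d1" "odd d2" using d by presburger+
  have "even (c * (d2*x^2 - d1*y^2))" unfolding eq[symmetric] by simp
  then have "even x \<longleftrightarrow> even y" using c od by simp
  then have xy: "odd x" "odd y" using n \<open>even z\<close> by auto
  have x8: "x^2 mod 8 = 1" "y^2 mod 8 = 1" using odd_square_mod_8 xy by blast+
  have D8: "8 dvd (d2*x^2 - d1*y^2) - (d2 - d1)"
  proof -
    have xy8: "8 dvd x^2 - 1" "8 dvd y^2 - 1" using x8 by presburger+
    have "8 dvd d2 * (x^2 - 1) - d1 * (y^2 - 1)" by (rule dvd_diff[OF dvd_mult[OF xy8(1)] dvd_mult[OF xy8(2)]])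
    then show ?thesis by (simp add: algebra_simps)
  qed
  have "4 dvd d2 - d1" using d by presburger
  then have "4 dvd d2*x^2 - d1*y^2" using D8 by presburger
  then have "4 dvd 2 * w^2" unfolding eq by simp
  then obtain j where "2 * w^2 = 4 * j" by (rule dvdE)
  then have "w^2 = 2 * j" by simp
  then have "even (w^2)" by simp
  then have "even w" by simp
  then obtain v where "w = 2*v" by (rule evenE)
  then have "8 dvd 2 * w^2" by (simp add: power2_eq_square)
  then have "8 dvd c * (d2*x^2 - d1*y^2)" unfolding eq .
  moreover have "coprime (2^3) c" using c by (simp only: coprime_power_left_iff coprime_left_2_iff_odd simp_thms)
  moreover have "(2::int)^3 = 8" by simp
  ultimately have "8 dvd d2*x^2 - d1*y^2" by (metis coprime_dvd_mult_right_iff)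
  then show ?thesis using D8 by presburger
qed

text \<open>If d1 = 1 modulo 8, all d_i are 2-adic squares and t = 0 works. If d1 = 5 modulo 8, take
  t = 2 and u3 = 1: the terms 4 e1 m and 4 e2 m are 4 modulo 8 and turn d3 = 1 into the class 5 of
  d1 and d2.\<close>

lemma D_padic_point_two_unramified:
  assumes e: "e1 + e2 + e3 = (0::int)" and odd: "odd e1" "odd e2" "odd m"
    and d: "d1 mod 4 = 1" "d3 mod 8 = 1" "8 dvd d2 - d1"
  shows "D_padic_point 2 e1 e2 e3 m (d1, d2, d3)"
proof (rule D_padic_pointI_bounded[OF two_is_prime_nat e, where M = 1], goal_cases)
  case (1 N)
  have od: "odd d1" "odd d2" "odd d3" using d by presburger+
  have "d1 mod 8 = 1 \<or> d1 mod 8 = 5" using d(1) by presburger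
  then show ?case
  proof
    assume "d1 mod 8 = 1"
    then have "8 dvd d1 - 1" "8 dvd d2 - 1" "8 dvd d3 - 1" using d by presburger+
    then obtain s1 s2 s3 where s: "odd s1" "2 ^ N dvd d1*s1^2 - 1" "odd s2" "2 ^ N dvd d2*s2^2 - 1"
      "odd s3" "2 ^ N dvd d3*s3^2 - 1" using hensel_square_two od by meson
    show ?thesis
      by (rule exI[of _ 0], rule exI[of _ s1], rule exI[of _ s2], rule exI[of _ s3])
         (use s dvd_diff[OF s(4) s(6)] dvd_diff[OF s(6) s(2)] in simp)
  next
    assume "d1 mod 8 = 5"
    have "even (1 + e1*m)" "even (1 - e2*m)" using odd by simp_all
    then obtain j1 j2 where j: "1 + e1*m = 2*j1" "1 - e2*m = 2*j2" by (metis dvdE)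
    have "d2 - (d3 - 4*e1*m) = (d2 - d3 - 4) + 8*j1" using j(1) by (simp add: algebra_simps)
    moreover have "8 dvd d2 - d3 - 4" using \<open>d1 mod 8 = 5\<close> d by presburger
    ultimately have "8 dvd d2 - (d3 - 4*e1*m)" by (simp only: dvd_add dvd_triv_left)
    then obtain s2 where s2: "2 ^ N dvd d2*s2^2 - (d3 - 4*e1*m)" using hensel_square_two[OF od(2)] by blast
    have "d1 - (d3 + 4*e2*m) = (d1 - d3 - 4) + 8*j2" using j(2) by (simp add: algebra_simps)
    moreover have "8 dvd d1 - d3 - 4" using \<open>d1 mod 8 = 5\<close> d by presburger
    ultimately have "8 dvd d1 - (d3 + 4*e2*m)" by (simp only: dvd_add dvd_triv_left)
    then obtain s1 where s1: "2 ^ N dvd d1*s1^2 - (d3 + 4*e2*m)" using hensel_square_two[OF od(1)] by blast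
    have "e1*m*2^2 + d2*s2^2 - d3*1^2 = d2*s2^2 - (d3 - 4*e1*m)" by simp
    then have 1: "2 ^ N dvd e1*m*2^2 + d2*s2^2 - d3*1^2" using s2 by (simp only:)
    have "e2*m*2^2 + d3*1^2 - d1*s1^2 = - (d1*s1^2 - (d3 + 4*e2*m))" by simp
    then have 2: "2 ^ N dvd e2*m*2^2 + d3*1^2 - d1*s1^2" using s1 by (simp only: dvd_minus_iff)
    show ?thesis
      by (rule exI[of _ 2], rule exI[of _ s1], rule exI[of _ s2], rule exI[of _ 1])
         (use 1 2 in simp)
  qed
qed

lemma D_global_conics:
  assumes e: "e1 + e2 + e3 = (0::int)" and nz: "e1 \<noteq> 0" "m \<noteq> 0" "d1 \<noteq> 0" "d2 \<noteq> 0" "d3 \<noteq> 0"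
    and R: "D_real_point e1 e2 e3 m (d1, d2, d3)"
    and P: "\<And>p. prime p \<Longrightarrow> odd p \<Longrightarrow> D_padic_point p e1 e2 e3 m (d1, d2, d3)"
  shows "\<exists>x y z. (x \<noteq> 0 \<or> y \<noteq> 0 \<or> z \<noteq> 0) \<and> (e1*m*d3)*x^2 + (-e1*m*d2)*y^2 = z^2"
proof (rule legendre_conic)
  show "e1*m*d3 \<noteq> 0" "-e1*m*d2 \<noteq> 0" using nz by simp_all
  show "e1*m*d3 > 0 \<or> -e1*m*d2 > 0" by (rule D_real_point_imp_conic[OF nz R])
  show "conic_solvable p (e1*m*d3) (-e1*m*d2)" if "prime p" "odd p" for p
    by (rule D_padic_point_imp_conic[OF that(1) nz(1,2,3) P[OF that]])
qed

text \<open>Solvability at 2 follows from all other places: the three conics through the curve have rational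
  points by Legendre's theorem, which pins down the classes of the \<open>d\<^sub>i\<close> modulo 8.\<close>
lemma D_padic_point_two_normalized:
  assumes e: "e1 + e2 + e3 = (0::int)" and odd: "odd e1" "odd e2" "odd m" and e3: "even e3" "\<not> 4 dvd e3"
    and d: "odd d1" "odd d2" "d3 mod 4 = 1" and sq: "is_square (d1*d2*d3)"
    and R: "D_real_point e1 e2 e3 m (d1, d2, d3)"
    and P: "\<And>p. prime p \<Longrightarrow> odd p \<Longrightarrow> D_padic_point p e1 e2 e3 m (d1, d2, d3)"
  shows "D_padic_point 2 e1 e2 e3 m (d1, d2, d3)"
proof -
  have od: "odd d3" using d by presburger
  have nz: "e1 \<noteq> 0" "e2 \<noteq> 0" "e3 \<noteq> 0" "m \<noteq> 0" "d1 \<noteq> 0" "d2 \<noteq> 0" "d3 \<noteq> 0" using odd e3 d od by auto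
  have e': "e2 + e3 + e1 = 0" "e3 + e1 + e2 = 0" using e by simp_all
  note R2 = D_real_point_rotate[OF e R]
  note R3 = D_real_point_rotate[OF e'(1) R2]
  have P2: "D_padic_point p e2 e3 e1 m (d2, d3, d1)" if "prime p" "odd p" for p
    by (rule D_padic_point_rotate[OF P[OF that]])
  have P3: "D_padic_point p e3 e1 e2 m (d3, d1, d2)" if "prime p" "odd p" for p
    by (rule D_padic_point_rotate[OF P2[OF that]])
  note C1 = D_global_conics[OF e nz(1,4,5,6,7) R P]
  note C2 = D_global_conics[OF e'(1) nz(2,4,6,7,5) R2 P2]
  note C3 = D_global_conics[OF e'(2) nz(3,4,7,5,6) R3 P3]
  \<comment> \<open>\<open>C1\<close> and \<open>C2\<close> have odd coefficients and are read
    modulo 4; \<open>C3\<close> carries the factor e3 = 2 c and is read modulo 8 at the end.\<close>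
  have M1: "(e1*m*d3) mod 4 = 1 \<or> (-e1*m*d2) mod 4 = 1" by (rule conic_mod_4[OF _ _ C1]) (use odd d od in simp_all)
  have M2: "(e2*m*d1) mod 4 = 1 \<or> (-e2*m*d3) mod 4 = 1" by (rule conic_mod_4[OF _ _ C2]) (use odd d od in simp_all)
  obtain k where k: "d1*d2*d3 = k^2" using sq unfolding is_square_def by blast
  have "odd (k^2)" unfolding k[symmetric] using d od by simp
  then have k8: "(d1*d2*d3) mod 8 = 1" unfolding k using odd_square_mod_8 by simp
  \<comment> \<open>e1 + e2 = -e3 is 2 modulo 4, and both summands are odd.\<close>
  have e12: "e1 mod 4 = e2 mod 4" using e odd e3 by presburger
  note e4 = odd_mod_4[OF d(1)] odd_mod_4[OF d(2)]
  have "(d1*d2*d3) mod 4 = 1" using k8 by presburger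
  then have prod4: "d1 mod 4 = d2 mod 4" using e4 d od
    by (auto simp: odd_mult_mod_4 split: if_splits)
  have oem: "odd (e1*m)" "odd (e2*m)" "odd (e1*m*d2)" "odd (e2*m*d3)" using odd d od by simp_all
  have mm: "-e1*m*d2 = - (e1*m*d2)" "-e2*m*d3 = - (e2*m*d3)" by simp_all
  have E1: "(e1*m*d3) mod 4 = (if (e1*m) mod 4 = d3 mod 4 then 1 else 3)"
    "(-e1*m*d2) mod 4 = (if (if (e1*m) mod 4 = d2 mod 4 then 1 else 3) = (1::int) then 3 else 1)"
    "(e2*m*d1) mod 4 = (if (e2*m) mod 4 = d1 mod 4 then 1 else 3)"
    "(-e2*m*d3) mod 4 = (if (if (e2*m) mod 4 = d3 mod 4 then 1 else 3) = (1::int) then 3 else 1)"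
    unfolding mm odd_minus_mod_4[OF oem(3)] odd_minus_mod_4[OF oem(4)] odd_mult_mod_4[OF oem(1) od]
      odd_mult_mod_4[OF oem(1) d(2)] odd_mult_mod_4[OF oem(2) d(1)] odd_mult_mod_4[OF oem(2) od]
    by (rule refl)+
  have E2: "(e1*m) mod 4 = (e2*m) mod 4" unfolding odd_mult_mod_4[OF odd(1,3)] odd_mult_mod_4[OF odd(2,3)] e12 by (rule refl)
  \<comment> \<open>With d1 = d2 = 3 and d3 = 1 modulo 4, the first conic would force the common
    residue of e1 m and e2 m to be 1, the second conic would force it to be 3.\<close>
  have "d1 mod 4 \<noteq> 3"
  proof
    assume "d1 mod 4 = 3"
    then show False using M1 M2 odd_mod_4[OF oem(2)] unfolding E1 E2 prod4[symmetric] d(3) by auto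
  qed
  then have d4: "d1 mod 4 = 1" using e4(1) by blast
  then have d4: "d1 mod 4 = 1" "d2 mod 4 = 1" using prod4 by simp_all
  obtain c where c: "e3 = 2*c" using e3(1) by (rule evenE)
  have "odd c" using e3(2) unfolding c by auto
  have "8 dvd d2 - d1"
    by (rule conic_mod_8[of "c*m", OF _ d4]) (use C3 \<open>odd c\<close> odd(3) in \<open>simp_all add: c mult.assoc\<close>)
  \<comment> \<open>d1 d2 = d1^2 = 1 modulo 8, and d1 d2 d3 is an odd square.\<close>
  moreover have "d3 mod 8 = 1"
  proof -
    have "8 dvd d1 * (d2 - d1)" using \<open>8 dvd d2 - d1\<close> by (rule dvd_mult)
    moreover have "8 dvd d1^2 - 1" using odd_square_mod_8[OF d(1)] by presburger
    ultimately have "8 dvd d1 * (d2 - d1) + (d1^2 - 1)" by (rule dvd_add)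
    then have "8 dvd d1*d2 - 1" by (simp add: power2_eq_square algebra_simps)
    then have "8 dvd (d1*d2 - 1) * d3" by (rule dvd_mult2)
    then have "8 dvd d1*d2*d3 - d3" by (simp add: algebra_simps)
    then show ?thesis using k8 by presburger
  qed
  ultimately show ?thesis using D_padic_point_two_unramified[OF e odd d4(1)] by blast
qed

text \<open>Translation by (e2 m, -e1 m, -e1 e2) multiplies d3 by -e1 e2, which is 3 modulo 4
  because e1 = e2 modulo 4. So the triple or its translate satisfies the normalization d3 = 1 modulo
  4.\<close>

lemma D_padic_point_two:
  assumes e: "e1 + e2 + e3 = (0::int)" and odd: "odd e1" "odd e2" "odd m" and e3: "even e3" "\<not> 4 dvd e3"
    and d: "odd d1" "odd d2" "odd d3" and sq: "is_square (d1*d2*d3)"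
    and R: "D_real_point e1 e2 e3 m (d1, d2, d3)"
    and P: "\<And>p. prime p \<Longrightarrow> odd p \<Longrightarrow> D_padic_point p e1 e2 e3 m (d1, d2, d3)"
  shows "D_padic_point 2 e1 e2 e3 m (d1, d2, d3)"
proof (cases "d3 mod 4 = 1")
  case True
  show ?thesis by (rule D_padic_point_two_normalized[OF e odd e3 d(1,2) True sq R P])
next
  case False
  then have d34: "d3 mod 4 = 3" using d(3) by presburger
  have nz: "e1 \<noteq> 0" "e2 \<noteq> 0" "m \<noteq> 0" "d1 \<noteq> 0" "d2 \<noteq> 0" "d3 \<noteq> 0" using odd d by auto
  let ?c1 = "e2*m*d2*d3" and ?c2 = "-e1*m*d1*d3" and ?c3 = "-e1*e2*d3"
  have oc: "odd ?c1" "odd ?c2" using odd d by simp_all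
  have e12: "e1 mod 4 = e2 mod 4" using e odd e3 by presburger
  have e4: "e1 mod 4 = 1 \<or> e1 mod 4 = 3" using odd by presburger
  have c3: "?c3 mod 4 = 1" using e12 e4 d34 odd d by (auto simp: odd_mult_mod_4 odd_minus_mod_4)
  obtain k where k: "d1*d2*d3 = k^2" using sq unfolding is_square_def by blast
  have "?c1 * ?c2 * ?c3 = (e1*e2*m*d3)^2 * (d1*d2*d3)" by (simp add: power2_eq_square algebra_simps)
  then have "?c1 * ?c2 * ?c3 = (e1*e2*m*d3*k)^2" unfolding k by (simp add: power_mult_distrib)
  then have csq: "is_square (?c1 * ?c2 * ?c3)" unfolding is_square_def by blast
  have cnz: "?c3 \<noteq> 0" using nz by simp
  have "D_padic_point 2 e1 e2 e3 m (?c1, ?c2, ?c3)"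
    by (rule D_padic_point_two_normalized[OF e odd e3 oc c3 csq])
       (rule D_real_point_translate[OF e nz(3,6) R], rule D_padic_point_translate[OF _ e nz(3,6) P])
  \<comment> \<open>A second translation returns to the original class, up to the explicit squares
    listed below.\<close>
  from D_padic_point_translate[OF two_is_prime_nat e nz(3) cnz this]
  have T: "D_padic_point 2 e1 e2 e3 m (e2*m*?c2*?c3, -e1*m*?c1*?c3, -e1*e2*?c3)" .
  show ?thesis
  proof (rule D_padic_point_square_class[OF two_is_prime_nat e T])
    show "e2*m*?c2*?c3 * 1^2 = d1 * (e1*e2*m*d3)^2" by (simp add: power2_eq_square algebra_simps)
    show "-e1*m*?c1*?c3 * 1^2 = d2 * (e1*e2*m*d3)^2" by (simp add: power2_eq_square algebra_simps)
    show "-e1*e2*?c3 * 1^2 = d3 * (e1*e2)^2" by (simp add: power2_eq_square algebra_simps)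
  qed (use nz in simp_all)
qed

text \<open>Modulo p the third quadric kills t and then the first kills u3. Modulo p^2 the first and
  second quadrics are left with d2 u2^2 and d1 u1^2; p divides d2 and d1 only once, so u2 and u1
  vanish as well, against primitivity.\<close>

lemma D_padic_point_not_ramified:
  assumes p: "prime p" and dv: "int p dvd d1" "int p dvd d2" "\<not> int p ^ 2 dvd d1" "\<not> int p ^ 2 dvd d2"
    and nd: "\<not> int p dvd d3" "\<not> int p dvd e3" "\<not> int p dvd m"
    and D: "D_padic_point p e1 e2 e3 m (d1, d2, d3)"
  shows False
proof -
  have pi: "prime (int p)" using p by simp
  obtain t u1 u2 u3 where n: "\<not> (int p dvd t \<and> int p dvd u1 \<and> int p dvd u2 \<and> int p dvd u3)"
      and f1: "int p ^ 2 dvd e1*m*t^2 + d2*u2^2 - d3*u3^2"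
      and f2: "int p ^ 2 dvd e2*m*t^2 + d3*u3^2 - d1*u1^2"
      and f3: "int p ^ 2 dvd e3*m*t^2 + d1*u1^2 - d2*u2^2" by (rule D_padic_pointD[OF D])
  have sq: "int p ^ 2 dvd c * u^2" if "int p dvd u" for c u using that by (simp add: dvd_power_same)
  have "int p dvd (e3*m*t^2 + d1*u1^2 - d2*u2^2) - d1*u1^2 + d2*u2^2"
    using dv by (intro dvd_add dvd_diff[OF square_dvd_imp_dvd[OF f3]]) simp_all
  then have "int p dvd e3*m*t^2" by simp
  then have t: "int p dvd t" using nd pi by (simp add: prime_dvd_mult_iff prime_dvd_power_iff)
  have "int p dvd e1*m*t^2 + d2*u2^2 - (e1*m*t^2 + d2*u2^2 - d3*u3^2)"
    using dv t by (intro dvd_diff[OF dvd_add square_dvd_imp_dvd[OF f1]]) (simp_all add: power2_eq_square)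
  then have "int p dvd d3*u3^2" by simp
  then have u3: "int p dvd u3" using nd pi by (simp add: prime_dvd_mult_iff prime_dvd_power_iff)
  have "int p ^ 2 dvd (e1*m*t^2 + d2*u2^2 - d3*u3^2) - (e1*m)*t^2 + d3*u3^2"
    by (intro dvd_add dvd_diff[OF f1] sq t u3)
  then have u2: "int p dvd u2" using prime_square_dvd_cancel[OF p dv(2,4), of u2] by simp
  have "int p ^ 2 dvd (e2*m)*t^2 + d3*u3^2 - (e2*m*t^2 + d3*u3^2 - d1*u1^2)"
    by (intro dvd_diff[OF dvd_add f2] sq t u3)
  then have "int p dvd u1" using prime_square_dvd_cancel[OF p dv(1,3), of u1] by simp
  then show False using n t u2 u3 by blast
qed

lemma QuadRes_cancel_square:
  assumes p: "prime p" and w: "\<not> int p dvd w" and h: "int p dvd d * w^2 - s^2"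
  shows "QuadRes (int p) d"
proof -
  obtain v where v: "int p dvd w * v - 1" by (rule inverse_mod_prime[OF p w])
  have "(s*v)^2 - d = d * (w*v + 1) * (w*v - 1) - v^2 * (d*w^2 - s^2)"
    by (simp add: power2_eq_square algebra_simps)
  then have "int p dvd (s*v)^2 - d" using v h by (simp del: mult_eq_0_iff)
  then show ?thesis unfolding QuadRes_def cong_iff_dvd_diff by blast
qed

text \<open>Modulo p all d_i u_i^2 agree. They are units: otherwise the first quadric modulo p^2,
  with p dividing m exactly once, would give p dividing t too. Since d1 d2 d3 = k^2, multiplying d1
  by the square of d2 u2^2 yields the square of k u2 u3 modulo p.\<close>

lemma D_padic_point_twist_unramified:
  assumes p: "prime p" and m: "int p dvd m" "\<not> int p ^ 2 dvd m" and e: "\<not> int p dvd e1"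
    and nd: "\<not> int p dvd d1" "\<not> int p dvd d2" "\<not> int p dvd d3" and sq: "is_square (d1*d2*d3)"
    and D: "D_padic_point p e1 e2 e3 m (d1, d2, d3)"
  shows "QuadRes (int p) d1"
proof -
  have pi: "prime (int p)" using p by simp
  obtain t u1 u2 u3 where n: "\<not> (int p dvd t \<and> int p dvd u1 \<and> int p dvd u2 \<and> int p dvd u3)"
      and f1: "int p ^ 2 dvd e1*m*t^2 + d2*u2^2 - d3*u3^2"
      and f2: "int p ^ 2 dvd e2*m*t^2 + d3*u3^2 - d1*u1^2"
      and f3: "int p ^ 2 dvd e3*m*t^2 + d1*u1^2 - d2*u2^2" by (rule D_padic_pointD[OF D])
  obtain k where k: "d1*d2*d3 = k^2" using sq unfolding is_square_def by blast
  have "int p dvd (e1*m*t^2 + d2*u2^2 - d3*u3^2) - e1*m*t^2" using m by (intro dvd_diff[OF square_dvd_imp_dvd[OF f1]]) simp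
  then have g1: "int p dvd d2*u2^2 - d3*u3^2" by simp
  have "int p dvd (e2*m*t^2 + d3*u3^2 - d1*u1^2) - e2*m*t^2" using m by (intro dvd_diff[OF square_dvd_imp_dvd[OF f2]]) simp
  then have g2: "int p dvd d3*u3^2 - d1*u1^2" by simp
  have u2: "\<not> int p dvd u2"
  proof
    assume u2: "int p dvd u2"
    then have "int p dvd d2*u2^2 - (d2*u2^2 - d3*u3^2)" by (intro dvd_diff[OF _ g1]) (simp add: power2_eq_square)
    then have u3: "int p dvd u3" using nd pi by (simp add: prime_dvd_mult_iff prime_dvd_power_iff)
    then have "int p dvd d3*u3^2 - (d3*u3^2 - d1*u1^2)" by (intro dvd_diff[OF _ g2]) (simp add: power2_eq_square)
    then have u1: "int p dvd u1" using nd pi by (simp add: prime_dvd_mult_iff prime_dvd_power_iff)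
    have "int p ^ 2 dvd (e1*m*t^2 + d2*u2^2 - d3*u3^2) - d2*u2^2 + d3*u3^2"
      using u2 u3 by (intro dvd_add dvd_diff[OF f1]) (simp_all add: dvd_power_same)
    then have "int p ^ 2 dvd m * (e1 * t^2)" by (simp add: mult_ac)
    moreover obtain m' where m': "m = int p * m'" using m(1) by (auto elim: dvdE)
    ultimately have "int p dvd m' * (e1 * t^2)" using pi by (simp add: power2_eq_square mult.assoc)
    moreover have "\<not> int p dvd m'" using m(2) unfolding m' by (simp add: power2_eq_square)
    ultimately have "int p dvd t" using pi e by (simp add: prime_dvd_mult_iff prime_dvd_power_iff)
    then show False using n u1 u2 u3 by blast
  qed
  have w: "\<not> int p dvd d2*u2^2" using u2 nd pi by (simp add: prime_dvd_mult_iff prime_dvd_power_iff)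
  have "d1*(d2*u2^2)^2 - (k*u2*u3)^2 = d1*(d2*u2^2)^2 - (d1*d2*d3)*u2^2*u3^2"
    unfolding k by (simp add: power_mult_distrib)
  also have "\<dots> = d1*(d2*u2^2) * (d2*u2^2 - d3*u3^2)" by (simp add: power2_eq_square algebra_simps)
  finally have "int p dvd d1*(d2*u2^2)^2 - (k*u2*u3)^2" using g1 by simp
  from QuadRes_cancel_square[OF p w this] show ?thesis .
qed

text \<open>With \<open>m = p \<mu>\<close>, \<open>d1 = p \<delta>1\<close>, \<open>d2 = p \<delta>2\<close>, a point must reduce to a 2-torsion point, where \<open>u3 = 0\<close>.\<close>
lemma D_padic_point_twist_ramified:
  assumes p: "prime p" "odd p" and e: "e1 + e2 + e3 = (0::int)"
    and nd: "\<not> int p dvd \<mu>" "\<not> int p dvd \<delta>1" "\<not> int p dvd \<delta>2" "\<not> int p dvd d3" "\<not> int p dvd e1" "\<not> int p dvd e2"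
  shows "D_padic_point p e1 e2 e3 (int p * \<mu>) (int p * \<delta>1, int p * \<delta>2, d3) \<longleftrightarrow>
    QuadRes (int p) (\<delta>1 * (e2*\<mu>)) \<and> QuadRes (int p) (\<delta>2 * (-e1*\<mu>))"
proof
  have pi: "prime (int p)" using p by simp
  assume D: "D_padic_point p e1 e2 e3 (int p * \<mu>) (int p * \<delta>1, int p * \<delta>2, d3)"
  obtain t u1 u2 u3 where n: "\<not> (int p dvd t \<and> int p dvd u1 \<and> int p dvd u2 \<and> int p dvd u3)"
      and f1: "int p ^ 2 dvd e1*(int p * \<mu>)*t^2 + (int p * \<delta>2)*u2^2 - d3*u3^2"
      and f2: "int p ^ 2 dvd e2*(int p * \<mu>)*t^2 + d3*u3^2 - (int p * \<delta>1)*u1^2" by (rule D_padic_pointD[OF D])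
  have "int p dvd (e1*(int p * \<mu>)*t^2 + (int p * \<delta>2)*u2^2) - (e1*(int p * \<mu>)*t^2 + (int p * \<delta>2)*u2^2 - d3*u3^2)"
    by (intro dvd_diff[OF _ square_dvd_imp_dvd[OF f1]]) simp
  then have "int p dvd d3*u3^2" by simp
  \<comment> \<open>Once u3 vanishes modulo p, the quadrics can be divided by p and reduce to e1
    \<mu> t^2 + \<delta>2 u2^2 = 0 and e2 \<mu> t^2 - \<delta>1 u1^2 = 0.\<close>
  then have u3: "int p dvd u3" using nd pi by (simp add: prime_dvd_mult_iff prime_dvd_power_iff)
  then have sq3: "int p ^ 2 dvd d3*u3^2" by (simp add: dvd_power_same)
  have "int p ^ 2 dvd (e1*(int p * \<mu>)*t^2 + (int p * \<delta>2)*u2^2 - d3*u3^2) + d3*u3^2" by (rule dvd_add[OF f1 sq3])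
  then have "int p * int p dvd int p * (e1*\<mu>*t^2 + \<delta>2*u2^2)" by (simp add: power2_eq_square algebra_simps)
  then have g1: "int p dvd e1*\<mu>*t^2 + \<delta>2*u2^2" using pi by simp
  have "int p ^ 2 dvd (e2*(int p * \<mu>)*t^2 + d3*u3^2 - (int p * \<delta>1)*u1^2) - d3*u3^2" by (rule dvd_diff[OF f2 sq3])
  then have "int p * int p dvd int p * (e2*\<mu>*t^2 - \<delta>1*u1^2)" by (simp add: power2_eq_square algebra_simps)
  then have g2: "int p dvd e2*\<mu>*t^2 - \<delta>1*u1^2" using pi by simp
  have t: "\<not> int p dvd t"
  proof
    assume t: "int p dvd t"
    then have "int p dvd (e1*\<mu>*t^2 + \<delta>2*u2^2) - e1*\<mu>*t^2" by (intro dvd_diff[OF g1]) (simp add: power2_eq_square)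
    then have "int p dvd u2" using nd pi by (simp add: prime_dvd_mult_iff prime_dvd_power_iff)
    moreover have "int p dvd e2*\<mu>*t^2 - (e2*\<mu>*t^2 - \<delta>1*u1^2)" using t by (intro dvd_diff[OF _ g2]) (simp add: power2_eq_square)
    then have "int p dvd u1" using nd pi by (simp add: prime_dvd_mult_iff prime_dvd_power_iff)
    ultimately show False using n t u3 by blast
  qed
  have "\<delta>1 * (e2*\<mu>) * t^2 - (\<delta>1*u1)^2 = \<delta>1 * (e2*\<mu>*t^2 - \<delta>1*u1^2)" by (simp add: power2_eq_square algebra_simps)
  then have "int p dvd \<delta>1 * (e2*\<mu>) * t^2 - (\<delta>1*u1)^2" using g2 by simp
  moreover have "\<delta>2 * (-e1*\<mu>) * t^2 - (\<delta>2*u2)^2 = - \<delta>2 * (e1*\<mu>*t^2 + \<delta>2*u2^2)" by (simp add: power2_eq_square algebra_simps)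
  then have "int p dvd \<delta>2 * (-e1*\<mu>) * t^2 - (\<delta>2*u2)^2" using g1 by simp
  ultimately show "QuadRes (int p) (\<delta>1 * (e2*\<mu>)) \<and> QuadRes (int p) (\<delta>2 * (-e1*\<mu>))"
    using QuadRes_cancel_square[OF p(1) t] by blast
next
  have pi: "prime (int p)" using p by simp
  assume q: "QuadRes (int p) (\<delta>1 * (e2*\<mu>)) \<and> QuadRes (int p) (\<delta>2 * (-e1*\<mu>))"
  have nX: "\<not> int p dvd e2*\<mu>" "\<not> int p dvd -e1*\<mu>" using nd pi by (simp_all add: prime_dvd_mult_iff)
  obtain v1 where v1: "int p dvd \<delta>1 * v1^2 - e2*\<mu>" using QuadRes_scaled_root[OF p(1) nd(2)] q by blast
  obtain v2 where v2: "int p dvd \<delta>2 * v2^2 - (-e1*\<mu>)" using QuadRes_scaled_root[OF p(1) nd(3)] q by blast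
  have n1: "\<not> int p dvd 1" by (rule prime_not_dvd_one[OF p(1)])
  show "D_padic_point p e1 e2 e3 (int p * \<mu>) (int p * \<delta>1, int p * \<delta>2, d3)"
  proof (rule D_padic_pointI_bounded[OF p(1) e, where M = 1], goal_cases)
    case (1 N)
    obtain u1 where u1: "int p ^ N dvd \<delta>1 * u1^2 - e2*\<mu>" using hensel_square_odd[OF p nd(2) nX(1) v1] by blast
    obtain u2 where u2: "int p ^ N dvd \<delta>2 * u2^2 - (-e1*\<mu>)" using hensel_square_odd[OF p nd(3) nX(2) v2] by blast
    \<comment> \<open>Conversely, t = 1 and u3 = 0 leave p times the two square root problems
      already solved by Hensel lifting.\<close>
    have A: "e1*(int p * \<mu>)*1^2 + (int p * \<delta>2)*u2^2 - d3*0^2 = int p * (\<delta>2 * u2^2 - (-e1*\<mu>))" by (simp add: algebra_simps)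
    have B: "e2*(int p * \<mu>)*1^2 + d3*0^2 - (int p * \<delta>1)*u1^2 = (- int p) * (\<delta>1 * u1^2 - e2*\<mu>)" by (simp add: algebra_simps)
    have C: "\<not> (int p ^ 1 dvd 1 \<and> int p ^ 1 dvd u1 \<and> int p ^ 1 dvd u2 \<and> int p ^ 1 dvd 0)" using n1 by simp
    show ?case
      by (rule exI[of _ 1], rule exI[of _ u1], rule exI[of _ u2], rule exI[of _ 0], unfold A B,
          intro conjI C dvd_mult u1 u2)
  qed
qed

section \<open>Matrix rows as local conditions\<close>

lemma D_padic_point_rotate_iff:
  "D_padic_point p e1 e2 e3 m (d1, d2, d3) \<longleftrightarrow> D_padic_point p e2 e3 e1 m (d2, d3, d1)"
  using D_padic_point_rotate by blast

lemma QuadRes_mult_iff: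
  assumes p: "prime p" "odd p" and a: "\<not> int p dvd a" "\<not> int p dvd b"
  shows "QuadRes (int p) (a * b) \<longleftrightarrow> (QuadRes (int p) a \<longleftrightarrow> QuadRes (int p) b)"
proof -
  have ab: "\<not> int p dvd a * b" using p a by (simp add: prime_dvd_mult_iff)
  have L: "Legendre u (int p) = (if QuadRes (int p) u then 1 else -1)" if "\<not> int p dvd u" for u
    using that by (simp add: Legendre_def cong_0_iff)
  show ?thesis using Legendre_mult[OF p, of a b] unfolding L[OF a(1)] L[OF a(2)] L[OF ab]
    by (auto split: if_splits)
qed

lemma QuadRes_one: "QuadRes p 1"
  unfolding QuadRes_def by (rule exI[of _ 1]) simp

lemma QuadRes_square: "QuadRes p (k^2)"
  unfolding QuadRes_def by (intro exI[of _ k] cong_refl)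

lemma QuadRes_power_iff:
  assumes p: "prime p" "odd p" and a: "\<not> int p dvd a"
  shows "QuadRes (int p) (a ^ c) \<longleftrightarrow> QuadRes (int p) a \<or> even c"
proof (induction c)
  case 0
  show ?case by (simp add: QuadRes_one)
next
  case (Suc c)
  have "\<not> int p dvd a ^ c" using p a prime_dvd_power[of "int p"] by auto
  then show ?case using Suc QuadRes_mult_iff[OF p a, of "a ^ c"] by auto
qed

lemma even_qr_bit: "even (qr_bit u p) \<longleftrightarrow> QuadRes (int p) u"
  by (simp add: qr_bit_def)

lemma QuadRes_prod_iff:
  assumes p: "prime p" "odd p" and S: "finite S" "\<And>q. q \<in> S \<Longrightarrow> \<not> int p dvd g q"
  shows "QuadRes (int p) (\<Prod>q\<in>S. g q ^ c q) \<longleftrightarrow> even (\<Sum>q\<in>S. qr_bit (g q) p * c q)"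
  using S
proof (induction S rule: finite_induct)
  case empty
  show ?case by (simp add: QuadRes_one)
next
  case (insert q S)
  have pi: "prime (int p)" using p by simp
  have q: "\<not> int p dvd g q" using insert.prems by simp
  have 1: "\<not> int p dvd g q ^ c q" using q pi prime_dvd_power by blast
  have 2: "\<not> int p dvd (\<Prod>q\<in>S. g q ^ c q)"
  proof
    assume "int p dvd (\<Prod>q\<in>S. g q ^ c q)"
    then obtain r where "r \<in> S" "int p dvd g r ^ c r" using insert.hyps(1) pi by (auto simp: prime_dvd_prod_iff)
    then show False using pi prime_dvd_power insert.prems by blast
  qed
  have IH: "QuadRes (int p) (\<Prod>q\<in>S. g q ^ c q) \<longleftrightarrow> even (\<Sum>q\<in>S. qr_bit (g q) p * c q)"
    using insert by blast
  show ?case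
    using insert.hyps by (simp add: QuadRes_mult_iff[OF p 1 2] IH QuadRes_power_iff[OF p q] even_qr_bit)
qed

text \<open>Off-diagonal entries of \<open>matA\<close>: the tame symbol of a unit against an
  element of valuation one.\<close>

lemma hilb_unit:
  assumes p: "prime p" "odd p" and b: "int p dvd b" "\<not> int p ^ 2 dvd b" and a: "\<not> int p dvd a"
  shows "hilb p a b = qr_bit a p"
proof -
  have n1: "\<not> int p dvd 1" by (rule prime_not_dvd_one[OF p(1)])
  have "conic_solvable p a b \<longleftrightarrow> QuadRes (int p) a"
  proof
    assume "conic_solvable p a b"
    from conic_solvable_imp_residue[OF p(1) b this] show "QuadRes (int p) a"
      unfolding QuadRes_def cong_iff_dvd_diff .
  next
    assume "QuadRes (int p) a"
    then obtain s where s: "int p dvd 1 * s^2 - a" unfolding QuadRes_def cong_iff_dvd_diff by auto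
    show "conic_solvable p a b" unfolding conic_solvable_def
    proof (rule allI, goal_cases)
      case (1 N)
      obtain r where r: "int p ^ N dvd 1 * r^2 - a" using hensel_square_odd[OF p n1 a s] by blast
      have A: "a*1^2 + b*0^2 - r^2 = - (1 * r^2 - a)" by simp
      have "int p ^ N dvd a*1^2 + b*0^2 - r^2" unfolding A using r by (simp only: dvd_minus_iff)
      then show ?case using n1 by blast
    qed
  qed
  then show ?thesis using hilb_eq_0_iff[of p a b] unfolding qr_bit_def hilb_def by presburger
qed

text \<open>Diagonal entries of \<open>matA\<close>: as [p, -p]_p = 0, the symbol equals
  [p, \<mu>]_p. Concretely, z vanishes modulo p and division by p turns the conic into x^2 = \<mu>
  y^2.\<close>

lemma hilb_self:
  assumes p: "prime p" "odd p" and \<mu>: "\<not> int p dvd \<mu>"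
  shows "hilb p (int p) (- (int p * \<mu>)) = qr_bit \<mu> p"
proof -
  have pi: "prime (int p)" using p by simp
  have n1: "\<not> int p dvd 1" by (rule prime_not_dvd_one[OF p(1)])
  have "conic_solvable p (int p) (- (int p * \<mu>)) \<longleftrightarrow> QuadRes (int p) \<mu>"
  proof
    assume h: "conic_solvable p (int p) (- (int p * \<mu>))"
    obtain x y z where n: "\<not> (int p dvd x \<and> int p dvd y \<and> int p dvd z)"
      and f: "int p ^ 2 dvd int p * x^2 + (- (int p * \<mu>))*y^2 - z^2" by (rule conic_solvableE[OF h])
    have "int p dvd int p * x^2 + (- (int p * \<mu>))*y^2 - z^2"
      using f by (auto simp: power2_eq_square dest: dvd_mult_left)
    then have "int p dvd (int p * x^2 + (- (int p * \<mu>))*y^2) - (int p * x^2 + (- (int p * \<mu>))*y^2 - z^2)"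
      by (rule dvd_diff[rotated]) simp
    then have "int p dvd z^2" by simp
    then have z: "int p dvd z" using pi by (simp add: prime_dvd_power_iff)
    then have "int p ^ 2 dvd z^2" by (simp add: dvd_power_same)
    from dvd_add[OF f this] have "int p * int p dvd int p * (x^2 - \<mu>*y^2)"
      by (simp add: power2_eq_square algebra_simps)
    then have g: "int p dvd x^2 - \<mu>*y^2" using pi by simp
    have "\<not> int p dvd y"
    proof
      assume y: "int p dvd y"
      then have "int p dvd (x^2 - \<mu>*y^2) + \<mu>*y^2" by (intro dvd_add[OF g]) (simp add: power2_eq_square)
      then have "int p dvd x" using pi by (simp add: prime_dvd_power_iff)
      then show False using n y z by blast
    qed
    moreover have "int p dvd \<mu>*y^2 - x^2" using g by (simp add: dvd_diff_commute)
    ultimately show "QuadRes (int p) \<mu>" by (rule QuadRes_cancel_square[OF p(1)])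
  next
    assume "QuadRes (int p) \<mu>"
    then obtain s where s: "int p dvd 1 * s^2 - \<mu>" unfolding QuadRes_def cong_iff_dvd_diff by auto
    show "conic_solvable p (int p) (- (int p * \<mu>))" unfolding conic_solvable_def
    proof (rule allI, goal_cases)
      case (1 N)
      obtain r where r: "int p ^ N dvd 1 * r^2 - \<mu>" using hensel_square_odd[OF p n1 \<mu> s] by blast
      have A: "int p * r^2 + (- (int p * \<mu>))*1^2 - 0^2 = int p * (1 * r^2 - \<mu>)" by (simp add: algebra_simps)
      have "int p ^ N dvd int p * r^2 + (- (int p * \<mu>))*1^2 - 0^2" unfolding A by (rule dvd_mult[OF r])
      then show ?case using n1 by blast
    qed
  qed
  then show ?thesis using hilb_eq_0_iff[of p "int p" "- (int p * \<mu>)"] unfolding qr_bit_def hilb_def by presburger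
qed

section \<open>Exponents of squarefree divisors and the rows of the matrix\<close>

lemma squarefree_multiplicity:
  fixes d :: int
  assumes "squarefree d" "prime p"
  shows "multiplicity (int p) d = (if int p dvd d then 1 else 0)"
proof -
  have d0: "d \<noteq> 0" using assms by auto
  have pi: "prime (int p)" using assms by simp
  have "\<not> int p ^ 2 dvd d" by (rule squarefree_not_square_dvd[OF assms])
  then have "multiplicity (int p) d < 2" using multiplicity_dvd' not_less by blast
  moreover have "int p dvd d \<longleftrightarrow> multiplicity (int p) d \<noteq> 0"
    using d0 pi prime_multiplicity_gt_zero_iff[of "int p" d] by auto
  ultimately show ?thesis by auto
qed

lemma prod_list_eq_prod_set: "distinct (xs::nat list) \<Longrightarrow> prod_list xs = \<Prod>(set xs)"
  by (metis prod.distinct_set_conv_list list.map_ident)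

lemma squarefree_prod_list_primes:
  assumes "distinct ps" "\<forall>p\<in>set ps. prime (p::nat)"
  shows "squarefree (int (prod_list ps))"
proof -
  have "prod_list ps = \<Prod>(set ps)" by (rule prod_list_eq_prod_set[OF assms(1)])
  then have "int (prod_list ps) = (\<Prod>p\<in>set ps. int p)" by simp
  also have "squarefree \<dots>"
  proof (rule squarefree_prod_coprime)
    show "coprime (int a) (int b)" if "a \<in> set ps" "b \<in> set ps" "a \<noteq> b" for a b
      using that assms(2) by (simp add: primes_coprime)
    show "squarefree (int a)" if "a \<in> set ps" for a using that assms(2) by (simp add: squarefree_prime)
  qed
  finally show ?thesis .
qed

lemma divisor_prod_primes:
  fixes d :: int
  assumes ps: "distinct ps" "\<forall>p\<in>set ps. prime (p::nat)" and d: "d > 0" "d dvd int (prod_list ps)"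
  shows "d = (\<Prod>q\<in>set ps. int q ^ multiplicity (int q) d)"
proof -
  have "d = (\<Prod>p\<in>prime_factors d. p ^ multiplicity p d)" using prod_prime_factors[of d] d(1) by simp
  also have "\<dots> = (\<Prod>p\<in>int ` set ps. p ^ multiplicity p d)"
  proof (rule prod.mono_neutral_left)
    show "prime_factors d \<subseteq> int ` set ps"
    proof
      fix r assume r: "r \<in> prime_factors d"
      then have rp: "prime r" "r dvd d" by auto
      then have "r dvd int (prod_list ps)" using d(2) dvd_trans by blast
      moreover have "prod_list ps = \<Prod>(set ps)" by (rule prod_list_eq_prod_set[OF ps(1)])
      ultimately have "r dvd (\<Prod>p\<in>set ps. int p)" by simp
      then obtain q where "q \<in> set ps" "r dvd int q" using rp(1) by (auto simp: prime_dvd_prod_iff)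
      then have "r = int q" using rp(1) ps(2) by (simp add: primes_dvd_imp_eq)
      then show "r \<in> int ` set ps" using \<open>q \<in> set ps\<close> by blast
    qed
    show "\<forall>i\<in>int ` set ps - prime_factors d. i ^ multiplicity i d = 1"
    proof
      fix i assume i: "i \<in> int ` set ps - prime_factors d"
      then have "prime i" using ps(2) by auto
      then have "\<not> i dvd d" using i d(1) by (auto simp: in_prime_factors_iff)
      then show "i ^ multiplicity i d = 1" by (simp add: not_dvd_imp_multiplicity_0)
    qed
  qed simp
  also have "\<dots> = (\<Prod>q\<in>set ps. int q ^ multiplicity (int q) d)"
    by (subst prod.reindex) (simp_all add: inj_on_def)
  finally show ?thesis .
qed

text \<open>The row of \<open>matA\<close> at p, applied to the exponents of d, is the residue
  symbol at p of d with its factor p, if there is one, replaced by \<mu> = n/p. The replacement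
  comes from the diagonal entry.\<close>

lemma hilb_sum_parity:
  fixes d :: int
  assumes ps: "distinct ps" "\<forall>p\<in>set ps. prime (p::nat)" and n: "int (prod_list ps) = int p * \<mu>"
    and d: "d > 0" "d dvd int (prod_list ps)" and p: "p \<in> set ps" "odd p"
  shows "\<not> int p dvd d \<Longrightarrow> even (\<Sum>q\<in>set ps. hilb p (int q) (- int (prod_list ps)) * multiplicity (int q) d)
      \<longleftrightarrow> QuadRes (int p) d"
    and "d = int p * \<delta> \<Longrightarrow> even (\<Sum>q\<in>set ps. hilb p (int q) (- int (prod_list ps)) * multiplicity (int q) d)
      \<longleftrightarrow> QuadRes (int p) (\<delta> * \<mu>)"
proof -
  let ?n = "int (prod_list ps)"
  let ?c = "\<lambda>q. multiplicity (int q) d"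
  have pp: "prime p" using p ps by blast
  have pi: "prime (int p)" using pp by simp
  have sqn: "squarefree ?n" by (rule squarefree_prod_list_primes[OF ps])
  have sqd: "squarefree d" using sqn d(2) squarefree_mono by blast
  have np2: "\<not> int p ^ 2 dvd ?n" by (rule squarefree_not_square_dvd[OF sqn pp])
  have \<mu>: "\<not> int p dvd \<mu>" using np2 unfolding n by (simp add: power2_eq_square)
  have nq: "\<not> int p dvd int q" if "q \<in> set ps - {p}" for q
    using that ps(2) pp primes_dvd_imp_eq by auto
  have hq: "hilb p (int q) (- ?n) = qr_bit (int q) p" if "q \<in> set ps - {p}" for q
    by (rule hilb_unit[OF pp p(2) _ _ nq[OF that]]) (use n np2 in simp_all)
  have hp: "hilb p (int p) (- ?n) = qr_bit \<mu> p" unfolding n by (rule hilb_self[OF pp p(2) \<mu>])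
  define r where "r = (\<Prod>q\<in>set ps - {p}. int q ^ ?c q)"
  have "(\<Sum>q\<in>set ps. hilb p (int q) (- ?n) * ?c q)
     = hilb p (int p) (- ?n) * ?c p + (\<Sum>q\<in>set ps - {p}. hilb p (int q) (- ?n) * ?c q)"
    using p(1) by (simp add: sum.remove)
  also have "(\<Sum>q\<in>set ps - {p}. hilb p (int q) (- ?n) * ?c q) = (\<Sum>q\<in>set ps - {p}. qr_bit (int q) p * ?c q)"
    by (rule sum.cong[OF refl]) (simp only: hq)
  finally have S: "(\<Sum>q\<in>set ps. hilb p (int q) (- ?n) * ?c q)
     = qr_bit \<mu> p * ?c p + (\<Sum>q\<in>set ps - {p}. qr_bit (int q) p * ?c q)" unfolding hp .
  have R: "QuadRes (int p) r \<longleftrightarrow> even (\<Sum>q\<in>set ps - {p}. qr_bit (int q) p * ?c q)" unfolding r_def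
    by (rule QuadRes_prod_iff[OF pp p(2)]) (use nq in auto)
  have "d = (\<Prod>q\<in>set ps. int q ^ ?c q)" by (rule divisor_prod_primes[OF ps d])
  also have "\<dots> = int p ^ ?c p * r" unfolding r_def using p(1) by (simp add: prod.remove)
  finally have dr: "d = int p ^ ?c p * r" .
  show "even (\<Sum>q\<in>set ps. hilb p (int q) (- ?n) * ?c q) \<longleftrightarrow> QuadRes (int p) d" if "\<not> int p dvd d"
  proof -
    have c: "?c p = 0" using that by (simp add: not_dvd_imp_multiplicity_0)
    then show ?thesis using dr R unfolding S by simp
  qed
  show "even (\<Sum>q\<in>set ps. hilb p (int q) (- ?n) * ?c q) \<longleftrightarrow> QuadRes (int p) (\<delta> * \<mu>)" if \<delta>: "d = int p * \<delta>"
  proof -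
    have c: "?c p = 1" using \<delta> squarefree_multiplicity[OF sqd pp] by simp
    have "d = int p * r" using dr unfolding c by (simp only: power_one_right)
    then have "int p * r = int p * \<delta>" using \<delta> by metis
    then have r: "r = \<delta>" using prime_gt_0_nat[OF pp] by simp
    have "\<not> int p ^ 2 dvd d" by (rule squarefree_not_square_dvd[OF sqd pp])
    then have "\<not> int p dvd \<delta>" unfolding \<delta> by (simp add: power2_eq_square)
    from QuadRes_mult_iff[OF pp p(2) this \<mu>] show ?thesis
      unfolding S c using R unfolding r by (auto simp: even_qr_bit)
  qed
qed

lemma squarefree_square_parity:
  fixes d1 d2 d3 :: int
  assumes sf: "squarefree d1" "squarefree d2" "squarefree d3" and sq: "is_square (d1*d2*d3)" and p: "prime p"
  shows "(int p dvd d1) = ((int p dvd d2) \<noteq> (int p dvd d3))"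
proof -
  have pe: "prime_elem (int p)" using p by simp
  have nz: "d1 \<noteq> 0" "d2 \<noteq> 0" "d3 \<noteq> 0" using sf by auto
  obtain k where k: "d1*d2*d3 = k^2" using sq unfolding is_square_def by blast
  have k0: "k \<noteq> 0" using k nz by auto
  have "multiplicity (int p) (d1*d2*d3) = 2 * multiplicity (int p) k"
    unfolding k using pe k0 by (simp add: prime_elem_multiplicity_power_distrib)
  moreover have "multiplicity (int p) (d1*d2*d3)
      = multiplicity (int p) d1 + multiplicity (int p) d2 + multiplicity (int p) d3"
    using pe nz by (simp add: prime_elem_multiplicity_mult_distrib)
  ultimately have "even (multiplicity (int p) d1 + multiplicity (int p) d2 + multiplicity (int p) d3)" by simp
  then show ?thesis unfolding squarefree_multiplicity[OF sf(1) p] squarefree_multiplicity[OF sf(2) p]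
      squarefree_multiplicity[OF sf(3) p] by (auto split: if_splits)
qed

lemma is_square_cancel:
  fixes c x :: int
  assumes "c \<noteq> 0" "is_square (c^2 * x)"
  shows "is_square x"
proof -
  obtain k where k: "c^2 * x = k^2" using assms(2) unfolding is_square_def by blast
  then have "c^2 dvd k^2" by (metis dvd_triv_left)
  then have "c dvd k" by simp
  then obtain j where "k = c*j" by (rule dvdE)
  then have "c^2 * x = c^2 * j^2" using k by (simp add: power_mult_distrib)
  then have "x = j^2" using assms(1) by simp
  then show ?thesis unfolding is_square_def by blast
qed

lemma QuadRes_square_product:
  assumes p: "prime p" "odd p" and nd: "\<not> int p dvd a" "\<not> int p dvd b" "\<not> int p dvd c"
    and sq: "is_square (a*b*c)"
  shows "QuadRes (int p) c \<longleftrightarrow> (QuadRes (int p) a \<longleftrightarrow> QuadRes (int p) b)"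
proof -
  have ab: "\<not> int p dvd a*b" using p nd by (simp add: prime_dvd_mult_iff)
  have "QuadRes (int p) (a*b*c)" using sq QuadRes_square unfolding is_square_def by auto
  then show ?thesis using QuadRes_mult_iff[OF p ab nd(3)] QuadRes_mult_iff[OF p nd(1,2)] by blast
qed

text \<open>By parity p divides none or exactly two of the d_i. Each case has a local criterion
  consisting of two residue conditions; multiplicativity of the symbol turns them into the two rows,
  possibly after replacing one condition by the sum of both.\<close>

lemma D_padic_point_iff_rows:
  fixes d1 d2 d3 :: int
  assumes ps: "distinct ps" "\<forall>p\<in>set ps. prime (p::nat)" and p: "p \<in> set ps" "odd p"
    and e: "e1 + e2 + e3 = (0::int)" and ne: "\<not> int p dvd e1" "\<not> int p dvd e2" "\<not> int p dvd e3"
    and d: "d1 > 0" "d1 dvd int (prod_list ps)" "d2 > 0" "d2 dvd int (prod_list ps)"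
      "d3 > 0" "d3 dvd int (prod_list ps)"
    and sq: "is_square (d1*d2*d3)"
  shows "D_padic_point p e1 e2 e3 (int (prod_list ps)) (d1, d2, d3) \<longleftrightarrow>
    even ((\<Sum>q\<in>set ps. hilb p (int q) (- int (prod_list ps)) * multiplicity (int q) d1)
      + qr_bit (-e3) p * multiplicity (int p) d1 + qr_bit (-e2*e3) p * multiplicity (int p) d2) \<and>
    even (qr_bit (-e1*e3) p * multiplicity (int p) d1
      + (\<Sum>q\<in>set ps. hilb p (int q) (- int (prod_list ps)) * multiplicity (int q) d2)
      + qr_bit e3 p * multiplicity (int p) d2)"
proof -
  let ?n = "int (prod_list ps)"
  let ?Q = "QuadRes (int p)"
  have pp: "prime p" using p ps by blast
  have pi: "prime (int p)" using pp by simp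
  have sqn: "squarefree ?n" by (rule squarefree_prod_list_primes[OF ps])
  have sf: "squarefree d1" "squarefree d2" "squarefree d3" using sqn d squarefree_mono by blast+
  have p2: "\<not> int p ^ 2 dvd x" if "squarefree x" for x :: int by (rule squarefree_not_square_dvd[OF that pp])
  have "p dvd prod_list ps" using p(1) by (rule prod_list_dvd)
  then have pn: "int p dvd ?n" by simp
  then obtain \<mu> where n: "?n = int p * \<mu>" by (rule dvdE)
  have \<mu>: "\<not> int p dvd \<mu>" using p2[OF sqn] unfolding n by (simp add: power2_eq_square)
  have nd1: "\<not> int p dvd -1" using pi not_prime_unit by auto
  note mi = QuadRes_mult_iff[OF pp p(2)]
  have neg: "?Q (-x) \<longleftrightarrow> (?Q (-1) \<longleftrightarrow> ?Q x)" if "\<not> int p dvd x" for x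
    using mi[OF nd1 that] by simp
  have unit: "\<not> int p dvd x * y" if "\<not> int p dvd x" "\<not> int p dvd y" for x y
    using that pi by (simp add: prime_dvd_mult_iff)
  have qs: "?Q (-e3) \<longleftrightarrow> (?Q (-1) \<longleftrightarrow> ?Q e3)" "?Q (-e2*e3) \<longleftrightarrow> (?Q (-1) \<longleftrightarrow> (?Q e2 \<longleftrightarrow> ?Q e3))"
    "?Q (-e1*e3) \<longleftrightarrow> (?Q (-1) \<longleftrightarrow> (?Q e1 \<longleftrightarrow> ?Q e3))"
    using neg[OF ne(3)] neg[OF unit[OF ne(2,3)]] neg[OF unit[OF ne(1,3)]] mi[OF ne(2,3)] mi[OF ne(1,3)] by simp_all
  note mult1 = squarefree_multiplicity[OF sf(1) pp] and mult2 = squarefree_multiplicity[OF sf(2) pp]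
  note bits = mult1 mult2 even_add even_mult_iff even_qr_bit qs if_True if_False odd_one even_zero simp_thms
  note par = squarefree_square_parity[OF sf sq pp]
  note hs1 = hilb_sum_parity[OF ps n d(1,2) p] and hs2 = hilb_sum_parity[OF ps n d(3,4) p]
  have qprod: "?Q (a * (b*\<mu>)) \<longleftrightarrow> (?Q a \<longleftrightarrow> (?Q b \<longleftrightarrow> ?Q \<mu>))" if "\<not> int p dvd a" "\<not> int p dvd b" for a b
    using mi[OF that(1) unit[OF that(2) \<mu>]] mi[OF that(2) \<mu>] by simp
  have nege: "\<not> int p dvd -e1" "\<not> int p dvd -e2" "\<not> int p dvd -e3" using ne by simp_all
  have cof: "\<not> int p dvd \<delta>" if "x = int p * \<delta>" "squarefree x" for x \<delta>
    using p2[OF that(2)] unfolding that(1) by (simp add: power2_eq_square)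
  have sq': "is_square (d2*d3*d1)" using sq by (simp add: mult_ac)
  show ?thesis
  proof (cases "int p dvd d1"; cases "int p dvd d2")
    assume h: "int p dvd d1" "int p dvd d2"
    then have n3: "\<not> int p dvd d3" using par by blast
    obtain \<delta>1 \<delta>2 where \<delta>: "d1 = int p * \<delta>1" "d2 = int p * \<delta>2" using h by (auto elim!: dvdE)
    have u: "\<not> int p dvd \<delta>1" "\<not> int p dvd \<delta>2" using cof \<delta> sf by blast+
    have D: "D_padic_point p e1 e2 e3 ?n (d1, d2, d3) \<longleftrightarrow> ?Q (\<delta>1 * (e2*\<mu>)) \<and> ?Q (\<delta>2 * (-e1*\<mu>))"
      unfolding n \<delta> by (rule D_padic_point_twist_ramified[OF pp p(2) e \<mu> u n3 ne(1,2)])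
    \<comment> \<open>What remains is a propositional identity between residue characters at
      p.\<close>
    show ?thesis unfolding D qprod[OF u(1) ne(2)] qprod[OF u(2) nege(1)] neg[OF ne(1)]
      using h mi[OF u(1) \<mu>] mi[OF u(2) \<mu>]
      by (simp only: bits hs1(2)[OF \<delta>(1)] hs2(2)[OF \<delta>(2)]) argo
  next
    assume h: "int p dvd d1" "\<not> int p dvd d2"
    then have d3: "int p dvd d3" using par by blast
    obtain \<delta>1 \<delta>3 where \<delta>: "d1 = int p * \<delta>1" "d3 = int p * \<delta>3" using h d3 by (auto elim!: dvdE)
    have u: "\<not> int p dvd \<delta>1" "\<not> int p dvd \<delta>3" using cof \<delta> sf by blast+
    have e': "e3 + e1 + e2 = 0" using e by simp
    have "D_padic_point p e1 e2 e3 ?n (d1, d2, d3) \<longleftrightarrow> D_padic_point p e3 e1 e2 ?n (d3, d1, d2)"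
      using D_padic_point_rotate_iff by metis
    also have "\<dots> \<longleftrightarrow> ?Q (\<delta>3 * (e1*\<mu>)) \<and> ?Q (\<delta>1 * (-e3*\<mu>))"
      unfolding n \<delta> by (rule D_padic_point_twist_ramified[OF pp p(2) e' \<mu> u(2,1) h(2) ne(3,1)])
    finally have D: "D_padic_point p e1 e2 e3 ?n (d1, d2, d3) \<longleftrightarrow> ?Q (\<delta>3 * (e1*\<mu>)) \<and> ?Q (\<delta>1 * (-e3*\<mu>))" .
    \<comment> \<open>The second row contains the character of d2, the local criterion that of
      \<delta>3; the square product \<delta>3 \<delta>1 d2 links them.\<close>
    have "d1*d2*d3 = (int p)^2 * (\<delta>3*\<delta>1*d2)" unfolding \<delta> by (simp add: power2_eq_square algebra_simps)
    from sq[unfolded this] have "is_square (\<delta>3*\<delta>1*d2)" using is_square_cancel[of "int p"] prime_gt_0_nat[OF pp] by simp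
    note q2 = QuadRes_square_product[OF pp p(2) u(2,1) h(2) this]
    show ?thesis unfolding D qprod[OF u(1) nege(3)] qprod[OF u(2) ne(1)] neg[OF ne(3)]
      using h mi[OF u(1) \<mu>] q2
      by (simp only: bits hs1(2)[OF \<delta>(1)] hs2(1)[OF h(2)]) argo
  next
    assume h: "\<not> int p dvd d1" "int p dvd d2"
    then have d3: "int p dvd d3" using par by blast
    obtain \<delta>2 \<delta>3 where \<delta>: "d2 = int p * \<delta>2" "d3 = int p * \<delta>3" using h d3 by (auto elim!: dvdE)
    have u: "\<not> int p dvd \<delta>2" "\<not> int p dvd \<delta>3" using cof \<delta> sf by blast+
    have e': "e2 + e3 + e1 = 0" using e by simp
    have "D_padic_point p e1 e2 e3 ?n (d1, d2, d3) \<longleftrightarrow> D_padic_point p e2 e3 e1 ?n (d2, d3, d1)"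
      by (rule D_padic_point_rotate_iff)
    also have "\<dots> \<longleftrightarrow> ?Q (\<delta>2 * (e3*\<mu>)) \<and> ?Q (\<delta>3 * (-e2*\<mu>))"
      unfolding n \<delta> by (rule D_padic_point_twist_ramified[OF pp p(2) e' \<mu> u h(1) ne(2,3)])
    finally have D: "D_padic_point p e1 e2 e3 ?n (d1, d2, d3) \<longleftrightarrow> ?Q (\<delta>2 * (e3*\<mu>)) \<and> ?Q (\<delta>3 * (-e2*\<mu>))" .
    have "d1*d2*d3 = (int p)^2 * (\<delta>2*\<delta>3*d1)" unfolding \<delta> by (simp add: power2_eq_square algebra_simps)
    from sq[unfolded this] have "is_square (\<delta>2*\<delta>3*d1)" using is_square_cancel[of "int p"] prime_gt_0_nat[OF pp] by simp
    note q1 = QuadRes_square_product[OF pp p(2) u h(1) this]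
    show ?thesis unfolding D qprod[OF u(1) ne(3)] qprod[OF u(2) nege(2)] neg[OF ne(2)]
      using h mi[OF u(1) \<mu>] q1
      by (simp only: bits hs2(2)[OF \<delta>(1)] hs1(1)[OF h(1)]) argo
  next
    assume h: "\<not> int p dvd d1" "\<not> int p dvd d2"
    then have n3: "\<not> int p dvd d3" using par by blast
    have "D_padic_point p e1 e2 e3 ?n (d1, d2, d3) \<longleftrightarrow> ?Q d1 \<and> ?Q d2"
    proof
      assume D: "D_padic_point p e1 e2 e3 ?n (d1, d2, d3)"
      have "?Q d1" by (rule D_padic_point_twist_unramified[OF pp pn p2[OF sqn] ne(1) h n3 sq D])
      moreover have "?Q d2"
        by (rule D_padic_point_twist_unramified[OF pp pn p2[OF sqn] ne(2) h(2) n3 h(1) sq' D_padic_point_rotate[OF D]])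
      ultimately show "?Q d1 \<and> ?Q d2" by blast
    next
      assume q: "?Q d1 \<and> ?Q d2"
      then have "?Q d3" using QuadRes_square_product[OF pp p(2) h n3 sq] by blast
      then show "D_padic_point p e1 e2 e3 ?n (d1, d2, d3)"
        using q by (intro D_padic_point_residues[OF pp p(2) e h n3]) auto
    qed
    then show ?thesis using h hs1(1) hs2(1) by (simp add: mult1 mult2)
  qed
qed

section \<open>Squares and torsion translates\<close>

lemma is_square_even_multiplicity:
  assumes "is_square x" "x \<noteq> 0" "prime p"
  shows "even (multiplicity (int p) x)"
proof -
  obtain k where k: "x = k^2" using assms(1) unfolding is_square_def by blast
  have "multiplicity (int p) x = 2 * multiplicity (int p) k"
    unfolding k using assms by (intro prime_elem_multiplicity_power_distrib) (auto simp: k)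
  then show ?thesis by simp
qed

lemma multiplicity_mult_prime:
  fixes x y :: int
  assumes "prime p" "x \<noteq> 0" "y \<noteq> 0"
  shows "multiplicity (int p) (x * y) = multiplicity (int p) x + multiplicity (int p) y"
  using assms by (simp add: prime_elem_multiplicity_mult_distrib)

lemma is_squareI_multiplicity:
  fixes x :: int
  assumes x: "x > 0" and ev: "\<And>p. prime p \<Longrightarrow> even (multiplicity (int p) x)"
  shows "is_square x"
proof -
  define s c where "s = squarefree_part x" and "c = square_part x"
  have xs: "x = s * c^2" unfolding s_def c_def by (rule squarefree_decompose)
  have nz: "s \<noteq> 0" "c \<noteq> 0" using x xs by auto
  have sf: "squarefree s" unfolding s_def by simp
  have "is_unit s"
  proof (rule ccontr)
    assume "\<not> is_unit s"
    then obtain q where q: "prime q" "q dvd s" using prime_divisor_exists[OF nz(1)] by blast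
    obtain p where p: "prime p" and qp: "q = int p" by (rule prime_int_cases[OF q(1)])
    have "multiplicity (int p) x = multiplicity (int p) s + 2 * multiplicity (int p) c"
      unfolding xs using nz p by (simp add: multiplicity_mult_prime prime_elem_multiplicity_power_distrib)
    then have "even (multiplicity (int p) s)" using ev[OF p] by simp
    then show False using squarefree_multiplicity[OF sf p] q(2) qp by simp
  qed
  moreover have "s > 0" using x unfolding xs by (simp add: zero_less_mult_iff)
  ultimately have "s = 1" by simp
  then show ?thesis using xs unfolding is_square_def by auto
qed

lemma is_square_nonneg: "is_square x \<Longrightarrow> x \<ge> 0"
  unfolding is_square_def by auto

lemma is_square_coprime:
  fixes a b :: int
  assumes sq: "is_square (a * b)" and cop: "coprime a b" and a: "a > 0" and b: "b \<noteq> 0"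
  shows "is_square b"
proof (rule is_squareI_multiplicity)
  show "b > 0" using is_square_nonneg[OF sq] a b by (simp add: zero_le_mult_iff)
  show "even (multiplicity (int p) b)" if p: "prime p" for p
  proof (cases "int p dvd b")
    case True
    then have "\<not> int p dvd a" using cop p not_prime_unit coprime_common_divisor
      by (metis prime_nat_int_transfer)
    then show ?thesis using is_square_even_multiplicity[OF sq _ p] a b
      by (simp add: multiplicity_mult_prime[OF p] not_dvd_imp_multiplicity_0)
  next
    case False
    then show ?thesis by (simp add: not_dvd_imp_multiplicity_0)
  qed
qed

text \<open>Up to squares a is b x and c is b y, so a c is x y, that is z. This composes two torsion
  translations entry by entry.\<close>

lemma is_square_chain:
  assumes "is_square (a * b * x)" "is_square (c * b * y)" "b \<noteq> 0" "x * y = z * w^2" "w \<noteq> 0"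
  shows "is_square (a * c * z)"
proof -
  obtain k l where k: "a * b * x = k^2" "c * b * y = l^2" using assms(1,2) unfolding is_square_def by blast
  have "(b*w)^2 * (a*c*z) = b^2 * a * c * (z * w^2)" by (simp add: power_mult_distrib mult_ac)
  also have "\<dots> = (a*b*x) * (c*b*y)" unfolding assms(4)[symmetric] by (simp add: power2_eq_square mult_ac)
  also have "\<dots> = (k*l)^2" unfolding k by (simp add: power_mult_distrib)
  finally have sq: "is_square ((b*w)^2 * (a*c*z))" unfolding is_square_def by blast
  have "b*w \<noteq> 0" using assms(3,5) by simp
  from is_square_cancel[OF this sq] show ?thesis .
qed

lemma squarefree_eqI:
  fixes a b :: int
  assumes "squarefree a" "squarefree b" "is_square (a*b)" "a > 0" "b > 0"
  shows "a = b"
proof (rule multiplicity_eq_int)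
  show "multiplicity r a = multiplicity r b" if r: "prime r" for r
  proof -
    obtain p where p: "prime p" and rp: "r = int p" by (rule prime_int_cases[OF r])
    have "even (multiplicity (int p) a + multiplicity (int p) b)"
      using is_square_even_multiplicity[OF assms(3) _ p] assms(4,5) multiplicity_mult_prime[OF p, of a b] by auto
    then show ?thesis unfolding rp squarefree_multiplicity[OF assms(1) p] squarefree_multiplicity[OF assms(2) p]
      by (auto split: if_splits)
  qed
qed (use assms in simp_all)

text \<open>Up to sign c is the squarefree part of w, so its primes are among those of w and hence
  of n.\<close>

lemma squarefree_dvdI:
  fixes c w :: int
  assumes sf: "squarefree c" and sq: "is_square (c*w)" and w: "w > 0" and n: "n \<noteq> 0"
    and pw: "\<And>p. prime p \<Longrightarrow> int p dvd w \<Longrightarrow> int p dvd n"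
  shows "c > 0" "c dvd n"
proof -
  have c0: "c \<noteq> 0" using sf by auto
  show "c > 0" using is_square_nonneg[OF sq] c0 w by (simp add: zero_le_mult_iff)
  show "c dvd n"
  proof (rule multiplicity_le_imp_dvd[OF c0])
    fix r :: int assume r: "prime r"
    obtain p where p: "prime p" and rp: "r = int p" by (rule prime_int_cases[OF r])
    show "multiplicity r c \<le> multiplicity r n"
    proof (cases "int p dvd c")
      case False
      then show ?thesis unfolding rp by (simp add: not_dvd_imp_multiplicity_0)
    next
      case True
      then have c1: "multiplicity (int p) c = 1" using squarefree_multiplicity[OF sf p] by simp
      have "even (multiplicity (int p) c + multiplicity (int p) w)"
        using is_square_even_multiplicity[OF sq _ p] c0 w multiplicity_mult_prime[OF p, of c w] by auto
      then have "odd (multiplicity (int p) w)" unfolding c1 by simp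
      then have "multiplicity (int p) w > 0" by (rule odd_pos)
      then have "int p dvd w" using not_dvd_imp_multiplicity_0[of "int p" w] by linarith
      then have "int p dvd n" by (rule pw[OF p])
      then have "multiplicity (int p) n > 0" using n p by (simp add: prime_multiplicity_gt_zero_iff)
      then show ?thesis unfolding rp c1 by simp
    qed
  qed
qed

section \<open>Selmer elements and their translates by torsion\<close>

lemma Sel2_iff:
  "(d1, d2, d3) \<in> Sel2 e1 e2 e3 m \<longleftrightarrow> squarefree d1 \<and> squarefree d2 \<and> squarefree d3 \<and>
     is_square (d1*d2*d3) \<and> D_real_point e1 e2 e3 m (d1, d2, d3) \<and>
     (\<forall>p. prime p \<longrightarrow> D_padic_point p e1 e2 e3 m (d1, d2, d3))"
  unfolding Sel2_def D_adelic_point_def by auto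

lemma D_padic_point_all_primes:
  assumes "\<And>p. prime p \<Longrightarrow> odd p \<Longrightarrow> D_padic_point p e1 e2 e3 m L"
    "D_padic_point 2 e1 e2 e3 m L" "prime p"
  shows "D_padic_point p e1 e2 e3 m L"
  using assms prime_odd_nat[OF assms(3)] prime_ge_2_nat[OF assms(3)] by (cases "p = 2") auto

lemma Sel2_rotate:
  assumes "e1 + e2 + e3 = 0" "(d1, d2, d3) \<in> Sel2 e1 e2 e3 m"
  shows "(d2, d3, d1) \<in> Sel2 e2 e3 e1 m"
proof -
  have "d2*d3*d1 = d1*d2*d3" by simp
  then show ?thesis using assms D_real_point_rotate[OF assms(1)] D_padic_point_rotate unfolding Sel2_iff by metis
qed

lemma one_in_Sel2:
  assumes e: "e1 + e2 + e3 = (0::int)"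
  shows "(1, 1, 1) \<in> Sel2 e1 e2 e3 m"
  unfolding Sel2_iff
proof (intro conjI allI impI)
  show "is_square (1*1*1)" unfolding is_square_def by (rule exI[of _ 1]) simp
  show "D_real_point e1 e2 e3 m (1, 1, 1)" by (rule D_real_pointI[OF e, of 0 1 1 1]) simp_all
  fix p :: nat assume p: "prime p"
  have n1: "\<not> int p dvd 1" by (rule prime_not_dvd_one[OF p])
  show "D_padic_point p e1 e2 e3 m (1, 1, 1)"
    by (rule D_padic_pointI_bounded[OF p e, where M = 1],
        rule exI[of _ 0], rule exI[of _ 1], rule exI[of _ 1], rule exI[of _ 1]) (use n1 in simp)
qed simp_all

text \<open>The translated triple need not be squarefree. Its squarefree parts c_i represent the
  same classes and are tied to the d_i by square conditions, the form in which
  \<open>sel_equiv\<close> consumes them.\<close>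

lemma Sel2_translate:
  assumes e: "e1 + e2 + e3 = (0::int)" and nz: "e1 \<noteq> 0" "e2 \<noteq> 0" "m \<noteq> 0"
    and S: "(d1, d2, d3) \<in> Sel2 e1 e2 e3 m"
  obtains c1 c2 c3 where "(c1, c2, c3) \<in> Sel2 e1 e2 e3 m"
    "is_square (c1 * d1 * (e2*m))" "is_square (c2 * d2 * (-e1*m))" "is_square (c3 * d3 * (-e1*e2))"
proof -
  have S': "squarefree d1" "squarefree d2" "squarefree d3" "is_square (d1*d2*d3)"
    "D_real_point e1 e2 e3 m (d1, d2, d3)"
    "\<And>p. prime p \<Longrightarrow> D_padic_point p e1 e2 e3 m (d1, d2, d3)"
    using S unfolding Sel2_iff by blast+
  have d0: "d1 \<noteq> 0" "d2 \<noteq> 0" "d3 \<noteq> 0" using S'(1-3) by auto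
  obtain k where k: "d1*d2*d3 = k^2" using S'(4) unfolding is_square_def by blast
  have k0: "k \<noteq> 0" using k d0 by auto
  have "\<exists>c r. squarefree c \<and> r \<noteq> 0 \<and> x = c * r^2" if "x \<noteq> 0" for x :: int
    using that squarefree_decompose[of x] by (intro exI[of _ "squarefree_part x"] exI[of _ "square_part x"]) simp
  then have dec: "\<exists>c r. squarefree c \<and> r \<noteq> 0 \<and> x * y = c * r^2" if "x \<noteq> 0" "y \<noteq> 0" for x y :: int
    using that by (metis mult_eq_0_iff)
  obtain c1 r1 where c1: "squarefree c1" "r1 \<noteq> 0" "d1 * (e2*m) = c1 * r1^2" using dec[of d1 "e2*m"] d0 nz by auto
  obtain c2 r2 where c2: "squarefree c2" "r2 \<noteq> 0" "d2 * (-e1*m) = c2 * r2^2" using dec[of d2 "-e1*m"] d0 nz by auto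
  obtain c3 r3 where c3: "squarefree c3" "r3 \<noteq> 0" "d3 * (-e1*e2) = c3 * r3^2" using dec[of d3 "-e1*e2"] d0 nz by auto
  have sqI: "is_square (c * d * x)" if "d * x = c * r^2" for c d x r
  proof -
    have "c * d * x = (c * r)^2" using that by (simp add: mult.assoc power2_eq_square)
    then show ?thesis unfolding is_square_def by blast
  qed
  have E1: "(e2*m*d2*d3) * d1^2 = c1 * (r1*k)^2"
  proof -
    have "(e2*m*d2*d3) * d1^2 = (d1 * (e2*m)) * (d1*d2*d3)" by (simp add: power2_eq_square mult_ac)
    then show ?thesis unfolding c1(3) k by (simp add: power_mult_distrib)
  qed
  have E2: "(-e1*m*d1*d3) * d2^2 = c2 * (r2*k)^2"
  proof -
    have "(-e1*m*d1*d3) * d2^2 = (d2 * (-e1*m)) * (d1*d2*d3)" by (simp add: power2_eq_square mult_ac)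
    then show ?thesis unfolding c2(3) k by (simp add: power_mult_distrib)
  qed
  have E3: "(-e1*e2*d3) * 1^2 = c3 * r3^2" using c3(3) by (simp add: mult_ac)
  have "(r1*r2*r3)^2 * (c1*c2*c3) = (c1 * r1^2) * (c2 * r2^2) * (c3 * r3^2)" by (simp add: power_mult_distrib mult_ac)
  also have "\<dots> = (d1*d2*d3) * (e1*e2*m)^2" unfolding c1(3)[symmetric] c2(3)[symmetric] c3(3)[symmetric]
    by (simp add: power2_eq_square mult_ac)
  also have "\<dots> = (k*(e1*e2*m))^2" unfolding k by (simp add: power_mult_distrib)
  finally have "is_square ((r1*r2*r3)^2 * (c1*c2*c3))" unfolding is_square_def by blast
  moreover have "r1*r2*r3 \<noteq> 0" using c1 c2 c3 by simp
  ultimately have sq: "is_square (c1*c2*c3)" by (rule is_square_cancel[rotated])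
  have rk: "r1*k \<noteq> 0" "r2*k \<noteq> 0" using c1 c2 k0 by simp_all
  have "(c1, c2, c3) \<in> Sel2 e1 e2 e3 m" unfolding Sel2_iff
  proof (intro conjI allI impI c1(1) c2(1) c3(1) sq)
    show "D_real_point e1 e2 e3 m (c1, c2, c3)"
      by (rule D_real_point_square_class[OF e D_real_point_translate[OF e nz(3) d0(3) S'(5)] rk c3(2) E1 E2 E3 d0(1,2)]) simp
    show "D_padic_point p e1 e2 e3 m (c1, c2, c3)" if p: "prime p" for p
      by (rule D_padic_point_square_class[OF p e D_padic_point_translate[OF p e nz(3) d0(3) S'(6)[OF p]] rk c3(2) E1 E2 E3 d0(1,2)]) simp
  qed
  then show thesis using that sqI[OF c1(3)] sqI[OF c2(3)] sqI[OF c3(3)] by blast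
qed

text \<open>Rotation of the indices carries the translation of \<open>Sel2_translate\<close> to the
  other 2-torsion points.\<close>

lemma Sel2_translate1:
  assumes e: "e1 + e2 + e3 = (0::int)" and nz: "e1 \<noteq> 0" "e3 \<noteq> 0" "m \<noteq> 0"
    and S: "(d1, d2, d3) \<in> Sel2 e1 e2 e3 m"
  obtains c1 c2 c3 where "(c1, c2, c3) \<in> Sel2 e1 e2 e3 m"
    "is_square (c1 * d1 * (-e3*m))" "is_square (c2 * d2 * (-e1*e3))" "is_square (c3 * d3 * (e1*m))"
proof -
  have e': "e2 + e3 + e1 = 0" "e3 + e1 + e2 = 0" using e by simp_all
  have "(d3, d1, d2) \<in> Sel2 e3 e1 e2 m" using Sel2_rotate[OF e'(1) Sel2_rotate[OF e S]] .
  then obtain c3 c1 c2 where c: "(c3, c1, c2) \<in> Sel2 e3 e1 e2 m"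
    "is_square (c3 * d3 * (e1*m))" "is_square (c1 * d1 * (-e3*m))" "is_square (c2 * d2 * (-e3*e1))"
    by (rule Sel2_translate[OF e'(2) nz(2,1,3)])
  show thesis by (rule that[OF Sel2_rotate[OF e'(2) c(1)] c(3) _ c(2)]) (use c(4) in \<open>simp add: mult_ac\<close>)
qed

lemma Sel2_translate2:
  assumes e: "e1 + e2 + e3 = (0::int)" and nz: "e2 \<noteq> 0" "e3 \<noteq> 0" "m \<noteq> 0"
    and S: "(d1, d2, d3) \<in> Sel2 e1 e2 e3 m"
  obtains c1 c2 c3 where "(c1, c2, c3) \<in> Sel2 e1 e2 e3 m"
    "is_square (c1 * d1 * (-e2*e3))" "is_square (c2 * d2 * (e3*m))" "is_square (c3 * d3 * (-e2*m))"
proof -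
  have e': "e2 + e3 + e1 = 0" "e3 + e1 + e2 = 0" using e by simp_all
  have "(d2, d3, d1) \<in> Sel2 e2 e3 e1 m" using Sel2_rotate[OF e S] .
  then obtain c2 c3 c1 where c: "(c2, c3, c1) \<in> Sel2 e2 e3 e1 m"
    "is_square (c2 * d2 * (e3*m))" "is_square (c3 * d3 * (-e2*m))" "is_square (c1 * d1 * (-e2*e3))"
    by (rule Sel2_translate[OF e'(1) nz])
  show thesis by (rule that[OF Sel2_rotate[OF e'(2) Sel2_rotate[OF e'(1) c(1)]] c(4,2,3)])
qed

lemma sel_equiv_iff:
  "sel_equiv e1 e2 e3 m (a1, a2, a3) (b1, b2, b3) \<longleftrightarrow>
     (is_square (a1*b1) \<and> is_square (a2*b2) \<and> is_square (a3*b3)) \<or>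
     (is_square (a1*b1*(-e3*m)) \<and> is_square (a2*b2*(-e1*e3)) \<and> is_square (a3*b3*(e1*m))) \<or>
     (is_square (a1*b1*(-e2*e3)) \<and> is_square (a2*b2*(e3*m)) \<and> is_square (a3*b3*(-e2*m))) \<or>
     (is_square (a1*b1*(e2*m)) \<and> is_square (a2*b2*(-e1*m)) \<and> is_square (a3*b3*(-e1*e2)))"
  unfolding sel_equiv_def tors_def by simp

text \<open>The four images form a Klein four-group modulo squares; for instance \<open>?t1\<close>
  times \<open>?t2\<close> is \<open>?t3\<close> times (e3^2, e3^2, m^2).\<close>

lemma tors_mult:
  assumes nz: "e1 \<noteq> 0" "e2 \<noteq> 0" "e3 \<noteq> 0" "m \<noteq> 0"
    and x: "(x1, x2, x3) \<in> set (tors e1 e2 e3 m)" and y: "(y1, y2, y3) \<in> set (tors e1 e2 e3 m)"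
  obtains z1 z2 z3 w1 w2 w3 where "(z1, z2, z3) \<in> set (tors e1 e2 e3 m)" "w1 \<noteq> 0" "w2 \<noteq> 0" "w3 \<noteq> 0"
    "x1*y1 = z1*w1^2" "x2*y2 = z2*w2^2" "x3*y3 = z3*w3^2"
proof -
  let ?T = "set (tors e1 e2 e3 m)"
  define P where "P = (\<lambda>(x1, x2, x3) (y1, y2, y3). \<exists>z1 z2 z3 w1 w2 w3. (z1, z2, z3) \<in> ?T \<and>
    w1 \<noteq> 0 \<and> w2 \<noteq> 0 \<and> w3 \<noteq> 0 \<and> x1*y1 = z1*w1^2 \<and> x2*y2 = z2*w2^2 \<and> x3*y3 = z3*(w3::int)^2)"
  have PI: "P (x1, x2, x3) (y1, y2, y3)" if "(z1, z2, z3) \<in> ?T" "w1 \<noteq> 0" "w2 \<noteq> 0" "w3 \<noteq> 0"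
    "x1*y1 = z1*w1^2" "x2*y2 = z2*w2^2" "x3*y3 = z3*w3^2" for x1 x2 x3 y1 y2 y3 z1 z2 z3 w1 w2 w3
    unfolding P_def using that by blast
  have sym: "P (y1, y2, y3) (x1, x2, x3)" if "P (x1, x2, x3) (y1, y2, y3)" for x1 x2 x3 y1 y2 y3
    using that unfolding P_def by (simp only: prod.case mult.commute)
  let ?t1 = "(-e3*m, -e1*e3, e1*m)" and ?t2 = "(-e2*e3, e3*m, -e2*m)" and ?t3 = "(e2*m, -e1*m, -e1*e2)"
  have T: "?T = {(1, 1, 1), ?t1, ?t2, ?t3}" unfolding tors_def by auto
  then have t: "(1, 1, 1) \<in> ?T" "?t1 \<in> ?T" "?t2 \<in> ?T" "?t3 \<in> ?T" by blast+
  have t0: "x1 \<noteq> 0" "x2 \<noteq> 0" "x3 \<noteq> 0" using x nz unfolding tors_def by auto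
  have "P ?t1 ?t2" by (rule PI[OF t(4), of e3 e3 m]) (use nz in \<open>simp_all add: power2_eq_square\<close>)
  moreover have "P ?t1 ?t3" by (rule PI[OF t(3), of m e1 e1]) (use nz in \<open>simp_all add: power2_eq_square\<close>)
  moreover have "P ?t2 ?t3" by (rule PI[OF t(2), of e2 m e2]) (use nz in \<open>simp_all add: power2_eq_square\<close>)
  moreover have "P (1, 1, 1) (y1, y2, y3)" by (rule PI[OF y, of 1 1 1]) simp_all
  moreover have "P (x1, x2, x3) (1, 1, 1)" by (rule PI[OF x, of 1 1 1]) simp_all
  moreover have "P (x1, x2, x3) (x1, x2, x3)" by (rule PI[OF t(1) t0]) (simp_all add: power2_eq_square)
  ultimately have "P (x1, x2, x3) (y1, y2, y3)" using x y sym unfolding T insert_iff empty_iff by metis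
  then show thesis using that unfolding P_def by blast
qed

lemma sel_equivE:
  assumes "sel_equiv e1 e2 e3 m (a1, a2, a3) (b1, b2, b3)"
  obtains x1 x2 x3 where "(x1, x2, x3) \<in> set (tors e1 e2 e3 m)"
    "is_square (a1*b1*x1)" "is_square (a2*b2*x2)" "is_square (a3*b3*x3)"
  using assms unfolding sel_equiv_def by (auto split: prod.splits)

lemma sel_equivI:
  assumes "(x1, x2, x3) \<in> set (tors e1 e2 e3 m)"
    "is_square (a1*b1*x1)" "is_square (a2*b2*x2)" "is_square (a3*b3*x3)"
  shows "sel_equiv e1 e2 e3 m (a1, a2, a3) (b1, b2, b3)"
  using assms unfolding sel_equiv_def by (auto split: prod.splits intro!: bexI[of _ "(x1, x2, x3)"])

lemma sel_equiv_euclidean: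
  assumes nz: "e1 \<noteq> 0" "e2 \<noteq> 0" "e3 \<noteq> 0" "m \<noteq> 0" "b1 \<noteq> 0" "b2 \<noteq> 0" "b3 \<noteq> 0"
    and A: "sel_equiv e1 e2 e3 m (a1, a2, a3) (b1, b2, b3)" and C: "sel_equiv e1 e2 e3 m (c1, c2, c3) (b1, b2, b3)"
  shows "sel_equiv e1 e2 e3 m (a1, a2, a3) (c1, c2, c3)"
proof -
  obtain x1 x2 x3 where x: "(x1, x2, x3) \<in> set (tors e1 e2 e3 m)"
    "is_square (a1*b1*x1)" "is_square (a2*b2*x2)" "is_square (a3*b3*x3)" by (rule sel_equivE[OF A])
  obtain y1 y2 y3 where y: "(y1, y2, y3) \<in> set (tors e1 e2 e3 m)"
    "is_square (c1*b1*y1)" "is_square (c2*b2*y2)" "is_square (c3*b3*y3)" by (rule sel_equivE[OF C])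
  obtain z1 z2 z3 w1 w2 w3 where z: "(z1, z2, z3) \<in> set (tors e1 e2 e3 m)" "w1 \<noteq> 0" "w2 \<noteq> 0" "w3 \<noteq> 0"
    "x1*y1 = z1*w1^2" "x2*y2 = z2*w2^2" "x3*y3 = z3*w3^2" by (rule tors_mult[OF nz(1-4) x(1) y(1)])
  show ?thesis
    by (rule sel_equivI[OF z(1) is_square_chain[OF x(2) y(2) nz(5) z(5,2)] is_square_chain[OF x(3) y(3) nz(6) z(6,3)]
          is_square_chain[OF x(4) y(4) nz(7) z(7,4)]])
qed

lemma sel_equiv_sym:
  assumes "sel_equiv e1 e2 e3 m (a1, a2, a3) (b1, b2, b3)"
  shows "sel_equiv e1 e2 e3 m (b1, b2, b3) (a1, a2, a3)"
  using assms unfolding sel_equiv_iff by (simp only: mult.commute[of b1] mult.commute[of b2] mult.commute[of b3])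

lemma multiplicity_two_mult:
  "x \<noteq> 0 \<Longrightarrow> y \<noteq> 0 \<Longrightarrow> multiplicity 2 (x * y :: int) = multiplicity 2 x + multiplicity 2 y"
  using multiplicity_mult_prime[OF two_is_prime_nat] by simp

lemma square_factor_even:
  assumes "is_square (x * y)" "odd (multiplicity 2 y)" "x \<noteq> 0" "y \<noteq> 0"
  shows "even (x::int)"
proof -
  have "even (multiplicity 2 (x*y))" using is_square_even_multiplicity[OF assms(1) _ two_is_prime_nat] assms by simp
  moreover note multiplicity_two_mult[OF assms(3,4)]
  ultimately have "odd (multiplicity 2 x)" using assms(2) by simp
  then have "multiplicity 2 x > 0" by (rule odd_pos)
  then show ?thesis using not_dvd_imp_multiplicity_0[of 2 x] by linarith
qed

lemma square_factor_odd:
  assumes "is_square (x * y)" "even (multiplicity 2 y)" "squarefree x" "y \<noteq> 0"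
  shows "odd (x::int)"
proof -
  have x0: "x \<noteq> 0" using assms(3) by auto
  have "even (multiplicity 2 (x*y))" using is_square_even_multiplicity[OF assms(1) _ two_is_prime_nat] assms x0 by simp
  moreover note multiplicity_two_mult[OF x0 assms(4)]
  ultimately have "even (multiplicity 2 x)" using assms(2) by auto
  then show ?thesis using squarefree_multiplicity[OF assms(3) two_is_prime_nat] by (auto split: if_splits)
qed

lemma multiplicity_two_twice_odd:
  assumes "even (x::int)" "\<not> 4 dvd x"
  shows "multiplicity 2 x = 1"
proof -
  obtain c where c: "x = 2*c" using assms(1) by (rule evenE)
  have oc: "odd c" using assms(2) unfolding c by auto
  then have c0: "c \<noteq> 0" by auto
  then show ?thesis using oc unfolding c by (simp add: multiplicity_two_mult not_dvd_imp_multiplicity_0)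
qed

lemma minus_prod_not_square:
  assumes e: "e1 + e2 + e3 = (0::int)" and odd: "odd e1" "odd e2" and e3: "even e3" "\<not> 4 dvd e3"
  shows "\<not> is_square (-e1*e2)"
proof
  assume "is_square (-e1*e2)"
  then obtain k where k: "-e1*e2 = k^2" unfolding is_square_def by blast
  have "odd (k^2)" unfolding k[symmetric] using odd by simp
  then have "(-(e1*e2)) mod 4 = 1" using k square_mod_4[of k] by simp
  moreover have "e1 mod 4 = e2 mod 4" using e odd e3 by presburger
  then have "(e1*e2) mod 4 = 1" by (simp add: odd_mult_mod_4[OF odd])
  ultimately show False by presburger
qed

text \<open>The four torsion images already exhaust the Selmer group of \<open>E\<close>, and those of the two remaining
  2-torsion points have an even first entry.\<close>
lemma Sel2_odd_torsion:
  assumes e: "e1 + e2 + e3 = (0::int)" and odd: "odd e1" "odd e2" and e3: "even e3" "\<not> 4 dvd e3"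
    and card: "card (Sel2 e1 e2 e3 1) = 4"
    and S: "(d1, d2, d3) \<in> Sel2 e1 e2 e3 1" and d: "odd d1" "odd d2" "odd d3"
  shows "(d1, d2, d3) = (1, 1, 1) \<or> (is_square (d1 * e2) \<and> is_square (d2 * -e1) \<and> is_square (d3 * (-e1*e2)))"
proof (rule ccontr)
  assume neg: "\<not> ?thesis"
  have nz: "e1 \<noteq> 0" "e2 \<noteq> 0" "e3 \<noteq> 0" "(1::int) \<noteq> 0" using odd e3 by auto
  note m3 = multiplicity_two_twice_odd[OF e3]
  have mo: "multiplicity 2 e1 = 0" "multiplicity 2 e2 = 0" using odd by (simp_all add: not_dvd_imp_multiplicity_0)
  note S1 = one_in_Sel2[OF e, of 1]
  obtain a1 a2 a3 where a: "(a1, a2, a3) \<in> Sel2 e1 e2 e3 1"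
    "is_square (a1 * 1 * (e2*1))" "is_square (a2 * 1 * (-e1*1))" "is_square (a3 * 1 * (-e1*e2))"
    by (rule Sel2_translate[OF e nz(1,2,4) S1])
  obtain b1 b2 b3 where b: "(b1, b2, b3) \<in> Sel2 e1 e2 e3 1"
    "is_square (b1 * 1 * (-e3*1))" "is_square (b2 * 1 * (-e1*e3))" "is_square (b3 * 1 * (e1*1))"
    by (rule Sel2_translate1[OF e nz(1,3,4) S1])
  obtain c1 c2 c3 where c: "(c1, c2, c3) \<in> Sel2 e1 e2 e3 1"
    "is_square (c1 * 1 * (-e2*e3))" "is_square (c2 * 1 * (e3*1))" "is_square (c3 * 1 * (-e2*1))"
    by (rule Sel2_translate2[OF e nz(2,3,4) S1])
  have sf: "squarefree a1" "b1 \<noteq> 0" "c1 \<noteq> 0" "b3 \<noteq> 0" using a(1) b(1) c(1) unfolding Sel2_iff by auto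
  have pa: "odd a1" by (rule square_factor_odd[of _ e2]) (use a(2) mo sf nz in simp_all)
  have pb: "even b1" by (rule square_factor_even[of _ "-e3"]) (use b(2) m3 sf nz in simp_all)
  have pc: "even c1"
  proof (rule square_factor_even[of _ "-e2*e3"])
    show "odd (multiplicity 2 (-e2*e3))" using m3 mo nz by (simp add: multiplicity_two_mult)
  qed (use c(2) sf nz in simp_all)
  \<comment> \<open>Parity of the first entry separates b and c from the rest. Third entries
    separate a from (1, 1, 1) and b from c, since a3 = 1 or b3 = c3 would make -e1 e2 a square.
    Together with d these are five elements in a set of four.\<close>
  have ne: "d1 \<noteq> b1" "d1 \<noteq> c1" "1 \<noteq> b1" "1 \<noteq> c1" "a1 \<noteq> b1" "a1 \<noteq> c1" using d(1) pa pb pc by auto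
  have "a3 \<noteq> 1" using a(4) minus_prod_not_square[OF e odd e3] by auto
  moreover have "b3 \<noteq> c3"
  proof
    assume "b3 = c3"
    then have "is_square (1 * b3 * e1)" "is_square (1 * b3 * -e2)" using b(4) c(4) by simp_all
    then have "is_square (1 * 1 * (-e1*e2))" by (rule is_square_chain[where w = 1]) (use sf in simp_all)
    then show False using minus_prod_not_square[OF e odd e3] by simp
  qed
  moreover have "(d1, d2, d3) \<noteq> (a1, a2, a3)" using neg a by auto
  moreover have "(d1, d2, d3) \<noteq> (1, 1, 1)" using neg by blast
  ultimately have "card {(d1, d2, d3), (1, 1, 1), (a1, a2, a3), (b1, b2, b3), (c1, c2, c3)} = 5"
    using ne by (simp add: card_insert_if)
  moreover have "finite (Sel2 e1 e2 e3 1)" using card by (metis card.infinite zero_neq_numeral)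
  then have "card {(d1, d2, d3), (1, 1, 1), (a1, a2, a3), (b1, b2, b3), (c1, c2, c3)} \<le> card (Sel2 e1 e2 e3 1)"
    using S S1 a(1) b(1) c(1) by (intro card_mono) auto
  ultimately show False using card by simp
qed

lemma Sel2_unramified:
  assumes e: "e1 + e2 + e3 = (0::int)" and S: "(d1, d2, d3) \<in> Sel2 e1 e2 e3 m" and p: "prime p"
    and nd: "\<not> int p dvd e3" "\<not> int p dvd m"
  shows "\<not> (int p dvd d1 \<and> int p dvd d2)"
proof
  assume h: "int p dvd d1 \<and> int p dvd d2"
  have sf: "squarefree d1" "squarefree d2" "squarefree d3" "is_square (d1*d2*d3)"
    "D_padic_point p e1 e2 e3 m (d1, d2, d3)" using S p unfolding Sel2_iff by blast+
  have "\<not> int p dvd d3" using squarefree_square_parity[OF sf(1-4) p] h by blast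
  moreover have "\<not> int p ^ 2 dvd x" if "squarefree x" for x :: int
    by (rule squarefree_not_square_dvd[OF that p])
  ultimately show False using D_padic_point_not_ramified[OF p _ _ _ _ _ nd sf(5)] h sf by blast
qed

section \<open>Selmer elements of the twist\<close>

lemma unit_square_root:
  assumes p: "prime p" "odd p" and a: "\<not> int p dvd a" "QuadRes (int p) a"
  obtains r where "\<not> int p dvd r" "int p ^ N dvd r^2 - a"
proof -
  have n1: "\<not> int p dvd 1" by (rule prime_not_dvd_one[OF p(1)])
  obtain s where s: "int p dvd 1 * s^2 - a" using a(2) unfolding QuadRes_def cong_iff_dvd_diff by auto
  obtain r where r: "int p ^ Suc N dvd 1 * r^2 - a" using hensel_square_odd[OF p n1 a(1) s] by blast
  have "\<not> int p dvd r"
  proof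
    assume "int p dvd r"
    then have "int p dvd r^2" by (simp add: power2_eq_square)
    moreover have "int p dvd r^2 - a" using r by (auto dest: dvd_mult_left)
    ultimately have "int p dvd r^2 - (r^2 - a)" by (rule dvd_diff)
    then show False using a(1) by simp
  qed
  moreover have "int p ^ N dvd r^2 - a" using r by (auto dest: dvd_mult_right)
  ultimately show thesis by (rule that)
qed

text \<open>m and the g_i are squares of p-adic units, so their roots are absorbed into the
  coordinates without losing primitivity; approximate roots modulo p^N suffice.\<close>

lemma D_padic_point_untwist:
  assumes p: "prime p" "odd p" and e: "e1 + e2 + e3 = (0::int)"
    and m: "\<not> int p dvd m" "QuadRes (int p) m" and g1: "\<not> int p dvd g1" "QuadRes (int p) g1"
    and g2: "\<not> int p dvd g2" "QuadRes (int p) g2" and g3: "\<not> int p dvd g3" "QuadRes (int p) g3"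
    and D: "D_padic_point p e1 e2 e3 m (g1*f1, g2*f2, g3*f3)"
  shows "D_padic_point p e1 e2 e3 1 (f1, f2, f3)"
proof (rule D_padic_pointI_bounded[OF p(1) e, where M = 1], goal_cases)
  case (1 N)
  have pi: "prime (int p)" using p by simp
  obtain t u1 u2 u3 where n: "\<not> (int p dvd t \<and> int p dvd u1 \<and> int p dvd u2 \<and> int p dvd u3)"
      and f1: "int p ^ N dvd e1*m*t^2 + g2*f2*u2^2 - g3*f3*u3^2"
      and f2: "int p ^ N dvd e2*m*t^2 + g3*f3*u3^2 - g1*f1*u1^2" by (rule D_padic_pointD[OF D])
  obtain r where r: "\<not> int p dvd r" "int p ^ N dvd r^2 - m" by (rule unit_square_root[OF p m])
  obtain s1 where s1: "\<not> int p dvd s1" "int p ^ N dvd s1^2 - g1" by (rule unit_square_root[OF p g1])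
  obtain s2 where s2: "\<not> int p dvd s2" "int p ^ N dvd s2^2 - g2" by (rule unit_square_root[OF p g2])
  obtain s3 where s3: "\<not> int p dvd s3" "int p ^ N dvd s3^2 - g3" by (rule unit_square_root[OF p g3])
  have C: "\<not> (int p ^ 1 dvd r*t \<and> int p ^ 1 dvd s1*u1 \<and> int p ^ 1 dvd s2*u2 \<and> int p ^ 1 dvd s3*u3)"
    using n r(1) s1(1) s2(1) s3(1) pi by (auto simp: prime_dvd_mult_iff)
  have A: "e1*1*(r*t)^2 + f2*(s2*u2)^2 - f3*(s3*u3)^2 = (e1*m*t^2 + g2*f2*u2^2 - g3*f3*u3^2)
     + (e1*t^2)*(r^2 - m) + (f2*u2^2)*(s2^2 - g2) - (f3*u3^2)*(s3^2 - g3)"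
    by (simp add: power_mult_distrib algebra_simps)
  have B: "e2*1*(r*t)^2 + f3*(s3*u3)^2 - f1*(s1*u1)^2 = (e2*m*t^2 + g3*f3*u3^2 - g1*f1*u1^2)
     + (e2*t^2)*(r^2 - m) + (f3*u3^2)*(s3^2 - g3) - (f1*u1^2)*(s1^2 - g1)"
    by (simp add: power_mult_distrib algebra_simps)
  have A': "int p ^ N dvd e1*1*(r*t)^2 + f2*(s2*u2)^2 - f3*(s3*u3)^2" unfolding A
    by (rule dvd_diff[OF dvd_add[OF dvd_add[OF f1 dvd_mult[OF r(2)]] dvd_mult[OF s2(2)]] dvd_mult[OF s3(2)]])
  have B': "int p ^ N dvd e2*1*(r*t)^2 + f3*(s3*u3)^2 - f1*(s1*u1)^2" unfolding B
    by (rule dvd_diff[OF dvd_add[OF dvd_add[OF f2 dvd_mult[OF r(2)]] dvd_mult[OF s3(2)]] dvd_mult[OF s1(2)]])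
  show ?case
    by (rule exI[of _ "r*t"], rule exI[of _ "s1*u1"], rule exI[of _ "s2*u2"], rule exI[of _ "s3*u3"],
        intro conjI C A' B')
qed

lemma D_real_point_untwist:
  assumes e: "e1 + e2 + e3 = (0::int)" and pos: "m > 0" "g1 > 0" "g2 > 0" "g3 > 0"
    and D: "D_real_point e1 e2 e3 m (g1*f1, g2*f2, g3*f3)"
  shows "D_real_point e1 e2 e3 1 (f1, f2, f3)"
proof (rule D_real_pointE[OF D])
  fix t u1 u2 u3 :: real
  assume s: "t \<noteq> 0 \<or> u1 \<noteq> 0 \<or> u2 \<noteq> 0 \<or> u3 \<noteq> 0"
    "of_int e1 * of_int m * t^2 + of_int (g2*f2) * u2^2 - of_int (g3*f3) * u3^2 = 0"
    "of_int e2 * of_int m * t^2 + of_int (g3*f3) * u3^2 - of_int (g1*f1) * u1^2 = 0"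
  have Q: "(sqrt (of_int g) * u)^2 = of_int g * u^2" if "g > 0" for g :: int and u :: real
    using that by (simp add: power_mult_distrib)
  show ?thesis
    by (rule D_real_pointI[OF e, of "sqrt (of_int m) * t" "sqrt (of_int g1) * u1" "sqrt (of_int g2) * u2" "sqrt (of_int g3) * u3"])
       (unfold Q[OF pos(1)] Q[OF pos(2)] Q[OF pos(3)] Q[OF pos(4)], use s pos in \<open>simp_all add: mult_ac\<close>)
qed

lemma D_real_point_positive:
  assumes e: "e1 + e2 + e3 = (0::int)" and pos: "d1 > 0" "d2 > 0" "d3 > 0"
  shows "D_real_point e1 e2 e3 m (d1, d2, d3)"
proof -
  have Q: "of_int d * (1 / sqrt (of_int d))^2 = (1::real)" if "d > 0" for d :: int
    using that by (simp add: power_divide)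
  show ?thesis
    by (rule D_real_pointI[OF e, of 0 "1 / sqrt (of_int d1)" "1 / sqrt (of_int d2)" "1 / sqrt (of_int d3)"])
       (unfold Q[OF pos(1)] Q[OF pos(2)] Q[OF pos(3)], use pos in simp_all)
qed

locale quadratic_twist =
  fixes e1 e2 e3 :: int and ps :: "nat list" and n :: nat
  assumes e: "e1 + e2 + e3 = 0" and odd_e: "odd e1" "odd e2" and e3: "even e3" "\<not> 4 dvd e3"
    and ps: "distinct ps" "\<forall>p\<in>set ps. prime p" and n: "n = prod_list ps" and odd_n: "odd n"
    and cop: "coprime (int n) (e1 * e2 * e3)"
    and res: "\<forall>q::nat. prime q \<longrightarrow> odd q \<longrightarrow> int q dvd e1 * e2 * e3 \<longrightarrow>
           (\<forall>p \<in> set ps. QuadRes (int q) (int p))"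
begin

lemma nz: "e1 \<noteq> 0" "e2 \<noteq> 0" "e3 \<noteq> 0" "int n \<noteq> 0"
  using odd_e e3 odd_pos[OF odd_n] by auto

lemma n_pos: "int n > 0"
  using nz(4) by simp

lemma odd_int_n: "odd (int n)"
  using odd_n by simp

lemma squarefree_n: "squarefree (int n)"
  unfolding n by (rule squarefree_prod_list_primes[OF ps])

lemma prime_dvd_n_iff: "prime p \<Longrightarrow> int p dvd int n \<longleftrightarrow> p \<in> set ps"
proof
  assume p: "prime p" and "int p dvd int n"
  then have "p dvd n" by (simp only: int_dvd_int_iff)
  moreover have "prod_list ps = \<Prod>(set ps)" by (rule prod_list_eq_prod_set[OF ps(1)])
  ultimately have "p dvd \<Prod>(set ps)" using n by simp
  then obtain q where "q \<in> set ps" "p dvd q" using p by (auto simp: prime_dvd_prod_iff)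
  then show "p \<in> set ps" using p ps(2) primes_dvd_imp_eq by blast
next
  assume "p \<in> set ps"
  then show "int p dvd int n" using n prod_list_dvd by simp
qed

lemma ps_prime: "p \<in> set ps \<Longrightarrow> prime p"
  using ps by blast

lemma ps_odd: "p \<in> set ps \<Longrightarrow> odd p"
  using prime_dvd_n_iff[OF ps_prime, of p] odd_n by (meson dvd_trans int_dvd_int_iff)

lemma ps_not_dvd: "p \<in> set ps \<Longrightarrow> \<not> int p dvd e1 \<and> \<not> int p dvd e2 \<and> \<not> int p dvd e3"
proof -
  assume p: "p \<in> set ps"
  have "int p dvd int n" using p prime_dvd_n_iff ps_prime by blast
  then have "\<not> int p dvd e1*e2*e3" using cop ps_prime[OF p] coprime_common_divisor not_prime_unit
    by (metis prime_nat_int_transfer)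
  then show ?thesis by (auto simp: dvd_mult dvd_mult2)
qed

lemma residue_divisor:
  assumes q: "prime q" "odd q" "int q dvd e1*e2*e3" and d: "d > 0" "d dvd int n"
  shows "QuadRes (int q) d" "\<not> int q dvd d"
proof -
  have "q \<notin> set ps" using ps_not_dvd q by (auto simp: prime_dvd_mult_iff)
  then have "\<not> int q dvd int n" using prime_dvd_n_iff q(1) by blast
  then show "\<not> int q dvd d" using d(2) dvd_trans by blast
  have qn: "\<not> int q dvd int r" if "r \<in> set ps" for r
    using that ps_prime q(1) \<open>q \<notin> set ps\<close> primes_dvd_imp_eq by auto
  have D: "d = (\<Prod>r\<in>set ps. int r ^ multiplicity (int r) d)"
    by (rule divisor_prod_primes[OF ps d(1)]) (use d(2) n in simp)
  have "QuadRes (int q) (\<Prod>r\<in>set ps. int r ^ multiplicity (int r) d)"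
    using q res qn by (subst QuadRes_prod_iff) (auto simp: qr_bit_def)
  then show "QuadRes (int q) d" using D by simp
qed

text \<open>Positivity gives a real point with t = 0. At odd primes dividing e1 e2 e3 the d_i are
  squares, at the other odd primes outside n the reduction is good, and the place 2 follows from all
  of these.\<close>

lemma posdiv_in_Sel2_iff:
  assumes d: "d1 > 0" "d1 dvd int n" "d2 > 0" "d2 dvd int n" "d3 > 0" "d3 dvd int n" and sq: "is_square (d1*d2*d3)"
  shows "(d1, d2, d3) \<in> Sel2 e1 e2 e3 (int n) \<longleftrightarrow> (\<forall>p\<in>set ps. D_padic_point p e1 e2 e3 (int n) (d1, d2, d3))"
proof
  assume "(d1, d2, d3) \<in> Sel2 e1 e2 e3 (int n)"
  then show "\<forall>p\<in>set ps. D_padic_point p e1 e2 e3 (int n) (d1, d2, d3)" unfolding Sel2_iff using ps_prime by blast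
next
  assume H: "\<forall>p\<in>set ps. D_padic_point p e1 e2 e3 (int n) (d1, d2, d3)"
  have sf: "squarefree d1" "squarefree d2" "squarefree d3" using squarefree_n d squarefree_mono by blast+
  have R: "D_real_point e1 e2 e3 (int n) (d1, d2, d3)" by (rule D_real_point_positive[OF e d(1,3,5)])
  have P: "D_padic_point p e1 e2 e3 (int n) (d1, d2, d3)" if p: "prime p" "odd p" for p
  proof (cases "int p dvd int n")
    case True
    then show ?thesis using H prime_dvd_n_iff[OF p(1)] by blast
  next
    case False
    then have nd: "\<not> int p dvd d1" "\<not> int p dvd d2" "\<not> int p dvd d3" using d dvd_trans by blast+
    show ?thesis
    proof (cases "int p dvd e1*e2*e3")
      case True
      show ?thesis by (rule D_padic_point_residues[OF p e nd residue_divisor(1)[OF p True d(1,2)]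
            residue_divisor(1)[OF p True d(3,4)] residue_divisor(1)[OF p True d(5,6)]])
    next
      case ne: False
      then have "\<not> int p dvd e1" "\<not> int p dvd e2" "\<not> int p dvd e3" by (auto simp: dvd_mult dvd_mult2)
      then show ?thesis by (rule D_padic_point_good[OF p e _ _ _ False nd sq])
    qed
  qed
  have od: "odd d1" "odd d2" "odd d3" using d odd_int_n dvd_trans by blast+
  have "D_padic_point 2 e1 e2 e3 (int n) (d1, d2, d3)"
    by (rule D_padic_point_two[OF e odd_e odd_int_n e3 od sq R P])
  from D_padic_point_all_primes[OF P this] show "(d1, d2, d3) \<in> Sel2 e1 e2 e3 (int n)"
    unfolding Sel2_iff using sf sq R by blast
qed

text \<open>The primes of \<open>n\<close> are squares at every odd prime of bad reduction, and the place 2 comes for free.\<close>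
lemma Sel2_untwist:
  assumes S: "(d1, d2, d3) \<in> Sel2 e1 e2 e3 (int n)" and od: "odd d1" "odd d2" "odd d3"
    and f: "d1 = gcd d1 (int n) * f1" "d2 = gcd d2 (int n) * f2" "d3 = gcd d3 (int n) * f3"
  shows "(f1, f2, f3) \<in> Sel2 e1 e2 e3 1"
proof -
  define g1 g2 g3 where g: "g1 = gcd d1 (int n)" "g2 = gcd d2 (int n)" "g3 = gcd d3 (int n)"
  have df: "d1 = g1*f1" "d2 = g2*f2" "d3 = g3*f3" using f unfolding g by blast+
  have S': "squarefree d1" "squarefree d2" "squarefree d3" "is_square (d1*d2*d3)"
    "D_real_point e1 e2 e3 (int n) (d1, d2, d3)"
    "\<And>p. prime p \<Longrightarrow> D_padic_point p e1 e2 e3 (int n) (d1, d2, d3)"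
    using S unfolding Sel2_iff by blast+
  have gp: "g1 > 0" "g2 > 0" "g3 > 0" unfolding g using nz(4) by (simp_all add: gcd_pos_int)
  have gn: "g1 dvd int n" "g2 dvd int n" "g3 dvd int n" unfolding g by simp_all
  have sf: "squarefree f1" "squarefree f2" "squarefree f3"
    using S'(1-3) squarefree_multD(2) unfolding df by blast+
  have f0: "f1 \<noteq> 0" "f2 \<noteq> 0" "f3 \<noteq> 0" using sf by auto
  have fd: "f1 dvd d1" "f2 dvd d2" "f3 dvd d3" unfolding df by simp_all
  \<comment> \<open>As d is squarefree, removing gcd d n leaves a part prime to n.\<close>
  have nf: "\<not> int p dvd f" if "d = g*f" "g = gcd d (int n)" "squarefree d" "prime p" "int p dvd int n" for p d g f
  proof
    assume h: "int p dvd f"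
    then have "int p dvd g * f" by (rule dvd_mult)
    then have "int p dvd d" unfolding that(1)[symmetric] .
    then have "int p dvd g" unfolding that(2) using that(5) by (rule gcd_greatest)
    then have "int p ^ 2 dvd d" using h that(1) by (simp add: power2_eq_square mult_dvd_mono)
    then show False using squarefree_not_square_dvd[OF that(3,4)] by blast
  qed
  have nfp: "\<not> int p dvd f1 \<and> \<not> int p dvd f2 \<and> \<not> int p dvd f3" if "prime p" "int p dvd int n" for p
    using nf[OF df(1) g(1) S'(1) that] nf[OF df(2) g(2) S'(2) that] nf[OF df(3) g(3) S'(3) that] by blast
  have sq: "is_square (f1*f2*f3)"
  proof (rule is_square_coprime[of "g1*g2*g3"])
    have "(g1*g2*g3) * (f1*f2*f3) = d1*d2*d3" unfolding df by (simp add: mult_ac)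
    then show "is_square ((g1*g2*g3) * (f1*f2*f3))" using S'(4) by (simp only:)
    show "g1*g2*g3 > 0" using gp by simp
    show "f1*f2*f3 \<noteq> 0" using f0 by simp
    show "coprime (g1*g2*g3) (f1*f2*f3)"
    proof (rule ccontr)
      assume "\<not> ?thesis"
      then have "\<not> is_unit (gcd (g1*g2*g3) (f1*f2*f3))" by (simp add: coprime_iff_gcd_eq_1)
      moreover have "gcd (g1*g2*g3) (f1*f2*f3) \<noteq> 0" using f0 by simp
      ultimately obtain r where r: "prime r" "r dvd gcd (g1*g2*g3) (f1*f2*f3)" using prime_divisor_exists by blast
      obtain p where p: "prime p" and rp: "r = int p" by (rule prime_int_cases[OF r(1)])
      have "int p dvd g1*g2*g3" "int p dvd f1*f2*f3" using r(2) rp by auto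
      then have "int p dvd g1 \<or> int p dvd g2 \<or> int p dvd g3" "int p dvd f1 \<or> int p dvd f2 \<or> int p dvd f3"
        using p by (auto simp: prime_dvd_mult_iff)
      then show False using nfp[OF p] gn dvd_trans by blast
    qed
  qed
  have R: "D_real_point e1 e2 e3 1 (f1, f2, f3)"
    by (rule D_real_point_untwist[OF e n_pos gp S'(5)[unfolded df]])
  have P: "D_padic_point p e1 e2 e3 1 (f1, f2, f3)" if p: "prime p" "odd p" for p
  proof -
    have n1: "\<not> int p dvd 1" by (rule prime_not_dvd_one[OF p(1)])
    show ?thesis
    proof (cases "int p dvd e1*e2*e3")
      case True
      note rd = residue_divisor[OF p True]
      have nn: "int n dvd int n" by simp
      show ?thesis
        by (rule D_padic_point_untwist[OF p e rd(2,1)[OF n_pos nn] rd(2,1)[OF gp(1) gn(1)] rd(2,1)[OF gp(2) gn(2)]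
              rd(2,1)[OF gp(3) gn(3)] S'(6)[OF p(1), unfolded df]])
    next
      case False
      then have ne: "\<not> int p dvd e1" "\<not> int p dvd e2" "\<not> int p dvd e3" by (auto simp: dvd_mult dvd_mult2)
      have "\<not> int p dvd f1 \<and> \<not> int p dvd f2 \<and> \<not> int p dvd f3"
      proof (cases "int p dvd int n")
        case True
        then show ?thesis using nfp[OF p(1)] by blast
      next
        case nn: False
        \<comment> \<open>Away from n the Selmer condition forbids p to divide two of the d_i, and
          squareness of the product forbids it to divide an odd number of them.\<close>
        have e': "e2 + e3 + e1 = 0" "e3 + e1 + e2 = 0" using e by simp_all
        note S2 = Sel2_rotate[OF e S] 
        note S3 = Sel2_rotate[OF e'(1) S2]
        have "\<not> (int p dvd d1 \<and> int p dvd d2)" "\<not> (int p dvd d2 \<and> int p dvd d3)" "\<not> (int p dvd d3 \<and> int p dvd d1)"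
          using Sel2_unramified[OF e S p(1) ne(3) nn] Sel2_unramified[OF e'(1) S2 p(1) ne(1) nn]
            Sel2_unramified[OF e'(2) S3 p(1) ne(2) nn] by blast+
        then have "\<not> int p dvd d1" "\<not> int p dvd d2" "\<not> int p dvd d3"
          using squarefree_square_parity[OF S'(1-4) p(1)] by blast+
        then show ?thesis using fd dvd_trans by blast
      qed
      then show ?thesis using D_padic_point_good[OF p e ne n1 _ _ _ sq] by blast
    qed
  qed
  have oddf: "odd f1" "odd f2" "odd f3" using od fd dvd_trans by blast+
  have "D_padic_point 2 e1 e2 e3 1 (f1, f2, f3)"
    by (rule D_padic_point_two[OF e odd_e _ e3 oddf sq R P]) simp
  from D_padic_point_all_primes[OF P this] show ?thesis unfolding Sel2_iff using sf sq R by blast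
qed

lemma posdiv_representative_odd:
  assumes card: "card (Sel2 e1 e2 e3 1) = 4"
    and S: "(d1, d2, d3) \<in> Sel2 e1 e2 e3 (int n)" and od: "odd d1" "odd d2" "odd d3"
  obtains c1 c2 c3 where "(c1, c2, c3) \<in> Sel2 e1 e2 e3 (int n)" "posdiv_triple n (c1, c2, c3)"
    "sel_equiv e1 e2 e3 (int n) (c1, c2, c3) (d1, d2, d3)"
proof -
  obtain f1 f2 f3 where f: "d1 = gcd d1 (int n) * f1" "d2 = gcd d2 (int n) * f2" "d3 = gcd d3 (int n) * f3"
    by (metis dvdE gcd_dvd1)
  define g1 g2 g3 where g: "g1 = gcd d1 (int n)" "g2 = gcd d2 (int n)" "g3 = gcd d3 (int n)"
  have df: "d1 = g1*f1" "d2 = g2*f2" "d3 = g3*f3" using f unfolding g by blast+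
  have gp: "g1 > 0" "g2 > 0" "g3 > 0" unfolding g using nz(4) by (simp_all add: gcd_pos_int)
  have gn: "g1 dvd int n" "g2 dvd int n" "g3 dvd int n" unfolding g by simp_all
  note F = Sel2_untwist[OF S od f]
  have f0: "f1 \<noteq> 0" "f2 \<noteq> 0" "f3 \<noteq> 0" using F unfolding Sel2_iff by auto
  have oddf: "odd f1" "odd f2" "odd f3" using od unfolding df by simp_all
  consider "(f1, f2, f3) = (1, 1, 1)" | "is_square (f1 * e2)" "is_square (f2 * -e1)" "is_square (f3 * (-e1*e2))"
    using Sel2_odd_torsion[OF e odd_e e3 card F oddf] by blast
  then show thesis
  proof cases
    case 1
    then have d: "d1 = g1" "d2 = g2" "d3 = g3" using df by simp_all
    have "posdiv_triple n (d1, d2, d3)" unfolding d posdiv_triple_def using gp gn by simp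
    moreover have "is_square (x * x)" for x unfolding is_square_def by (metis power2_eq_square)
    then have "sel_equiv e1 e2 e3 (int n) (d1, d2, d3) (d1, d2, d3)" unfolding sel_equiv_iff by blast
    ultimately show thesis using that S by blast
  next
    case 2
    obtain c1 c2 c3 where c: "(c1, c2, c3) \<in> Sel2 e1 e2 e3 (int n)"
      "is_square (c1 * d1 * (e2*int n))" "is_square (c2 * d2 * (-e1*int n))" "is_square (c3 * d3 * (-e1*e2))"
      by (rule Sel2_translate[OF e nz(1,2,4) S])
    have sc: "squarefree c1" "squarefree c2" "squarefree c3" using c(1) unfolding Sel2_iff by blast+
    \<comment> \<open>Applied with x = e2, -e1, -e1 e2 and y = n, n, 1: the part f of d prime to n
      cancels against the factor x of the torsion entry, sign included, and leaves g y, built from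
      divisors of n.\<close>
    have red: "is_square (c * w)" if h: "is_square (c * (g*f) * (x*y))" "is_square (f * x)" "f*x \<noteq> 0" "w = g*y" for c g f x y w
    proof -
      obtain k where k: "f * x = k^2" using h(2) unfolding is_square_def by blast
      have "c * (g*f) * (x*y) = (f*x) * (c*w)" unfolding h(4) by (simp add: mult_ac)
      then have "is_square (k^2 * (c*w))" using h(1) unfolding k by (simp only:)
      moreover have "k \<noteq> 0" using h(3) k by auto
      ultimately show ?thesis by (rule is_square_cancel[rotated])
    qed
    have s1: "is_square (c1 * (g1 * int n))" by (rule red[OF c(2)[unfolded df] 2(1)]) (use f0 nz in simp_all)
    have s2: "is_square (c2 * (g2 * int n))" by (rule red[OF c(3)[unfolded df] 2(2)]) (use f0 nz in simp_all)
    have c3': "is_square (c3 * (g3*f3) * ((-e1*e2) * 1))" using c(4) unfolding df by simp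
    have s3: "is_square (c3 * g3)" by (rule red[OF c3' 2(3)]) (use f0 nz in simp_all)
    have pd: "int p dvd int n" if h: "prime p" "int p dvd g * int n" "g dvd int n" for p g
    proof -
      have "prime (int p)" using h(1) by simp
      then have "int p dvd g \<or> int p dvd int n" using h(2) prime_dvd_mult_iff by blast
      then show ?thesis using h(3) dvd_trans by blast
    qed
    have pd3: "int p dvd int n" if "prime p" "int p dvd g3" for p using that gn(3) dvd_trans by blast
    have w: "g1 * int n > 0" "g2 * int n > 0" using gp n_pos by simp_all
    have "c1 > 0" "c1 dvd int n" using squarefree_dvdI[OF sc(1) s1 w(1) nz(4) pd[OF _ _ gn(1)]] by blast+
    moreover have "c2 > 0" "c2 dvd int n" using squarefree_dvdI[OF sc(2) s2 w(2) nz(4) pd[OF _ _ gn(2)]] by blast+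
    moreover have "c3 > 0" "c3 dvd int n" using squarefree_dvdI[OF sc(3) s3 gp(3) nz(4) pd3] by blast+
    ultimately have "posdiv_triple n (c1, c2, c3)" unfolding posdiv_triple_def by simp
    moreover have "sel_equiv e1 e2 e3 (int n) (c1, c2, c3) (d1, d2, d3)" unfolding sel_equiv_iff using c by blast
    ultimately show thesis using that c(1) by blast
  qed
qed

lemma posdiv_representative:
  assumes card: "card (Sel2 e1 e2 e3 1) = 4" and S: "(d1, d2, d3) \<in> Sel2 e1 e2 e3 (int n)"
  obtains c1 c2 c3 where "(c1, c2, c3) \<in> Sel2 e1 e2 e3 (int n)" "posdiv_triple n (c1, c2, c3)"
    "sel_equiv e1 e2 e3 (int n) (c1, c2, c3) (d1, d2, d3)"
proof (cases "odd d1 \<and> odd d2 \<and> odd d3")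
  case True
  then show thesis using posdiv_representative_odd[OF card S] that by blast
next
  case False
  have S': "squarefree d1" "squarefree d2" "squarefree d3" "is_square (d1*d2*d3)" using S unfolding Sel2_iff by blast+
  have d0: "d1 \<noteq> 0" "d2 \<noteq> 0" "d3 \<noteq> 0" using S'(1-3) by auto
  have e': "e2 + e3 + e1 = 0" "e3 + e1 + e2 = 0" using e by simp_all
  note S2 = Sel2_rotate[OF e S] 
  note S3 = Sel2_rotate[OF e'(1) S2]
  have i2: "int 2 = 2" by simp
  \<comment> \<open>e1, e2 and n are odd, so 2 cannot divide either of these pairs; only the pair
    d1, d2, which belongs to the even e3, remains.\<close>
  have "\<not> (even d2 \<and> even d3)" "\<not> (even d3 \<and> even d1)"
    using Sel2_unramified[OF e'(1) S2 two_is_prime_nat] Sel2_unramified[OF e'(2) S3 two_is_prime_nat] odd_e odd_int_n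
    unfolding i2 by blast+
  then have ev: "even d1" "even d2" "odd d3" using False squarefree_square_parity[OF S' two_is_prime_nat] unfolding i2 by blast+
  \<comment> \<open>Since 2 divides e3 exactly once, the torsion entries -e3 n and -e1 e3 have
    valuation one at 2 and cancel the factors 2 of d1 and d2, while e1 n is odd.\<close>
  obtain b1 b2 b3 where b: "(b1, b2, b3) \<in> Sel2 e1 e2 e3 (int n)"
    "is_square (b1 * d1 * (-e3*int n))" "is_square (b2 * d2 * (-e1*e3))" "is_square (b3 * d3 * (e1*int n))"
    by (rule Sel2_translate1[OF e nz(1,3,4) S])
  have sb: "squarefree b1" "squarefree b2" "squarefree b3" using b(1) unfolding Sel2_iff by blast+
  note m3 = multiplicity_two_twice_odd[OF e3]
  have mo: "multiplicity 2 e1 = 0" "multiplicity 2 (int n) = 0" "multiplicity 2 d3 = 0"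
    using odd_e odd_int_n ev by (simp_all add: not_dvd_imp_multiplicity_0)
  have md: "multiplicity 2 d1 = 1" "multiplicity 2 d2 = 1"
    using squarefree_multiplicity[OF S'(1) two_is_prime_nat] squarefree_multiplicity[OF S'(2) two_is_prime_nat] ev by simp_all
  note mm = multiplicity_two_mult
  have "odd b1"
  proof (rule square_factor_odd[of _ "d1 * (e3 * -int n)"])
    show "is_square (b1 * (d1 * (e3 * -int n)))" using b(2) by (simp add: mult_ac)
    show "even (multiplicity 2 (d1 * (e3 * -int n)))" using d0 nz by (simp add: mm md mo m3)
  qed (use sb d0 nz in simp_all)
  moreover have "odd b2"
  proof (rule square_factor_odd[of _ "d2 * (-e1*e3)"])
    show "is_square (b2 * (d2 * (-e1*e3)))" using b(3) by (simp add: mult_ac)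
    show "even (multiplicity 2 (d2 * (-e1*e3)))" using d0 nz by (simp add: mm md mo m3)
  qed (use sb d0 nz in simp_all)
  moreover have "odd b3"
  proof (rule square_factor_odd[of _ "d3 * (e1*int n)"])
    show "is_square (b3 * (d3 * (e1*int n)))" using b(4) by (simp add: mult_ac)
    show "even (multiplicity 2 (d3 * (e1*int n)))" using d0 nz by (simp add: mm mo)
  qed (use sb d0 nz in simp_all)
  ultimately obtain c1 c2 c3 where c: "(c1, c2, c3) \<in> Sel2 e1 e2 e3 (int n)" "posdiv_triple n (c1, c2, c3)"
    "sel_equiv e1 e2 e3 (int n) (c1, c2, c3) (b1, b2, b3)" using posdiv_representative_odd[OF card b(1)] by blast
  have "sel_equiv e1 e2 e3 (int n) (b1, b2, b3) (d1, d2, d3)" unfolding sel_equiv_iff using b by blast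
  then have db: "sel_equiv e1 e2 e3 (int n) (d1, d2, d3) (b1, b2, b3)" by (rule sel_equiv_sym)
  have b0: "b1 \<noteq> 0" "b2 \<noteq> 0" "b3 \<noteq> 0" using sb by auto
  show thesis by (rule that[OF c(1,2) sel_equiv_euclidean[OF nz b0 c(3) db]])
qed

lemma posdiv_tripleD:
  assumes "posdiv_triple n (d1, d2, d3)"
  shows "0 < d1" "d1 dvd int n" "0 < d2" "d2 dvd int n" "0 < d3" "d3 dvd int n"
  using assms unfolding posdiv_triple_def by auto

lemma posdiv_equiv_unique:
  assumes A: "posdiv_triple n (a1, a2, a3)" and B: "posdiv_triple n (b1, b2, b3)"
    and E: "sel_equiv e1 e2 e3 (int n) (a1, a2, a3) (b1, b2, b3)"
  shows "(a1, a2, a3) = (b1, b2, b3)"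
proof -
  note a = posdiv_tripleD[OF A] and b = posdiv_tripleD[OF B]
  have sf: "squarefree a1" "squarefree a2" "squarefree a3" "squarefree b1" "squarefree b2" "squarefree b3"
    using squarefree_n a b squarefree_mono by blast+
  note m3 = multiplicity_two_twice_odd[OF e3]
  have od: "odd a1" "odd b1" using a b odd_int_n dvd_trans by blast+
  have mo: "multiplicity 2 e2 = 0" "multiplicity 2 (int n) = 0"
    using odd_e odd_int_n by (simp_all add: not_dvd_imp_multiplicity_0)
  note mm = multiplicity_two_mult
  from E consider "is_square (a1*b1)" "is_square (a2*b2)" "is_square (a3*b3)"
    | "is_square (a1*b1*(-e3*int n))" | "is_square (a1*b1*(-e2*e3))" | "is_square (a3*b3*(-e1*e2))"
    unfolding sel_equiv_iff by blast
  then show ?thesis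
  proof cases
    case 1
    then show ?thesis using squarefree_eqI sf a b by auto
  next
    case 2
    \<comment> \<open>The torsion entry has odd valuation at 2, whereas divisors of n are
      odd.\<close>
    have "even (a1*b1)" by (rule square_factor_even[OF 2]) (use nz a b in \<open>simp_all add: mm m3 mo\<close>)
    then show ?thesis using od by simp
  next
    case 3
    have "even (a1*b1)" by (rule square_factor_even[OF 3]) (use nz a b in \<open>simp_all add: mm m3 mo\<close>)
    then show ?thesis using od by simp
  next
    case 4
    \<comment> \<open>-e1 e2 is coprime to the divisors a3 and b3 of n, so squareness of a3 b3 (-e1
      e2) would pass to -e1 e2 itself.\<close>
    have "coprime x (e1*e2)" if "x dvd int n" for x
    proof -
      have "coprime (int n) (e1*e2)" using cop by simp
      then show ?thesis using that coprime_divisors dvd_refl by blast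
    qed
    then have "coprime (a3*b3) (-e1*e2)" using a b by simp
    then have "is_square (-e1*e2)" using 4 a b nz by (intro is_square_coprime[OF 4]) simp_all
    then show ?thesis using minus_prod_not_square[OF e odd_e e3] by blast
  qed
qed

end

section \<open>The kernel of the matrix\<close>

text \<open>Arithmetic in F_2 is expressed by parity of sums of natural numbers; this allows
  summands to be changed modulo 2, as the \<open>mod 2\<close> in \<open>selmat\<close> and
  \<open>vadd2\<close> requires.\<close>

lemma even_sum_cong:
  fixes f g :: "'a \<Rightarrow> nat"
  assumes "\<And>j. j \<in> A \<Longrightarrow> even (f j) \<longleftrightarrow> even (g j)"
  shows "even (sum f A) \<longleftrightarrow> even (sum g A)"
  using assms by (induction A rule: infinite_finite_induct) auto

lemma sum_lessThan_add:
  fixes f :: "nat \<Rightarrow> nat"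
  shows "(\<Sum>j<a+b. f j) = (\<Sum>j<a. f j) + (\<Sum>j<b. f (a+j))"
  by (induction b) (simp_all add: add.assoc)

lemma sum_nth_distinct:
  assumes "distinct xs"
  shows "(\<Sum>j<length xs. f (xs ! j)) = (\<Sum>x\<in>set xs. f x)"
  using sum.reindex_bij_betw[OF bij_betw_nth[OF assms refl refl], of f] .

lemma sum_matD: "i < k \<Longrightarrow> (\<Sum>j<k. matD u ps i j * c j) = qr_bit u (ps ! i) * c i"
  unfolding matD_def by (subst sum.remove[of _ i]) (auto intro!: sum.neutral)

lemma selmat_row_upper:
  assumes i: "i < length ps" and v: "length xs = length ps" "length ys = length ps"
  shows "even (\<Sum>j<2 * length ps. selmat e1 e2 e3 ps i j * (xs @ ys) ! j) \<longleftrightarrow>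
    even ((\<Sum>j<length ps. matA ps i j * xs ! j) + qr_bit (-e3) (ps ! i) * xs ! i + qr_bit (-e2*e3) (ps ! i) * ys ! i)"
proof -
  let ?k = "length ps"
  have "(\<Sum>j<2*?k. selmat e1 e2 e3 ps i j * (xs @ ys) ! j)
      = (\<Sum>j<?k. selmat e1 e2 e3 ps i j * (xs @ ys) ! j) + (\<Sum>j<?k. selmat e1 e2 e3 ps i (?k+j) * (xs @ ys) ! (?k+j))"
    unfolding mult_2 by (rule sum_lessThan_add)
  moreover have "even (\<Sum>j<?k. selmat e1 e2 e3 ps i j * (xs @ ys) ! j)
      \<longleftrightarrow> even (\<Sum>j<?k. matA ps i j * xs ! j + matD (-e3) ps i j * xs ! j)"
    by (rule even_sum_cong) (use i v in \<open>auto simp: selmat_def Let_def nth_append\<close>)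
  moreover have "(\<Sum>j<?k. selmat e1 e2 e3 ps i (?k+j) * (xs @ ys) ! (?k+j)) = (\<Sum>j<?k. matD (-e2*e3) ps i j * ys ! j)"
    by (rule sum.cong) (use i v in \<open>auto simp: selmat_def Let_def nth_append\<close>)
  ultimately show ?thesis by (simp add: sum.distrib sum_matD[OF i] del: mult_minus_left)
qed

lemma selmat_row_lower:
  assumes i: "i < length ps" and v: "length xs = length ps" "length ys = length ps"
  shows "even (\<Sum>j<2 * length ps. selmat e1 e2 e3 ps (length ps + i) j * (xs @ ys) ! j) \<longleftrightarrow>
    even (qr_bit (-e1*e3) (ps ! i) * xs ! i + (\<Sum>j<length ps. matA ps i j * ys ! j) + qr_bit e3 (ps ! i) * ys ! i)"
proof -
  let ?k = "length ps"
  have "(\<Sum>j<2*?k. selmat e1 e2 e3 ps (?k + i) j * (xs @ ys) ! j)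
      = (\<Sum>j<?k. selmat e1 e2 e3 ps (?k + i) j * (xs @ ys) ! j) + (\<Sum>j<?k. selmat e1 e2 e3 ps (?k + i) (?k+j) * (xs @ ys) ! (?k+j))"
    unfolding mult_2 by (rule sum_lessThan_add)
  moreover have "even (\<Sum>j<?k. selmat e1 e2 e3 ps (?k + i) (?k+j) * (xs @ ys) ! (?k+j))
      \<longleftrightarrow> even (\<Sum>j<?k. matA ps i j * ys ! j + matD e3 ps i j * ys ! j)"
    by (rule even_sum_cong) (use i v in \<open>auto simp: selmat_def Let_def nth_append\<close>)
  moreover have "(\<Sum>j<?k. selmat e1 e2 e3 ps (?k + i) j * (xs @ ys) ! j) = (\<Sum>j<?k. matD (-e1*e3) ps i j * xs ! j)"
    by (rule sum.cong) (use i v in \<open>auto simp: selmat_def Let_def nth_append\<close>)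
  ultimately show ?thesis by (simp add: sum.distrib sum_matD[OF i] add.assoc del: mult_minus_left)
qed

lemma kerF2_vadd2:
  assumes v: "v \<in> kerF2 M K" and w: "w \<in> kerF2 M K"
  shows "vadd2 v w \<in> kerF2 M K"
proof -
  have l: "length v = K" "length w = K" using v w unfolding kerF2_def by auto
  have "even (\<Sum>j<K. M i j * vadd2 v w ! j)" if i: "i < K" for i
  proof -
    have "even (\<Sum>j<K. M i j * vadd2 v w ! j) \<longleftrightarrow> even (\<Sum>j<K. M i j * v ! j + M i j * w ! j)"
      by (rule even_sum_cong) (use l in \<open>auto simp: vadd2_def\<close>)
    also have "\<dots> \<longleftrightarrow> even ((\<Sum>j<K. M i j * v ! j) + (\<Sum>j<K. M i j * w ! j))" by (simp add: sum.distrib)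
    finally show ?thesis using v w i unfolding kerF2_def by simp
  qed
  moreover have "x \<in> {0, 1}" if "x \<in> set (vadd2 v w)" for x
    using that unfolding vadd2_def by (auto simp: set_zip)
  ultimately show ?thesis using l unfolding kerF2_def by (auto simp: vadd2_def)
qed

lemma sqmul_eq:
  assumes "a > 0" "b > 0"
  shows "a * b = (gcd a b)^2 * sqmul a b"
proof -
  have "(gcd a b)^2 dvd a * b" by (simp add: power2_eq_square mult_dvd_mono)
  then show ?thesis unfolding sqmul_def by simp
qed

text \<open>With g = gcd a b, a = g a' and b = g b', the value is a' b', a product of coprime
  divisors of n.\<close>

lemma sqmul_posdiv:
  assumes a: "a > 0" "a dvd n" and b: "b > 0" "b dvd (n::int)"
  shows "sqmul a b > 0" "sqmul a b dvd n"
proof -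
  let ?g = "gcd a b"
  have g: "?g > 0" using a by (simp add: gcd_pos_int)
  obtain a' b' where ab: "a = ?g * a'" "b = ?g * b'" by (metis dvdE gcd_dvd1 gcd_dvd2)
  have cop: "coprime a' b'"
  proof -
    have "a div ?g = a'" "b div ?g = b'" using ab g by (metis nonzero_mult_div_cancel_left less_irrefl)+
    then show ?thesis using div_gcd_coprime[of a b] a by auto
  qed
  have "?g^2 * sqmul a b = ?g * a' * (?g * b')" using sqmul_eq[OF a(1) b(1)] ab by metis
  also have "\<dots> = ?g^2 * (a' * b')" by (simp add: power2_eq_square mult_ac)
  finally have eq: "sqmul a b = a' * b'" using a(1) by auto
  have "a' dvd a" "b' dvd b" using ab by (metis dvd_triv_right)+
  then have "a' dvd n" "b' dvd n" using a b dvd_trans by blast+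
  then show "sqmul a b dvd n" unfolding eq using cop by (simp add: divides_mult)
  have "0 < ?g^2 * sqmul a b" unfolding sqmul_eq[OF a(1) b(1), symmetric] using a b by simp
  then show "sqmul a b > 0" using g by (simp add: zero_less_mult_iff)
qed

lemma multiplicity_sqmul:
  assumes p: "prime p" and ab: "a > 0" "b > 0"
  shows "multiplicity (int p) (sqmul a b) mod 2 = (multiplicity (int p) a mod 2 + multiplicity (int p) b mod 2) mod 2"
proof -
  have g: "gcd a b \<noteq> 0" using ab by simp
  have s: "sqmul a b \<noteq> 0" using sqmul_eq[OF ab] ab by auto
  have "multiplicity (int p) a + multiplicity (int p) b = multiplicity (int p) ((gcd a b)^2 * sqmul a b)"
    unfolding sqmul_eq[OF ab, symmetric] using multiplicity_mult_prime[OF p] ab by simp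
  also have "\<dots> = 2 * multiplicity (int p) (gcd a b) + multiplicity (int p) (sqmul a b)"
    using multiplicity_mult_prime[OF p, of "(gcd a b)^2"] p g s by (simp add: prime_elem_multiplicity_power_distrib)
  finally have "(multiplicity (int p) a + multiplicity (int p) b) mod 2 = multiplicity (int p) (sqmul a b) mod 2" by simp
  then show ?thesis by (simp add: mod_add_eq)
qed

context quadratic_twist
begin

text \<open>With k = length of \<open>ps\<close>, rows i and k + i together express the local
  condition at the i-th prime.\<close>

lemma posdiv_in_Sel2_iff_kernel:
  assumes L: "posdiv_triple n (d1, d2, d3)" and sq: "is_square (d1*d2*d3)"
  shows "(d1, d2, d3) \<in> Sel2 e1 e2 e3 (int n) \<longleftrightarrow>
    phi ps (d1, d2, d3) \<in> kerF2 (selmat e1 e2 e3 ps) (2 * length ps)"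
proof -
  let ?k = "length ps"
  note d = posdiv_tripleD[OF L]
  have sf: "squarefree d1" "squarefree d2" using squarefree_n d squarefree_mono by blast+
  define xs ys where "xs = map (\<lambda>p. multiplicity (int p) d1 mod 2) ps" and "ys = map (\<lambda>p. multiplicity (int p) d2 mod 2) ps"
  have phi: "phi ps (d1, d2, d3) = xs @ ys" unfolding phi_def xs_def ys_def by simp
  have l: "length xs = ?k" "length ys = ?k" unfolding xs_def ys_def by simp_all
  have xi: "xs ! i = multiplicity (int (ps ! i)) d1" "ys ! i = multiplicity (int (ps ! i)) d2" if "i < ?k" for i
    using that squarefree_multiplicity[OF sf(1) ps_prime[OF nth_mem[OF that]]]
      squarefree_multiplicity[OF sf(2) ps_prime[OF nth_mem[OF that]]] unfolding xs_def ys_def by simp_all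
  have A1: "(\<Sum>j<?k. matA ps i j * xs ! j) = (\<Sum>q\<in>set ps. hilb (ps ! i) (int q) (- int (prod_list ps)) * multiplicity (int q) d1)" for i
    unfolding sum_nth_distinct[OF ps(1), symmetric] by (rule sum.cong) (simp_all add: matA_def xi)
  have A2: "(\<Sum>j<?k. matA ps i j * ys ! j) = (\<Sum>q\<in>set ps. hilb (ps ! i) (int q) (- int (prod_list ps)) * multiplicity (int q) d2)" for i
    unfolding sum_nth_distinct[OF ps(1), symmetric] by (rule sum.cong) (simp_all add: matA_def xi)
  have R: "D_padic_point (ps ! i) e1 e2 e3 (int n) (d1, d2, d3) \<longleftrightarrow>
     even (\<Sum>j<2 * ?k. selmat e1 e2 e3 ps i j * (xs @ ys) ! j) \<and>
     even (\<Sum>j<2 * ?k. selmat e1 e2 e3 ps (?k + i) j * (xs @ ys) ! j)" if i: "i < ?k" for i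
  proof -
    have p: "ps ! i \<in> set ps" using i by simp
    have ne: "\<not> int (ps ! i) dvd e1" "\<not> int (ps ! i) dvd e2" "\<not> int (ps ! i) dvd e3" using ps_not_dvd[OF p] by blast+
    show ?thesis unfolding selmat_row_upper[OF i l] selmat_row_lower[OF i l] A1 A2 xi[OF i] n
      by (rule D_padic_point_iff_rows[OF ps p ps_odd[OF p] e ne d[unfolded n] sq])
  qed
  have "(d1, d2, d3) \<in> Sel2 e1 e2 e3 (int n) \<longleftrightarrow> (\<forall>p\<in>set ps. D_padic_point p e1 e2 e3 (int n) (d1, d2, d3))"
    by (rule posdiv_in_Sel2_iff[OF d sq])
  also have "\<dots> \<longleftrightarrow> (\<forall>i<?k. D_padic_point (ps ! i) e1 e2 e3 (int n) (d1, d2, d3))" by (simp add: all_set_conv_all_nth)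
  also have "\<dots> \<longleftrightarrow> (\<forall>i<2 * ?k. even (\<Sum>j<2 * ?k. selmat e1 e2 e3 ps i j * (xs @ ys) ! j))"
  proof
    assume H: "\<forall>i<?k. D_padic_point (ps ! i) e1 e2 e3 (int n) (d1, d2, d3)"
    show "\<forall>i<2 * ?k. even (\<Sum>j<2 * ?k. selmat e1 e2 e3 ps i j * (xs @ ys) ! j)"
    proof (intro allI impI)
      fix i assume i: "i < 2 * ?k"
      show "even (\<Sum>j<2 * ?k. selmat e1 e2 e3 ps i j * (xs @ ys) ! j)"
      proof (cases "i < ?k")
        case True
        then show ?thesis using R H by blast
      next
        case False
        then obtain i' where i': "i = ?k + i'" using le_Suc_ex not_less by blast
        then have "i' < ?k" using i by simp
        then show ?thesis using R[of i'] H unfolding i' by blast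
      qed
    qed
  next
    assume H: "\<forall>i<2 * ?k. even (\<Sum>j<2 * ?k. selmat e1 e2 e3 ps i j * (xs @ ys) ! j)"
    show "\<forall>i<?k. D_padic_point (ps ! i) e1 e2 e3 (int n) (d1, d2, d3)"
    proof (intro allI impI)
      fix i assume i: "i < ?k"
      then have "i < 2 * ?k" "?k + i < 2 * ?k" by simp_all
      then show "D_padic_point (ps ! i) e1 e2 e3 (int n) (d1, d2, d3)" using R[OF i] H by blast
    qed
  qed
  also have "\<dots> \<longleftrightarrow> phi ps (d1, d2, d3) \<in> kerF2 (selmat e1 e2 e3 ps) (2 * ?k)"
    unfolding phi kerF2_def using l by (auto simp: xs_def ys_def)
  finally show ?thesis .
qed

abbreviation "PSel \<equiv> {L \<in> Sel2 e1 e2 e3 (int n). posdiv_triple n L}"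

text \<open>Additivity of \<open>phi\<close> is shown first. Membership of the product then follows
  because the kernel is closed under addition.\<close>

lemma phi_mul3:
  assumes "L \<in> PSel" "L' \<in> PSel"
  shows "mul3 L L' \<in> PSel" "phi ps (mul3 L L') = vadd2 (phi ps L) (phi ps L')"
proof -
  obtain a1 a2 a3 b1 b2 b3 where L: "L = (a1, a2, a3)" "L' = (b1, b2, b3)" by (metis prod_cases3)
  have pd: "posdiv_triple n (a1, a2, a3)" "posdiv_triple n (b1, b2, b3)" using assms(1,2) unfolding L by auto
  note a = posdiv_tripleD[OF pd(1)] and b = posdiv_tripleD[OF pd(2)]
  have M: "mul3 (a1, a2, a3) (b1, b2, b3) = (sqmul a1 b1, sqmul a2 b2, sqmul a3 b3)" unfolding mul3_def by simp
  show ph: "phi ps (mul3 L L') = vadd2 (phi ps L) (phi ps L')"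
  proof (rule nth_equalityI)
    show "length (phi ps (mul3 L L')) = length (vadd2 (phi ps L) (phi ps L'))"
      unfolding L M phi_def vadd2_def by simp
    fix i assume "i < length (phi ps (mul3 L L'))"
    then have i: "i < length ps + length ps" unfolding L M phi_def by simp
    have ms: "multiplicity (int (ps ! j)) (sqmul a b) mod 2 = (multiplicity (int (ps ! j)) a mod 2 + multiplicity (int (ps ! j)) b mod 2) mod 2"
      if "j < length ps" "a > 0" "b > 0" for j a b
      by (rule multiplicity_sqmul[OF ps_prime[OF nth_mem[OF that(1)]] that(2,3)])
    show "phi ps (mul3 L L') ! i = vadd2 (phi ps L) (phi ps L') ! i"
      unfolding L M phi_def vadd2_def using i a b by (auto simp: nth_append ms)
  qed
  have P: "posdiv_triple n (sqmul a1 b1, sqmul a2 b2, sqmul a3 b3)"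
    unfolding posdiv_triple_def using sqmul_posdiv a b by simp
  have sa: "is_square (a1*a2*a3)" "is_square (b1*b2*b3)" using assms unfolding L by (simp_all add: Sel2_iff)
  then obtain k l where k: "a1*a2*a3 = k^2" "b1*b2*b3 = l^2" unfolding is_square_def by blast
  let ?G = "gcd a1 b1 * gcd a2 b2 * gcd a3 b3"
  have "?G^2 * (sqmul a1 b1 * sqmul a2 b2 * sqmul a3 b3)
     = ((gcd a1 b1)^2 * sqmul a1 b1) * ((gcd a2 b2)^2 * sqmul a2 b2) * ((gcd a3 b3)^2 * sqmul a3 b3)"
    by (simp add: power_mult_distrib mult_ac)
  also have "\<dots> = (a1*b1) * (a2*b2) * (a3*b3)" using sqmul_eq a b by simp
  also have "\<dots> = (a1*a2*a3) * (b1*b2*b3)" by (simp add: mult_ac)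
  also have "\<dots> = (k*l)^2" unfolding k by (simp add: power_mult_distrib)
  finally have "is_square (?G^2 * (sqmul a1 b1 * sqmul a2 b2 * sqmul a3 b3))" unfolding is_square_def by blast
  moreover have "?G \<noteq> 0" using a by simp
  ultimately have sq: "is_square (sqmul a1 b1 * sqmul a2 b2 * sqmul a3 b3)" by (rule is_square_cancel[rotated])
  have "phi ps L \<in> kerF2 (selmat e1 e2 e3 ps) (2 * length ps)" "phi ps L' \<in> kerF2 (selmat e1 e2 e3 ps) (2 * length ps)"
    using posdiv_in_Sel2_iff_kernel[OF _ sa(1)] posdiv_in_Sel2_iff_kernel[OF _ sa(2)] assms unfolding L by auto
  then have "phi ps (mul3 L L') \<in> kerF2 (selmat e1 e2 e3 ps) (2 * length ps)" unfolding ph by (rule kerF2_vadd2)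
  then show "mul3 L L' \<in> PSel" using posdiv_in_Sel2_iff_kernel[OF P sq] P unfolding L M by simp
qed

text \<open>Exponents modulo 2 fix the squarefree divisors d1 and d2; d3 is then the positive
  squarefree number in the square class of d1 d2.\<close>

lemma phi_inj: "inj_on (phi ps) PSel"
proof (rule inj_onI)
  fix L L' assume H: "L \<in> PSel" "L' \<in> PSel" "phi ps L = phi ps L'"
  obtain a1 a2 a3 b1 b2 b3 where L: "L = (a1, a2, a3)" "L' = (b1, b2, b3)" by (metis prod_cases3)
  have pd: "posdiv_triple n (a1, a2, a3)" "posdiv_triple n (b1, b2, b3)" using H(1,2) unfolding L by auto
  note a = posdiv_tripleD[OF pd(1)] and b = posdiv_tripleD[OF pd(2)]
  have sf: "squarefree a1" "squarefree a2" "squarefree a3" "squarefree b1" "squarefree b2" "squarefree b3"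
    using squarefree_n a b squarefree_mono by blast+
  have m: "\<forall>p\<in>set ps. multiplicity (int p) a1 mod 2 = multiplicity (int p) b1 mod 2"
    "\<forall>p\<in>set ps. multiplicity (int p) a2 mod 2 = multiplicity (int p) b2 mod 2"
    using H(3) unfolding L phi_def by auto
  have eq: "a = b" if h: "0 < a" "a dvd int n" "0 < b" "b dvd int n"
    "\<forall>p\<in>set ps. multiplicity (int p) a mod 2 = multiplicity (int p) b mod 2" for a b
  proof -
    have s: "squarefree a" "squarefree b" using squarefree_n h squarefree_mono by blast+
    have "multiplicity (int p) a = multiplicity (int p) b" if "p \<in> set ps" for p
      using h(5) that squarefree_multiplicity[OF s(1) ps_prime[OF that]] squarefree_multiplicity[OF s(2) ps_prime[OF that]]
      by (auto split: if_splits)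
    then have "(\<Prod>q\<in>set ps. int q ^ multiplicity (int q) a) = (\<Prod>q\<in>set ps. int q ^ multiplicity (int q) b)"
      by (intro prod.cong) simp_all
    then show ?thesis
      using divisor_prod_primes[OF ps h(1) h(2)[unfolded n]] divisor_prod_primes[OF ps h(3) h(4)[unfolded n]] by simp
  qed
  have 1: "a1 = b1" "a2 = b2" using eq[OF a(1,2) b(1,2) m(1)] eq[OF a(3,4) b(3,4) m(2)] by blast+
  have "is_square (a1*a2*a3)" "is_square (b1*b2*b3)" using H unfolding L by (simp_all add: Sel2_iff)
  then have "is_square (a3 * (a1*a2) * 1)" "is_square (b3 * (a1*a2) * 1)" unfolding 1 by (simp_all add: mult_ac)
  then have "is_square (a3 * b3 * 1)" by (rule is_square_chain[where w = 1]) (use a in simp_all)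
  then have "a3 = b3" using squarefree_eqI[OF sf(3,6)] a b by simp
  then show "L = L'" unfolding L 1 by simp
qed

lemma phi_image: "phi ps ` PSel = kerF2 (selmat e1 e2 e3 ps) (2 * length ps)"
proof
  show "phi ps ` PSel \<subseteq> kerF2 (selmat e1 e2 e3 ps) (2 * length ps)"
  proof
    fix v assume "v \<in> phi ps ` PSel"
    then obtain d1 d2 d3 where d: "v = phi ps (d1, d2, d3)" "(d1, d2, d3) \<in> PSel" by auto
    then have "is_square (d1*d2*d3)" by (simp add: Sel2_iff)
    then show "v \<in> kerF2 (selmat e1 e2 e3 ps) (2 * length ps)" using posdiv_in_Sel2_iff_kernel d by auto
  qed
  show "kerF2 (selmat e1 e2 e3 ps) (2 * length ps) \<subseteq> phi ps ` PSel"
  proof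
    fix v assume v: "v \<in> kerF2 (selmat e1 e2 e3 ps) (2 * length ps)"
    let ?k = "length ps"
    have lv: "length v = ?k + ?k" and sv: "set v \<subseteq> {0, 1}" using v unfolding kerF2_def by auto
    \<comment> \<open>\<open>f\<close> selects which half of \<open>v\<close> supplies the
      exponents; \<open>inv_into\<close> recovers the position of a prime in \<open>ps\<close>, so
      that d can be written as a product over a set.\<close>
    have ex: "\<exists>d. d > 0 \<and> d dvd int n \<and> (\<forall>i<?k. multiplicity (int (ps ! i)) d = v ! (f i))"
      if f: "\<And>i. i < ?k \<Longrightarrow> f i < length v" for f
    proof -
      define c where "c q = v ! f (inv_into {..<?k} ((!) ps) q)" for q
      have inj: "inj_on ((!) ps) {..<?k}" using ps(1) by (simp add: inj_on_nth)
      have c: "c (ps ! i) = v ! f i" if "i < ?k" for i unfolding c_def using inv_into_f_f[OF inj] that by simp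
      have c1: "c q \<le> 1" if q: "q \<in> set ps" for q
      proof -
        obtain i where i: "i < ?k" "q = ps ! i" using q by (metis in_set_conv_nth)
        then have "c q \<in> set v" using c f by simp
        then show ?thesis using sv by auto
      qed
      define d where "d = (\<Prod>r\<in>int ` set ps. r ^ c (nat r))"
      have dq: "d = (\<Prod>q\<in>set ps. int q ^ c q)" unfolding d_def by (subst prod.reindex) (simp_all add: inj_on_def)
      have "d > 0" unfolding dq using ps_prime by (intro prod_pos) (simp add: prime_gt_0_nat)
      moreover have "prod_list ps = \<Prod>(set ps)" by (rule prod_list_eq_prod_set[OF ps(1)])
      then have "int n = (\<Prod>q\<in>set ps. int q)" unfolding n by simp
      then have "d dvd int n" unfolding dq using c1
        by (simp only:) (rule prod_dvd_prod, metis le_imp_power_dvd power_one_right)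
      moreover have "multiplicity (int (ps ! i)) d = v ! f i" if i: "i < ?k" for i
      proof -
        have "multiplicity (int (ps ! i)) d = (if int (ps ! i) \<in> int ` set ps then c (nat (int (ps ! i))) else 0)"
          unfolding d_def by (rule multiplicity_prod_prime_powers) (use ps_prime i in auto)
        then show ?thesis using i c by simp
      qed
      ultimately show ?thesis by blast
    qed
    obtain d1 where d1: "d1 > 0" "d1 dvd int n" "\<forall>i<?k. multiplicity (int (ps ! i)) d1 = v ! i"
      using ex[of "\<lambda>i. i"] lv by auto
    obtain d2 where d2: "d2 > 0" "d2 dvd int n" "\<forall>i<?k. multiplicity (int (ps ! i)) d2 = v ! (?k + i)"
      using ex[of "\<lambda>i. ?k + i"] lv by auto
    \<comment> \<open>The forced third entry: the squarefree representative of d1 d2.\<close>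
    let ?d3 = "sqmul d1 d2"
    have P: "posdiv_triple n (d1, d2, ?d3)" unfolding posdiv_triple_def using d1 d2 sqmul_posdiv by simp
    have "d1*d2*?d3 = (gcd d1 d2 * ?d3)^2" unfolding sqmul_eq[OF d1(1) d2(1)] by (simp add: power2_eq_square mult_ac)
    then have sq: "is_square (d1*d2*?d3)" unfolding is_square_def by blast
    have v2: "v ! i mod 2 = v ! i" if "i < ?k + ?k" for i
    proof -
      have "v ! i \<in> {0, 1}" using sv lv that nth_mem by (metis subsetD)
      then show ?thesis by auto
    qed
    have ph: "phi ps (d1, d2, ?d3) = v"
    proof (rule nth_equalityI)
      show "length (phi ps (d1, d2, ?d3)) = length v" unfolding phi_def lv by simp
      fix i assume "i < length (phi ps (d1, d2, ?d3))"
      then have i: "i < ?k + ?k" unfolding phi_def by simp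
      show "phi ps (d1, d2, ?d3) ! i = v ! i"
      proof (cases "i < ?k")
        case True
        then show ?thesis unfolding phi_def using d1(3) v2[OF i] by (simp add: nth_append)
      next
        case False
        then obtain i' where i': "i = ?k + i'" using le_Suc_ex not_less by blast
        then have "i' < ?k" using i by simp
        then show ?thesis unfolding phi_def i' using d2(3) v2[OF i] i' by (simp add: nth_append)
      qed
    qed
    then have "(d1, d2, ?d3) \<in> PSel" using posdiv_in_Sel2_iff_kernel[OF P sq] P v by simp
    then show "v \<in> phi ps ` PSel" unfolding ph[symmetric] by (rule imageI)
  qed
qed

end

theorem theorem3p3:
  fixes e1 e2 e3 :: int and n :: nat and ps :: "nat list"
  assumes "e1 \<noteq> 0" and "e2 \<noteq> 0" and "e3 \<noteq> 0" and "e1 + e2 + e3 = 0"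
    and "gcd e1 (gcd e2 e3) \<in> {1, 2}"
    and "odd e1" and "odd e2" and "even e3" and "\<not> 4 dvd e3"
    and "distinct ps" and "\<forall>p \<in> set ps. prime p" and "n = prod_list ps"
    and "odd n" and "coprime (int n) (e1 * e2 * e3)"
    and "\<forall>q::nat. prime q \<longrightarrow> odd q \<longrightarrow> int q dvd e1 * e2 * e3 \<longrightarrow>
           (\<forall>p \<in> set ps. QuadRes (int q) (int p))"
    and "card (Sel2 e1 e2 e3 1) = 4"
  shows "(\<forall>L \<in> Sel2 e1 e2 e3 (int n). \<exists>!L'. L' \<in> Sel2 e1 e2 e3 (int n) \<and>
            posdiv_triple n L' \<and> sel_equiv e1 e2 e3 (int n) L' L)
    \<and> bij_betw (phi ps) {L \<in> Sel2 e1 e2 e3 (int n). posdiv_triple n L}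
         (kerF2 (selmat e1 e2 e3 ps) (2 * length ps))
    \<and> (\<forall>L \<in> {L \<in> Sel2 e1 e2 e3 (int n). posdiv_triple n L}.
         \<forall>L' \<in> {L \<in> Sel2 e1 e2 e3 (int n). posdiv_triple n L}.
           mul3 L L' \<in> {L \<in> Sel2 e1 e2 e3 (int n). posdiv_triple n L} \<and>
           phi ps (mul3 L L') = vadd2 (phi ps L) (phi ps L'))"
proof -
  interpret quadratic_twist e1 e2 e3 ps n
    by (rule quadratic_twist.intro) (fact assms)+
  have "\<exists>!L'. L' \<in> Sel2 e1 e2 e3 (int n) \<and> posdiv_triple n L' \<and> sel_equiv e1 e2 e3 (int n) L' L"
    if L: "L \<in> Sel2 e1 e2 e3 (int n)" for L
  proof -
    obtain d1 d2 d3 where d: "L = (d1, d2, d3)" by (rule prod_cases3)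
    note S = L[unfolded d]
    have d0: "d1 \<noteq> 0" "d2 \<noteq> 0" "d3 \<noteq> 0" using S unfolding Sel2_iff by auto
    obtain c1 c2 c3 where c: "(c1, c2, c3) \<in> Sel2 e1 e2 e3 (int n)" "posdiv_triple n (c1, c2, c3)"
      "sel_equiv e1 e2 e3 (int n) (c1, c2, c3) (d1, d2, d3)" by (rule posdiv_representative[OF assms(16) S])
    show ?thesis
    proof (rule ex1I[of _ "(c1, c2, c3)"])
      show "(c1, c2, c3) \<in> Sel2 e1 e2 e3 (int n) \<and> posdiv_triple n (c1, c2, c3) \<and> sel_equiv e1 e2 e3 (int n) (c1, c2, c3) L"
        unfolding d using c by blast
      fix L' assume H: "L' \<in> Sel2 e1 e2 e3 (int n) \<and> posdiv_triple n L' \<and> sel_equiv e1 e2 e3 (int n) L' L"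
      obtain b1 b2 b3 where b: "L' = (b1, b2, b3)" by (rule prod_cases3)
      \<comment> \<open>Both representatives are equivalent to \<open>L\<close>, hence to each
        other.\<close>
      have "sel_equiv e1 e2 e3 (int n) (b1, b2, b3) (c1, c2, c3)"
        using sel_equiv_euclidean[OF nz d0 _ c(3)] H unfolding b d by blast
      then show "L' = (c1, c2, c3)" using posdiv_equiv_unique c(2) H unfolding b by blast
    qed
  qed
  moreover have "bij_betw (phi ps) PSel (kerF2 (selmat e1 e2 e3 ps) (2 * length ps))"
    unfolding bij_betw_def using phi_inj phi_image by blast
  ultimately show ?thesis using phi_mul3 by blast
qed

end
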